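(* Suppose that $f_\epsilon$ is supersmooth with parameter $a>0$, i.e. there is a constant $d>0$ such that $d\le(1+t^2)^a\,|\ln(|[\mathcal{F}f_\epsilon](t)|^2)|^{-1}\le d^{-1}$ for all $t\in\mathbb{R}$, and that $f_X\in H_p$ for some $p>0$. Let $\widehat{f_Y}$ be the kernel estimator constructed using a kernel $K\in\mathcal{K}_r$ and a bandwidth $h=c\,n^{-1/(2r+1)}$, $c,r>0$. For $0\le s<p$ consider the estimator $\widehat{f_X}_s$ with threshold $\alpha=c'\{n^{-r/(2r+1)}+m^{-1/2}\}$, $c'>0$. Then $$\mathbb{E}\|\widehat{f_X}_s-f_X\|_s^2=O\big((\log n)^{-(p-s)/a}+(\log m)^{-(p-s)/a}\big)\qquad\text{as }n,m\to\infty .$$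
   Context: $\|\cdot\|$ is the norm of $L^2(\mathbb{R})$ and $[\mathcal{F}g](t)=\frac{1}{\sqrt{2\pi}}\int_{-\infty}^\infty e^{-itx}g(x)\,dx$ for $g\in L^1(\mathbb{R})\cap L^2(\mathbb{R})$, extended as a unitary operator to $L^2(\mathbb{R})$. $\mathcal{D}$ is the set of all probability densities in $L^2(\mathbb{R})$. $X$ and $\epsilon$ are independent real random variables with densities $f_X,f_\epsilon\in\mathcal{D}$, with $|[\mathcal{F}f_\epsilon](t)|^2>0$ for all $t\in\mathbb{R}$; $Y=X+\epsilon$ has density $f_Y=f_X\star f_\epsilon$ (convolution). $Y_1,\dots,Y_n$ and $\epsilon_1,\dots,\epsilon_m$ are i.i.d. samples from $f_Y$ and $f_\epsilon$, respectively; $f_\epsilon$ is unknown. For $s\in\mathbb{R}$ let $\ell_s(t):=(1+t^2)^{s/2}$, and for $s\ge0$ let $\|f\|_s^2:=\int_{-\infty}^\infty(1+t^2)^s|[\mathcal{F}f](t)|^2\,dt$ and $H_s:=\{f\in L^2(\mathbb{R}):\|f\|_s<\infty\}$. The kernel estimator with kernel $K$ and bandwidth $h>0$ is $\widehat{f_Y}(y):=\frac1{nh}\sum_{j=1}^nK\big(\frac{Y_j-y}{h}\big)$, and for $r\ge0$ $$\mathcal{K}_r:=\Big\{K\in L^1(\mathbb{R})\cap L^2(\mathbb{R}):\lim_{t\to0}\frac{|1-\sqrt{2\pi}[\mathcal{F}K](t)|}{|t|^r}=\kappa_r<\infty\Big\}.$$ Put $[\widehat{\mathcal{F}f_\epsilon}](t):=\frac{1}{m\sqrt{2\pi}}\sum_{j=1}^me^{-it\epsilon_j}$.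 For a threshold $\alpha=\alpha(n,m)>0$ the estimator $\widehat{f_X}_s$ is defined by $$\mathcal{F}\widehat{f_X}_s:=\frac{\mathcal{F}\widehat{f_Y}\cdot\overline{\widehat{\mathcal{F}f_\epsilon}}}{\sqrt{2\pi}\,|\widehat{\mathcal{F}f_\epsilon}|^2}\cdot\mathbb{1}\{|\widehat{\mathcal{F}f_\epsilon}/\ell_s|^2\ge\alpha\}.$$ Both $\ln$ and $\log$ denote the natural logarithm. *)

theory Defs
  imports "HOL-Probability.Probability"
begin

section \<open>Square-integrable functions and the Fourier transform\<close>

text \<open>Elements of \<open>L\<^sup>1\<close> and \<open>L\<^sup>2\<close> are represented by Borel functions; no quotient
  by almost-everywhere equality is taken.\<close>

definition L1 :: "(real \<Rightarrow> complex) set" where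
  "L1 = {f. integrable lborel f}"

definition L2 :: "(real \<Rightarrow> complex) set" where
  "L2 = {f. f \<in> borel_measurable lborel \<and> integrable lborel (\<lambda>x. (cmod (f x))\<^sup>2)}"

definition L2_tendsto :: "(nat \<Rightarrow> real \<Rightarrow> complex) \<Rightarrow> (real \<Rightarrow> complex) \<Rightarrow> bool" where
  "L2_tendsto u f \<longleftrightarrow>
     (\<lambda>k. \<integral>\<^sup>+x. ennreal ((cmod (u k x - f x))\<^sup>2) \<partial>lborel) \<longlonglongrightarrow> 0"

definition fourier_integral :: "(real \<Rightarrow> complex) \<Rightarrow> real \<Rightarrow> complex" where
  "fourier_integral g t =
     1 / complex_of_real (sqrt (2 * pi)) *
       (LINT x|lborel. exp (- \<i> * complex_of_real (t * x)) * g x)"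

text \<open>On \<open>L\<^sup>1 \<inter> L\<^sup>2\<close> the transform is the (pointwise defined) Fourier integral. On the rest
  of \<open>L\<^sup>2\<close> it is the extension by continuity, i.e. a representative of the \<open>L\<^sup>2\<close> limit of the
  transforms of a sequence in \<open>L\<^sup>1 \<inter> L\<^sup>2\<close> approximating the argument; by Plancherel such a limit
  exists and is unique up to null sets. Values outside \<open>L\<^sup>2\<close> have no meaning.\<close>

definition fourier :: "(real \<Rightarrow> complex) \<Rightarrow> real \<Rightarrow> complex" where
  "fourier f =
     (if f \<in> L1 \<inter> L2 then fourier_integral f
      else SOME g. g \<in> L2 \<and>
        (\<exists>u. (\<forall>k. u k \<in> L1 \<inter> L2) \<and> L2_tendsto u f \<and>
             L2_tendsto (\<lambda>k. fourier_integral (u k)) g))"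

definition ell :: "real \<Rightarrow> real \<Rightarrow> real" where
  "ell s t = (1 + t\<^sup>2) powr (s / 2)"

text \<open>The squared norm \<open>\<parallel>f\<parallel>\<^sub>s\<^sup>2\<close>, with value \<open>\<infinity>\<close> allowed.\<close>

definition sobolev_norm_sq :: "real \<Rightarrow> (real \<Rightarrow> complex) \<Rightarrow> ennreal" where
  "sobolev_norm_sq s f = (\<integral>\<^sup>+t. ennreal ((1 + t\<^sup>2) powr s * (cmod (fourier f t))\<^sup>2) \<partial>lborel)"

definition sobolev :: "real \<Rightarrow> (real \<Rightarrow> complex) set" where
  "sobolev s = {f \<in> L2. sobolev_norm_sq s f < \<infinity>}"


section \<open>Densities and samples\<close>

abbreviation cplx :: "(real \<Rightarrow> real) \<Rightarrow> real \<Rightarrow> complex" where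
  "cplx f \<equiv> (\<lambda>x. complex_of_real (f x))"

definition L2_densities :: "(real \<Rightarrow> real) set" where
  "L2_densities = {f. f \<in> borel_measurable lborel \<and> (\<forall>x. 0 \<le> f x) \<and>
     (\<integral>\<^sup>+x. ennreal (f x) \<partial>lborel) = 1 \<and> cplx f \<in> L2}"

definition convolve :: "(real \<Rightarrow> real) \<Rightarrow> (real \<Rightarrow> real) \<Rightarrow> real \<Rightarrow> real" where
  "convolve f g y = (LINT x|lborel. f (y - x) * g x)"

definition has_density :: "'a measure \<Rightarrow> ('a \<Rightarrow> real) \<Rightarrow> (real \<Rightarrow> real) \<Rightarrow> bool" where
  "has_density M Z f \<longleftrightarrow> distributed M lborel Z (\<lambda>x. ennreal (f x))"

text \<open>Samples are infinite sequences indexed from \<open>0\<close>; the sample of size \<open>n\<close> consists of the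
  members with index \<open>j < n\<close>.\<close>

definition iid_sample :: "'a measure \<Rightarrow> (nat \<Rightarrow> 'a \<Rightarrow> real) \<Rightarrow> (real \<Rightarrow> real) \<Rightarrow> bool" where
  "iid_sample M Z f \<longleftrightarrow>
     prob_space.indep_vars M (\<lambda>_. borel) Z UNIV \<and> (\<forall>j. has_density M (Z j) f)"

definition supersmooth :: "real \<Rightarrow> (real \<Rightarrow> real) \<Rightarrow> bool" where
  "supersmooth a f \<longleftrightarrow> (\<exists>d>0. \<forall>t.
     d \<le> (1 + t\<^sup>2) powr a * inverse \<bar>ln ((cmod (fourier (cplx f) t))\<^sup>2)\<bar> \<and>
     (1 + t\<^sup>2) powr a * inverse \<bar>ln ((cmod (fourier (cplx f) t))\<^sup>2)\<bar> \<le> inverse d)"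


section \<open>Estimators\<close>

definition kernel_class :: "real \<Rightarrow> (real \<Rightarrow> complex) set" where
  "kernel_class r = {K \<in> L1 \<inter> L2. \<exists>\<kappa>::real.
     ((\<lambda>t. cmod (1 - complex_of_real (sqrt (2 * pi)) * fourier K t) / \<bar>t\<bar> powr r) \<longlongrightarrow> \<kappa>) (at 0)}"

text \<open>In the following definitions \<open>y\<close> and \<open>e\<close> are realised samples.\<close>

definition kernel_estimator ::
    "(real \<Rightarrow> complex) \<Rightarrow> real \<Rightarrow> nat \<Rightarrow> (nat \<Rightarrow> real) \<Rightarrow> real \<Rightarrow> complex" where
  "kernel_estimator K h n y x =
     1 / complex_of_real (real n * h) * (\<Sum>j<n. K ((y j - x) / h))"

definition empirical_fourier :: "nat \<Rightarrow> (nat \<Rightarrow> real) \<Rightarrow> real \<Rightarrow> complex" where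
  "empirical_fourier m e t =
     1 / complex_of_real (real m * sqrt (2 * pi)) * (\<Sum>j<m. exp (- \<i> * complex_of_real (t * e j)))"

definition deconv_fourier ::
    "real \<Rightarrow> real \<Rightarrow> (real \<Rightarrow> complex) \<Rightarrow> (real \<Rightarrow> complex) \<Rightarrow> real \<Rightarrow> complex" where
  "deconv_fourier s \<alpha> fY_hat phi_hat t =
     fourier fY_hat t * cnj (phi_hat t)
       / complex_of_real (sqrt (2 * pi) * (cmod (phi_hat t))\<^sup>2)
       * indicator {t. (cmod (phi_hat t / complex_of_real (ell s t)))\<^sup>2 \<ge> \<alpha>} t"

text \<open>The deconvolution estimator is the element of \<open>L\<^sup>2\<close> with the above Fourier transform. It is
  determined up to null sets, since the Fourier transform is unitary and, for \<open>s \<ge> 0\<close> and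
  \<open>\<alpha> > 0\<close>, the prescribed transform lies in \<open>L\<^sup>2\<close>.\<close>

definition deconv_estimator ::
    "real \<Rightarrow> real \<Rightarrow> (real \<Rightarrow> complex) \<Rightarrow> (real \<Rightarrow> complex) \<Rightarrow> real \<Rightarrow> complex" where
  "deconv_estimator s \<alpha> fY_hat phi_hat =
     (SOME f. f \<in> L2 \<and> (AE t in lborel. fourier f t = deconv_fourier s \<alpha> fY_hat phi_hat t))"

end

theory Submission imports Defs begin

text \<open>
  All functions are compared on the Fourier side, where the Sobolev norms are weighted \<open>L\<^sup>2\<close> norms.
  Let \<open>u\<close> and \<open>\<Phi>\<close> be the transforms of \<open>f_X\<close> and \<open>f_\<epsilon>\<close>, so that the data density has transform
  \<open>g = sqrt (2 * pi) * u * \<Phi>\<close>, and let \<open>G\<close> and \<open>\<phi>\<close> be the estimates of \<open>g\<close> and \<open>\<Phi>\<close>. The estimator divides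
  \<open>G\<close> by \<open>sqrt (2 * pi) * \<phi>\<close> wherever \<open>\<bar>\<phi>\<bar>\<^sup>2 \<ge> \<alpha> * ell s\<^sup>2\<close>. A case distinction at each frequency
  (\<open>thresholded_quotient_error\<close>) bounds its weighted squared error by
  \<open>\<bar>G - g\<bar>\<^sup>2 / (pi * \<alpha>)\<close>, plus \<open>2 * \<bar>u\<bar>\<^sup>2 * \<bar>\<phi> - \<Phi>\<bar>\<^sup>2 / \<alpha>\<close>, plus \<open>ell s\<^sup>2 * \<bar>u\<bar>\<^sup>2\<close> restricted to the
  frequencies with \<open>\<bar>\<Phi>\<bar>\<^sup>2 < 4 * \<alpha> * ell s\<^sup>2\<close>.

  Integrated over frequencies and in expectation (\<open>deconvolution_risk\<close>), the first two terms are
  polynomially small. The empirical characteristic functions have variance at most \<open>1 / n\<close> and \<open>1 / m\<close>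
  (\<open>empirical_char_second_moment\<close>), and the kernel bias is of order \<open>h powr r\<close> against a data density that
  is smooth of every order, because the noise is supersmooth. The choices of \<open>h\<close> and \<open>\<alpha>\<close> leave
  \<open>n powr (- r / (2 * r + 1)) + m powr (- 1 / 2)\<close> (\<open>risk_rate\<close>).

  The third term dominates (\<open>cut_off_bias\<close>). Since \<open>\<bar>\<Phi>\<bar>\<^sup>2\<close> decays no faster than
  \<open>exp (- (1 + t\<^sup>2) powr a / d)\<close>, smallness of \<open>\<bar>\<Phi>\<bar>\<^sup>2\<close> forces \<open>(1 + t\<^sup>2) powr a\<close> to be at least a
  multiple of \<open>- ln (4 * \<alpha>)\<close>, which in turn is at least a multiple of \<open>min (ln n) (ln m)\<close> for large samples
  (\<open>threshold_log_lower\<close>). There \<open>(1 + t\<^sup>2) powr s\<close> is smaller than \<open>(1 + t\<^sup>2) powr p\<close> by the factor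
  \<open>(1 + t\<^sup>2) powr (- (p - s))\<close>, which yields the logarithmic rate.

  The estimator is defined only as some element of \<open>L\<^sup>2\<close> with a prescribed transform, and the transform
  itself by extension from \<open>L\<^sup>1 \<inter> L\<^sup>2\<close>. That both descriptions determine the objects up to null sets is the
  unitarity of the Fourier transform on \<open>L\<^sup>2\<close>. Plancherel's identity on \<open>L\<^sup>1 \<inter> L\<^sup>2\<close> comes from a Gaussian
  weight and continuity of translations (\<open>plancherel_L1_L2\<close>); completeness of \<open>L\<^sup>2\<close> gives the extension;
  surjectivity (\<open>fourier_surjective\<close>) holds because the adjoint is isometric as well.
\<close>

section \<open>The space of square integrable functions\<close>

definition L2_inner :: "(real \<Rightarrow> complex) \<Rightarrow> (real \<Rightarrow> complex) \<Rightarrow> complex" where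
  "L2_inner f g = (LINT x|lborel. f x * cnj (g x))"

definition L2_norm :: "(real \<Rightarrow> complex) \<Rightarrow> real" where
  "L2_norm f = sqrt (LINT x|lborel. (cmod (f x))\<^sup>2)"

lemma borel_measurable_cnj [measurable]: "cnj \<in> borel_measurable borel"
  by (intro borel_measurable_continuous_onI continuous_intros)

lemma L2_measurable: "f \<in> L2 \<Longrightarrow> f \<in> borel_measurable borel"
  by (simp add: L2_def)

lemma L2_iff_nn_integral:
  "f \<in> L2 \<longleftrightarrow> f \<in> borel_measurable borel \<and> (\<integral>\<^sup>+x. ennreal ((cmod (f x))\<^sup>2) \<partial>lborel) < \<infinity>"
  by (auto simp: L2_def integrable_iff_bounded)

lemma L2_norm_nonneg [simp]: "0 \<le> L2_norm f"
  by (simp add: L2_norm_def)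

lemma L2_norm_sq: "(L2_norm f)\<^sup>2 = (LINT x|lborel. (cmod (f x))\<^sup>2)"
  by (simp add: L2_norm_def)

lemma nn_integral_L2_norm:
  "f \<in> L2 \<Longrightarrow> (\<integral>\<^sup>+x. ennreal ((cmod (f x))\<^sup>2) \<partial>lborel) = ennreal ((L2_norm f)\<^sup>2)"
  by (simp add: L2_norm_sq L2_def nn_integral_eq_integral)

lemma cmod_mult_le_squares: "cmod (z * w) \<le> (cmod z)\<^sup>2 + (cmod w)\<^sup>2"
proof -
  have "2 * (cmod z * cmod w) \<le> (cmod z)\<^sup>2 + (cmod w)\<^sup>2"
    using sum_squares_bound[of "cmod z" "cmod w"] by (simp add: power2_eq_square)
  moreover have "0 \<le> cmod z * cmod w" by simp
  ultimately show ?thesis unfolding norm_mult by linarith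
qed

lemma integrable_L2_mult:
  assumes "f \<in> L2" "g \<in> L2"
  shows "integrable lborel (\<lambda>x. f x * g x)"
proof (rule Bochner_Integration.integrable_bound)
  show "integrable lborel (\<lambda>x. (cmod (f x))\<^sup>2 + (cmod (g x))\<^sup>2)"
    using assms by (simp add: L2_def)
  show "AE x in lborel. norm (f x * g x) \<le> norm ((cmod (f x))\<^sup>2 + (cmod (g x))\<^sup>2)"
    using cmod_mult_le_squares by (auto intro!: AE_I2)
qed (use assms in \<open>auto simp: L2_def\<close>)

lemma L2_cnj: "f \<in> L2 \<Longrightarrow> (\<lambda>x. cnj (f x)) \<in> L2"
  by (auto simp: L2_def)

lemma L2_norm_cnj [simp]: "L2_norm (\<lambda>x. cnj (f x)) = L2_norm f"
  by (simp add: L2_norm_def)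

lemma integrable_L2_inner:
  "f \<in> L2 \<Longrightarrow> g \<in> L2 \<Longrightarrow> integrable lborel (\<lambda>x. f x * cnj (g x))"
  by (intro integrable_L2_mult L2_cnj)

lemma L2_diff:
  assumes "f \<in> L2" "g \<in> L2"
  shows "(\<lambda>x. f x - g x) \<in> L2"
proof -
  have "integrable lborel (\<lambda>x. (cmod (f x - g x))\<^sup>2)"
  proof (rule Bochner_Integration.integrable_bound)
    show "integrable lborel (\<lambda>x. 2 * (cmod (f x))\<^sup>2 + 2 * (cmod (g x))\<^sup>2)"
      using assms by (simp add: L2_def)
    have "(cmod (f x - g x))\<^sup>2 \<le> 2 * (cmod (f x))\<^sup>2 + 2 * (cmod (g x))\<^sup>2" for x
    proof -
      have "(cmod (f x - g x))\<^sup>2 \<le> (cmod (f x) + cmod (g x))\<^sup>2"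
        by (intro power_mono norm_triangle_ineq4) auto
      also have "\<dots> \<le> 2 * (cmod (f x))\<^sup>2 + 2 * (cmod (g x))\<^sup>2"
        using sum_squares_bound[of "cmod (f x)" "cmod (g x)"]
        by (simp add: power2_sum)
      finally show ?thesis .
    qed
    then show "AE x in lborel. norm ((cmod (f x - g x))\<^sup>2)
        \<le> norm (2 * (cmod (f x))\<^sup>2 + 2 * (cmod (g x))\<^sup>2)"
      by auto
  qed (use assms in \<open>auto simp: L2_def\<close>)
  then show ?thesis using assms by (auto simp: L2_def)
qed

lemma L2_cmult: "f \<in> L2 \<Longrightarrow> (\<lambda>x. c * f x) \<in> L2"
  by (auto simp: L2_def norm_mult power_mult_distrib)

lemma L2_dominated:
  assumes "f \<in> L2" "g \<in> borel_measurable borel" "AE x in lborel. cmod (g x) \<le> cmod (f x)"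
  shows "g \<in> L2"
proof -
  have "integrable lborel (\<lambda>x. (cmod (g x))\<^sup>2)"
  proof (rule Bochner_Integration.integrable_bound)
    show "integrable lborel (\<lambda>x. (cmod (f x))\<^sup>2)" using assms by (simp add: L2_def)
    show "AE x in lborel. norm ((cmod (g x))\<^sup>2) \<le> norm ((cmod (f x))\<^sup>2)"
      using assms(3) by eventually_elim (simp add: power_mono)
  qed (use assms in simp)
  then show ?thesis using assms by (simp add: L2_def)
qed

lemma L2_inner_self: "L2_inner f f = complex_of_real ((L2_norm f)\<^sup>2)"
proof -
  have "L2_inner f f = (LINT x|lborel. complex_of_real ((cmod (f x))\<^sup>2))"
    unfolding L2_inner_def by (simp only: complex_norm_square)
  then show ?thesis by (simp only: integral_complex_of_real L2_norm_sq)
qed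

lemma L2_inner_commute: "L2_inner f g = cnj (L2_inner g f)"
  using Bochner_Integration.integral_cnj[of lborel "\<lambda>x. g x * cnj (f x)"]
  by (simp add: L2_inner_def mult.commute del: Bochner_Integration.integral_cnj)

lemma L2_inner_diff_left:
  "f \<in> L2 \<Longrightarrow> g \<in> L2 \<Longrightarrow> k \<in> L2 \<Longrightarrow>
    L2_inner (\<lambda>x. f x - g x) k = L2_inner f k - L2_inner g k"
  unfolding L2_inner_def by (simp add: left_diff_distrib integrable_L2_inner)

lemma L2_Cauchy_Schwarz:
  assumes "f \<in> L2" "g \<in> L2"
  shows "cmod (L2_inner f g) \<le> L2_norm f * L2_norm g"
proof -
  note [measurable] = L2_measurable[OF assms(1)] L2_measurable[OF assms(2)]
  have int: "integrable lborel (\<lambda>x. cmod (f x) * cmod (g x))"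
    using integrable_norm[OF integrable_L2_inner[OF assms]] by (simp add: norm_mult)
  have "(ennreal (LINT x|lborel. cmod (f x) * cmod (g x)))\<^sup>2
      = (\<integral>\<^sup>+x. ennreal (cmod (f x)) * ennreal (cmod (g x)) \<partial>lborel)\<^sup>2"
    by (subst nn_integral_eq_integral[symmetric, OF int]) (auto simp: ennreal_mult)
  also have "\<dots> \<le> (\<integral>\<^sup>+x. (ennreal (cmod (f x)))\<^sup>2 \<partial>lborel) * (\<integral>\<^sup>+x. (ennreal (cmod (g x)))\<^sup>2 \<partial>lborel)"
    by (rule Cauchy_Schwarz_nn_integral) measurable
  also have "\<dots> = ennreal ((L2_norm f * L2_norm g)\<^sup>2)"
    using assms by (simp add: ennreal_power nn_integral_L2_norm ennreal_mult power_mult_distrib)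
  finally have "(LINT x|lborel. cmod (f x) * cmod (g x))\<^sup>2 \<le> (L2_norm f * L2_norm g)\<^sup>2"
    by (subst (asm) ennreal_power) (auto simp: integral_nonneg_AE)
  then have "(LINT x|lborel. cmod (f x) * cmod (g x)) \<le> L2_norm f * L2_norm g"
    by (rule power2_le_imp_le) simp
  moreover have "cmod (L2_inner f g) \<le> (LINT x|lborel. cmod (f x) * cmod (g x))"
    unfolding L2_inner_def using integral_norm_bound[of lborel "\<lambda>x. f x * cnj (g x)"]
    by (simp add: norm_mult)
  ultimately show ?thesis by simp
qed

lemma L2_norm_diff_sq:
  assumes "f \<in> L2" "g \<in> L2"
  shows "(L2_norm (\<lambda>x. f x - g x))\<^sup>2 = (L2_norm f)\<^sup>2 - 2 * Re (L2_inner f g) + (L2_norm g)\<^sup>2"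
proof -
  have eq: "(cmod (f x - g x))\<^sup>2 = (cmod (f x))\<^sup>2 - 2 * Re (f x * cnj (g x)) + (cmod (g x))\<^sup>2" for x
    unfolding cmod_power2 by (simp add: algebra_simps power2_eq_square)
  have i: "integrable lborel (\<lambda>x. Re (f x * cnj (g x)))"
    using integrable_L2_inner[OF assms] by (rule integrable_Re)
  have "(L2_norm (\<lambda>x. f x - g x))\<^sup>2
      = (LINT x|lborel. (cmod (f x))\<^sup>2 - 2 * Re (f x * cnj (g x)) + (cmod (g x))\<^sup>2)"
    by (simp only: L2_norm_sq eq)
  also have "\<dots> = (L2_norm f)\<^sup>2 - 2 * (LINT x|lborel. Re (f x * cnj (g x))) + (L2_norm g)\<^sup>2"
    using assms i unfolding L2_norm_sq L2_def by (simp del: times_complex.sel)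
  also have "(LINT x|lborel. Re (f x * cnj (g x))) = Re (L2_inner f g)"
    unfolding L2_inner_def using integrable_L2_inner[OF assms] by (rule integral_Re)
  finally show ?thesis .
qed

lemma L2_norm_triangle:
  assumes "f \<in> L2" "g \<in> L2"
  shows "L2_norm (\<lambda>x. f x - g x) \<le> L2_norm f + L2_norm g"
proof (rule power2_le_imp_le)
  have "- Re (L2_inner f g) \<le> L2_norm f * L2_norm g"
    using L2_Cauchy_Schwarz[OF assms] abs_Re_le_cmod[of "L2_inner f g"] by linarith
  then show "(L2_norm (\<lambda>x. f x - g x))\<^sup>2 \<le> (L2_norm f + L2_norm g)\<^sup>2"
    using assms by (simp add: L2_norm_diff_sq power2_sum)
qed simp

lemma L2_norm_diff_ge:
  assumes "f \<in> L2" "g \<in> L2"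
  shows "\<bar>L2_norm f - L2_norm g\<bar> \<le> L2_norm (\<lambda>x. f x - g x)"
proof (rule power2_le_imp_le)
  have "Re (L2_inner f g) \<le> L2_norm f * L2_norm g"
    using L2_Cauchy_Schwarz[OF assms] abs_Re_le_cmod[of "L2_inner f g"] by linarith
  then show "(\<bar>L2_norm f - L2_norm g\<bar>)\<^sup>2 \<le> (L2_norm (\<lambda>x. f x - g x))\<^sup>2"
    using assms by (simp add: L2_norm_diff_sq power2_diff)
qed simp

lemma L2_norm_minus_commute: "L2_norm (\<lambda>x. f x - g x) = L2_norm (\<lambda>x. g x - f x)"
  by (simp add: L2_norm_def norm_minus_commute)

lemma L2_norm_triangle3:
  assumes "f \<in> L2" "g \<in> L2" "k \<in> L2"
  shows "L2_norm (\<lambda>x. f x - k x) \<le> L2_norm (\<lambda>x. f x - g x) + L2_norm (\<lambda>x. g x - k x)"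
proof -
  have "L2_norm (\<lambda>x. (f x - g x) - (k x - g x)) \<le> L2_norm (\<lambda>x. f x - g x) + L2_norm (\<lambda>x. k x - g x)"
    by (intro L2_norm_triangle L2_diff assms)
  then show ?thesis by (simp add: L2_norm_minus_commute[of k g])
qed

lemma L2_norm_zero_AE:
  assumes "f \<in> L2" "L2_norm f = 0"
  shows "AE x in lborel. f x = 0"
proof -
  have "(LINT x|lborel. (cmod (f x))\<^sup>2) = 0" using assms(2) by (simp flip: L2_norm_sq)
  then have "AE x in lborel. (cmod (f x))\<^sup>2 = 0"
    by (subst (asm) integral_nonneg_eq_0_iff_AE) (use assms in \<open>auto simp: L2_def\<close>)
  then show ?thesis by auto
qed

lemma L2_tendsto_iff_norm:
  assumes "\<And>k. u k \<in> L2" "f \<in> L2"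
  shows "L2_tendsto u f \<longleftrightarrow> (\<lambda>k. L2_norm (\<lambda>x. u k x - f x)) \<longlonglongrightarrow> 0"
proof -
  have "L2_tendsto u f \<longleftrightarrow> (\<lambda>k. ennreal ((L2_norm (\<lambda>x. u k x - f x))\<^sup>2)) \<longlonglongrightarrow> ennreal 0"
    unfolding L2_tendsto_def by (subst nn_integral_L2_norm) (auto intro: L2_diff assms)
  also have "\<dots> \<longleftrightarrow> (\<lambda>k. (L2_norm (\<lambda>x. u k x - f x))\<^sup>2) \<longlonglongrightarrow> 0"
    by (rule tendsto_ennreal_iff) auto
  also have "\<dots> \<longleftrightarrow> (\<lambda>k. L2_norm (\<lambda>x. u k x - f x)) \<longlonglongrightarrow> 0"
  proof
    assume "(\<lambda>k. (L2_norm (\<lambda>x. u k x - f x))\<^sup>2) \<longlonglongrightarrow> 0"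
    from tendsto_real_sqrt[OF this] show "(\<lambda>k. L2_norm (\<lambda>x. u k x - f x)) \<longlonglongrightarrow> 0" by simp
  next
    assume "(\<lambda>k. L2_norm (\<lambda>x. u k x - f x)) \<longlonglongrightarrow> 0"
    from tendsto_power[OF this, of 2] show "(\<lambda>k. (L2_norm (\<lambda>x. u k x - f x))\<^sup>2) \<longlonglongrightarrow> 0" by simp
  qed
  finally show ?thesis .
qed

lemma L2_norm_tendsto:
  assumes u: "\<And>k. u k \<in> L2" and f: "f \<in> L2" and "L2_tendsto u f"
  shows "(\<lambda>k. L2_norm (u k)) \<longlonglongrightarrow> L2_norm f"
proof (rule LIM_zero_cancel, rule tendsto_rabs_zero_cancel, rule tendsto_sandwich[of "\<lambda>_. 0"])
  show "(\<lambda>k. L2_norm (\<lambda>x. u k x - f x)) \<longlonglongrightarrow> 0" using assms by (simp add: L2_tendsto_iff_norm)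
  show "\<forall>\<^sub>F k in sequentially. \<bar>L2_norm (u k) - L2_norm f\<bar> \<le> L2_norm (\<lambda>x. u k x - f x)"
    using u f by (simp add: L2_norm_diff_ge)
qed auto

lemma L2_inner_tendsto_left:
  assumes u: "\<And>k. u k \<in> L2" and f: "f \<in> L2" and g: "g \<in> L2" and "L2_tendsto u f"
  shows "(\<lambda>k. L2_inner (u k) g) \<longlonglongrightarrow> L2_inner f g"
proof (rule LIM_zero_cancel, rule tendsto_norm_zero_cancel, rule tendsto_sandwich[of "\<lambda>_. 0"])
  have "(\<lambda>k. L2_norm (\<lambda>x. u k x - f x)) \<longlonglongrightarrow> 0" using assms by (simp add: L2_tendsto_iff_norm)
  from tendsto_mult_right[OF this, of "L2_norm g"]
  show "(\<lambda>k. L2_norm (\<lambda>x. u k x - f x) * L2_norm g) \<longlonglongrightarrow> 0" by simp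
  show "\<forall>\<^sub>F k in sequentially. cmod (L2_inner (u k) g - L2_inner f g)
      \<le> L2_norm (\<lambda>x. u k x - f x) * L2_norm g"
    using L2_Cauchy_Schwarz[OF L2_diff[OF u f] g] by (simp add: L2_inner_diff_left u f g)
qed auto

lemma L2_inner_tendsto_right:
  assumes u: "\<And>k. u k \<in> L2" and f: "f \<in> L2" and g: "g \<in> L2" and "L2_tendsto u f"
  shows "(\<lambda>k. L2_inner g (u k)) \<longlonglongrightarrow> L2_inner g f"
  using tendsto_cnj[OF L2_inner_tendsto_left[OF assms]] by (simp flip: L2_inner_commute)

lemma L2_tendsto_diff:
  assumes u: "\<And>k. u k \<in> L2" and v: "\<And>k. v k \<in> L2" and f: "f \<in> L2" and g: "g \<in> L2"
    and "L2_tendsto u f" "L2_tendsto v g"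
  shows "L2_tendsto (\<lambda>k x. u k x - v k x) (\<lambda>x. f x - g x)"
proof -
  have 1: "(\<lambda>k. L2_norm (\<lambda>x. u k x - f x)) \<longlonglongrightarrow> 0" "(\<lambda>k. L2_norm (\<lambda>x. v k x - g x)) \<longlonglongrightarrow> 0"
    using assms by (simp_all add: L2_tendsto_iff_norm)
  have "(\<lambda>k. L2_norm (\<lambda>x. (u k x - v k x) - (f x - g x))) \<longlonglongrightarrow> 0"
  proof (rule tendsto_sandwich[of "\<lambda>_. 0"])
    show "(\<lambda>k. L2_norm (\<lambda>x. u k x - f x) + L2_norm (\<lambda>x. v k x - g x)) \<longlonglongrightarrow> 0"
      using tendsto_add[OF 1] by simp
    show "\<forall>\<^sub>F k in sequentially. L2_norm (\<lambda>x. (u k x - v k x) - (f x - g x))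
        \<le> L2_norm (\<lambda>x. u k x - f x) + L2_norm (\<lambda>x. v k x - g x)"
    proof (intro always_eventually allI)
      fix k
      show "L2_norm (\<lambda>x. (u k x - v k x) - (f x - g x))
        \<le> L2_norm (\<lambda>x. u k x - f x) + L2_norm (\<lambda>x. v k x - g x)"
        using L2_norm_triangle[OF L2_diff[OF u f] L2_diff[OF v g], of k k] by (simp add: algebra_simps)
    qed
  qed auto
  then show ?thesis by (subst L2_tendsto_iff_norm) (auto intro: L2_diff u v f g)
qed

lemma L2_tendsto_dominated:
  assumes f: "f \<in> L2" and w: "w \<in> L2" and u[measurable]: "\<And>k. u k \<in> borel_measurable borel"
    and dom: "\<And>k. AE x in lborel. cmod (u k x - f x) \<le> cmod (w x)"
    and lim: "AE x in lborel. (\<lambda>k. u k x) \<longlonglongrightarrow> f x"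
  shows "L2_tendsto u f"
proof -
  note [measurable] = L2_measurable[OF f] L2_measurable[OF w]
  have "(\<lambda>k. \<integral>\<^sup>+x. ennreal ((cmod (u k x - f x))\<^sup>2) \<partial>lborel) \<longlonglongrightarrow> (\<integral>\<^sup>+(x::real). 0 \<partial>lborel)"
  proof (rule nn_integral_dominated_convergence[where w = "\<lambda>x. ennreal ((cmod (w x))\<^sup>2)"])
    show "(\<integral>\<^sup>+x. ennreal ((cmod (w x))\<^sup>2) \<partial>lborel) < \<infinity>" using w by (simp add: L2_iff_nn_integral)
    show "AE x in lborel. ennreal ((cmod (u k x - f x))\<^sup>2) \<le> ennreal ((cmod (w x))\<^sup>2)" for k
      using dom[of k] by eventually_elim (intro ennreal_leI power_mono, auto)
    show "AE x in lborel. (\<lambda>k. ennreal ((cmod (u k x - f x))\<^sup>2)) \<longlonglongrightarrow> 0"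
      using lim
    proof eventually_elim
      fix x assume "(\<lambda>k. u k x) \<longlonglongrightarrow> f x"
      then have "(\<lambda>k. (cmod (u k x - f x))\<^sup>2) \<longlonglongrightarrow> (cmod (f x - f x))\<^sup>2" by (intro tendsto_intros)
      then show "(\<lambda>k. ennreal ((cmod (u k x - f x))\<^sup>2)) \<longlonglongrightarrow> 0"
        by (simp flip: ennreal_0 add: tendsto_ennrealI)
    qed
  qed measurable
  then show ?thesis by (simp add: L2_tendsto_def)
qed

lemma bounded_support_L2:
  assumes "g \<in> borel_measurable borel" "\<And>x. cmod (g x) \<le> b" "\<And>x. k < \<bar>x\<bar> \<Longrightarrow> g x = 0"
  shows "g \<in> L1 \<inter> L2"
proof -
  have *: "integrable lborel (\<lambda>x::real. indicator {-k..k} x *\<^sub>R v)" for v :: "'v::{banach,second_countable_topology}"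
    by (intro integrable_indicator) (auto simp: emeasure_lborel_Icc_eq)
  have 1: "integrable lborel g"
  proof (rule Bochner_Integration.integrable_bound[OF *[of "b"]])
    show "AE x in lborel. norm (g x) \<le> norm (indicat_real {- k..k} x *\<^sub>R b)"
    proof (intro AE_I2)
      fix x
      have "0 \<le> b" using assms(2)[of 0] norm_ge_zero order.trans by blast
      then show "norm (g x) \<le> norm (indicat_real {- k..k} x *\<^sub>R b)"
        using assms(2)[of x] assms(3)[of x] by (cases "k < \<bar>x\<bar>") (auto simp: indicator_def abs_le_iff not_less)
    qed
  qed (use assms in simp)
  have 2: "integrable lborel (\<lambda>x. (cmod (g x))\<^sup>2)"
  proof (rule Bochner_Integration.integrable_bound[OF *[of "b\<^sup>2"]])
    show "AE x in lborel. norm ((cmod (g x))\<^sup>2) \<le> norm (indicat_real {- k..k} x *\<^sub>R b\<^sup>2)"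
    proof (intro AE_I2)
      fix x
      have "(cmod (g x))\<^sup>2 \<le> b\<^sup>2" by (intro power_mono assms(2)) auto
      then show "norm ((cmod (g x))\<^sup>2) \<le> norm (indicat_real {- k..k} x *\<^sub>R b\<^sup>2)"
        using assms(3)[of x] by (cases "k < \<bar>x\<bar>") (auto simp: indicator_def abs_le_iff not_less)
    qed
  qed (use assms in simp)
  show ?thesis using 1 2 assms by (simp add: L1_def L2_def)
qed

text \<open>Cutting \<open>f\<close> off outside \<open>[-k, k]\<close> makes it integrable, because there it is the product of two
  square integrable functions.\<close>
lemma L1_L2_dense:
  assumes f: "f \<in> L2"
  obtains u where "\<And>k. u k \<in> L1 \<inter> L2" "L2_tendsto u f"
proof -
  define u where "u k x = (indicator {-real k..real k} x :: complex) * f x" for k x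
  note [measurable] = L2_measurable[OF f]
  have m[measurable]: "u k \<in> borel_measurable borel" for k unfolding u_def by measurable
  have le: "cmod (u k x) \<le> cmod (f x)" for k x by (simp add: u_def indicator_def)
  have 2: "u k \<in> L2" for k by (rule L2_dominated[OF f m]) (simp add: le)
  have "integrable lborel (\<lambda>x. indicator {-real k..real k} x * f x)" for k
  proof (rule integrable_L2_mult[OF _ f])
    show "indicator {-real k..real k} \<in> L2"
      using bounded_support_L2[of "indicator {-real k..real k}" 1 "real k"] by (fastforce simp: indicator_def)
  qed
  then have 1: "u k \<in> L1" for k by (simp add: L1_def u_def[abs_def])
  have "L2_tendsto u f"
  proof (rule L2_tendsto_dominated[OF f f m])
    show "AE x in lborel. cmod (u k x - f x) \<le> cmod (f x)" for k by (simp add: u_def indicator_def)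
    have "(\<lambda>k. u k x) \<longlonglongrightarrow> f x" for x
    proof (rule tendsto_eventually)
      show "\<forall>\<^sub>F k in sequentially. u k x = f x"
        using eventually_ge_at_top[of "nat \<lceil>\<bar>x\<bar>\<rceil>"]
      proof eventually_elim
        case (elim k)
        then have "\<bar>x\<bar> \<le> real k" by linarith
        then show ?case by (auto simp: u_def indicator_def)
      qed
    qed
    then show "AE x in lborel. (\<lambda>k. u k x) \<longlonglongrightarrow> f x" by simp
  qed
  with 1 2 that show ?thesis by blast
qed

lemma std_normal_density_L2: "(\<lambda>x. complex_of_real (std_normal_density x)) \<in> L2"
proof -
  have le: "std_normal_density x \<le> 1" for x
  proof -
    have "1 / sqrt (2 * pi) * exp (- x\<^sup>2 / 2) \<le> 1 * 1"
      by (intro mult_mono) (use pi_ge_two in auto)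
    then show ?thesis by (simp add: std_normal_density_def)
  qed
  have "integrable lborel (\<lambda>x. (std_normal_density x)\<^sup>2)"
  proof (rule Bochner_Integration.integrable_bound)
    show "integrable lborel std_normal_density" by simp
    show "AE x in lborel. norm ((std_normal_density x)\<^sup>2) \<le> norm (std_normal_density x)"
      using le by (intro AE_I2) (simp add: power2_eq_square mult_left_le)
  qed simp
  then show ?thesis by (simp add: L2_def)
qed

text \<open>Multiplication by the Gaussian density, which is positive and square integrable, turns an
  \<open>L\<^sup>2\<close> Cauchy sequence into an \<open>L\<^sup>1\<close> Cauchy sequence (Cauchy--Schwarz). The latter has an almost
  everywhere convergent subsequence, and Fatou's lemma identifies its pointwise limit, divided by the
  Gaussian, as the \<open>L\<^sup>2\<close> limit of the whole sequence.\<close>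
lemma L2_complete:
  assumes u: "\<And>k. u k \<in> L2"
    and cauchy: "\<And>e. e > 0 \<Longrightarrow> \<exists>N. \<forall>i\<ge>N. \<forall>j\<ge>N. L2_norm (\<lambda>x. u i x - u j x) < e"
  obtains g where "g \<in> L2" "L2_tendsto u g"
proof -
  note [measurable] = L2_measurable[OF u]
  let ?w = "\<lambda>x. complex_of_real (std_normal_density x)"
  have w: "?w \<in> L2" by (rule std_normal_density_L2)
  define s where "s k x = u k x * ?w x" for k x
  have "\<exists>N. \<forall>i\<ge>N. \<forall>j\<ge>N. LINT x|lborel. norm (s i x - s j x) < e" if "e > 0" for e
  proof -
    have "0 < e / (L2_norm ?w + 1)" using that by (intro divide_pos_pos add_nonneg_pos) auto
    then obtain N where N: "\<forall>i\<ge>N. \<forall>j\<ge>N. L2_norm (\<lambda>x. u i x - u j x) < e / (L2_norm ?w + 1)"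
      using cauchy by blast
    have "LINT x|lborel. norm (s i x - s j x) < e" if "i \<ge> N" "j \<ge> N" for i j
    proof -
      let ?d = "\<lambda>x. complex_of_real (cmod (u i x - u j x))"
      have d: "?d \<in> L2" using L2_diff[OF u u, of i j] by (simp add: L2_def)
      have nd: "L2_norm ?d = L2_norm (\<lambda>x. u i x - u j x)" by (simp add: L2_norm_def)
      have "L2_inner ?d ?w = complex_of_real (LINT x|lborel. norm (s i x - s j x))"
        unfolding L2_inner_def
        by (subst integral_complex_of_real[symmetric])
           (simp add: s_def norm_mult flip: left_diff_distrib)
      then have "(LINT x|lborel. norm (s i x - s j x)) = cmod (L2_inner ?d ?w)"
        by (simp add: integral_nonneg_AE)
      also have "\<dots> \<le> L2_norm ?d * L2_norm ?w" by (rule L2_Cauchy_Schwarz[OF d w])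
      also have "\<dots> \<le> L2_norm ?d * (L2_norm ?w + 1)" by (intro mult_left_mono) auto
      also have "\<dots> < e"
        using N that nd by (subst pos_less_divide_eq[symmetric]) (auto simp: add_nonneg_pos)
      finally show ?thesis .
    qed
    then show ?thesis by blast
  qed
  moreover have "integrable lborel (s k)" for k
    unfolding s_def[abs_def] by (rule integrable_L2_mult[OF u w])
  ultimately obtain r where r: "strict_mono r" and ae: "AE x in lborel. Cauchy (\<lambda>i. s (r i) x)"
    using cauchy_L1_AE_cauchy_subseq[of lborel s] by blast
  define g where "g x = lim (\<lambda>i. u (r i) x)" for x
  have gm[measurable]: "g \<in> borel_measurable borel" unfolding g_def[abs_def] by measurable
  have lim: "AE x in lborel. (\<lambda>i. u (r i) x) \<longlonglongrightarrow> g x"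
    using ae
  proof eventually_elim
    fix x assume "Cauchy (\<lambda>i. s (r i) x)"
    then have "convergent (\<lambda>i. s (r i) x * (1 / ?w x))"
      by (intro convergent_mult convergent_const) (simp add: Cauchy_convergent_iff)
    moreover have "?w x \<noteq> 0" using normal_density_pos[of 1 0 x] by simp
    ultimately have "convergent (\<lambda>i. u (r i) x)" by (simp add: s_def)
    then show "(\<lambda>i. u (r i) x) \<longlonglongrightarrow> g x" by (simp add: g_def convergent_LIMSEQ_iff)
  qed
  have fatou: "(\<integral>\<^sup>+x. ennreal ((cmod (u k x - g x))\<^sup>2) \<partial>lborel) \<le> ennreal (e\<^sup>2)"
    if N: "\<forall>i\<ge>N. \<forall>j\<ge>N. L2_norm (\<lambda>x. u i x - u j x) < e" and k: "k \<ge> N" for k N e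
  proof -
    have "(\<integral>\<^sup>+x. ennreal ((cmod (u k x - g x))\<^sup>2) \<partial>lborel)
        = (\<integral>\<^sup>+x. liminf (\<lambda>i. ennreal ((cmod (u k x - u (r i) x))\<^sup>2)) \<partial>lborel)"
    proof (rule nn_integral_cong_AE)
      show "AE x in lborel. ennreal ((cmod (u k x - g x))\<^sup>2)
          = liminf (\<lambda>i. ennreal ((cmod (u k x - u (r i) x))\<^sup>2))"
        using lim
      proof eventually_elim
        fix x assume "(\<lambda>i. u (r i) x) \<longlonglongrightarrow> g x"
        then have "(\<lambda>i. ennreal ((cmod (u k x - u (r i) x))\<^sup>2)) \<longlonglongrightarrow> ennreal ((cmod (u k x - g x))\<^sup>2)"
          by (intro tendsto_ennrealI tendsto_intros)
        from lim_imp_Liminf[OF _ this]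
        show "ennreal ((cmod (u k x - g x))\<^sup>2) = liminf (\<lambda>i. ennreal ((cmod (u k x - u (r i) x))\<^sup>2))"
          by simp
      qed
    qed
    also have "\<dots> \<le> liminf (\<lambda>i. \<integral>\<^sup>+x. ennreal ((cmod (u k x - u (r i) x))\<^sup>2) \<partial>lborel)"
      by (rule nn_integral_liminf) measurable
    also have "\<dots> \<le> liminf (\<lambda>i. ennreal (e\<^sup>2))"
    proof (rule Liminf_mono)
      show "\<forall>\<^sub>F i in sequentially. (\<integral>\<^sup>+x. ennreal ((cmod (u k x - u (r i) x))\<^sup>2) \<partial>lborel) \<le> ennreal (e\<^sup>2)"
        using eventually_ge_at_top[of N]
      proof eventually_elim
        case (elim i)
        then have "N \<le> r i" using seq_suble[OF r, of i] by linarith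
        then have "L2_norm (\<lambda>x. u k x - u (r i) x) \<le> e" using N k by (simp add: less_imp_le)
        then show ?case
          by (subst nn_integral_L2_norm) (auto intro!: L2_diff u ennreal_leI power_mono)
      qed
    qed
    also have "\<dots> = ennreal (e\<^sup>2)" by (simp add: Liminf_const)
    finally show ?thesis .
  qed
  have g: "g \<in> L2"
  proof -
    obtain N where N: "\<forall>i\<ge>N. \<forall>j\<ge>N. L2_norm (\<lambda>x. u i x - u j x) < 1" using cauchy[of 1] by auto
    have "(\<lambda>x. u N x - g x) \<in> L2"
      unfolding L2_iff_nn_integral using fatou[OF N order_refl] by (auto intro: le_less_trans)
    from L2_diff[OF u[of N] this] show ?thesis by simp
  qed
  have "(\<lambda>k. L2_norm (\<lambda>x. u k x - g x)) \<longlonglongrightarrow> 0"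
  proof (rule LIMSEQ_I)
    fix e :: real assume "e > 0"
    then obtain N where N: "\<forall>i\<ge>N. \<forall>j\<ge>N. L2_norm (\<lambda>x. u i x - u j x) < e / 2"
      using cauchy[of "e / 2"] by auto
    have "L2_norm (\<lambda>x. u k x - g x) < e" if "k \<ge> N" for k
    proof -
      have "ennreal ((L2_norm (\<lambda>x. u k x - g x))\<^sup>2) \<le> ennreal ((e / 2)\<^sup>2)"
        using fatou[OF N that] by (subst (asm) nn_integral_L2_norm) (auto intro: L2_diff u g)
      then have "L2_norm (\<lambda>x. u k x - g x) \<le> e / 2"
        using \<open>e > 0\<close> by (subst (asm) ennreal_le_iff) (auto dest: power2_le_imp_le)
      then show ?thesis using \<open>e > 0\<close> by simp
    qed
    then show "\<exists>no. \<forall>n\<ge>no. norm (L2_norm (\<lambda>x. u n x - g x) - 0) < e"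
      by (intro exI[of _ N]) simp
  qed
  then have "L2_tendsto u g" using u g by (simp add: L2_tendsto_iff_norm)
  with g that show ?thesis by blast
qed

section \<open>Continuity of translations\<close>

lemma L2_norm_translate [simp]: "L2_norm (\<lambda>x. f (x - z)) = L2_norm f"
  using lborel_integral_real_affine[of 1 "\<lambda>x. (cmod (f x))\<^sup>2" "- z"] by (simp add: L2_norm_def)

lemma L2_translate: 
  assumes "f \<in> L2" shows "(\<lambda>x. f (x - z)) \<in> L2"
proof -
  note [measurable] = L2_measurable[OF assms]
  have "integrable lborel (\<lambda>x. (cmod (f (- z + 1 * x)))\<^sup>2)"
    using assms by (intro lborel_integrable_real_affine) (auto simp: L2_def)
  then show ?thesis by (simp add: L2_def)
qed

text \<open>The continuous retraction of the plane onto the disc of radius \<open>b\<close>. It bounds a function without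
  destroying its continuity.\<close>
definition clip :: "real \<Rightarrow> complex \<Rightarrow> complex" where
  "clip b w = w * complex_of_real (b / max b (cmod w))"

lemma cmod_clip: "b > 0 \<Longrightarrow> cmod (clip b w) = cmod w * (b / max b (cmod w))"
  by (simp add: clip_def norm_mult norm_divide)

lemma cmod_clip_le: "b > 0 \<Longrightarrow> cmod (clip b w) \<le> b"
  by (auto simp: cmod_clip max_def field_simps)

lemma clip_eq: "b > 0 \<Longrightarrow> cmod w \<le> b \<Longrightarrow> clip b w = w"
  by (simp add: clip_def max_def)

lemma cmod_clip_diff_le:
  assumes "b > 0" shows "cmod (clip b w - w) \<le> cmod w"
proof -
  have "clip b w - w = w * complex_of_real (b / max b (cmod w) - 1)"
    by (simp add: clip_def algebra_simps)
  moreover have "\<bar>b / max b (cmod w) - 1\<bar> \<le> 1"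
  proof -
    have "0 \<le> b / max b (cmod w)" "b / max b (cmod w) \<le> 1"
      using assms by (auto simp: le_max_iff_disj)
    then show ?thesis by linarith
  qed
  ultimately show ?thesis by (simp add: norm_mult mult_left_le del: of_real_diff of_real_divide)
qed

lemma continuous_on_clip: "b > 0 \<Longrightarrow> continuous_on UNIV (clip b)"
  unfolding clip_def[abs_def] by (intro continuous_intros) (auto simp: max_def)

lemma isCont_clip: "b > 0 \<Longrightarrow> isCont (clip b) w"
  using continuous_on_clip continuous_on_eq_continuous_at open_UNIV by blast

lemma clip_measurable [measurable]: "b > 0 \<Longrightarrow> clip b \<in> borel_measurable borel"
  by (intro borel_measurable_continuous_onI continuous_on_clip)

text \<open>The radius \<open>k + 1\<close> rather than \<open>k\<close> keeps the disc nondegenerate for \<open>k = 0\<close>.\<close>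
definition trunc :: "real \<Rightarrow> (real \<Rightarrow> complex) \<Rightarrow> real \<Rightarrow> complex" where
  "trunc k g x = indicator {-k..k} x * clip (k + 1) (g x)"

lemma cmod_cut_le: "k \<ge> 0 \<Longrightarrow> cmod (trunc k g x) \<le> k + 1"
  using cmod_clip_le[of "k + 1" "g x"] by (simp add: trunc_def norm_mult indicator_def)

lemma trunc_eq_0: "k < \<bar>x\<bar> \<Longrightarrow> trunc k g x = 0"
  by (auto simp: trunc_def indicator_def)

lemma trunc_measurable [measurable]:
  "k \<ge> 0 \<Longrightarrow> g \<in> borel_measurable borel \<Longrightarrow> trunc k g \<in> borel_measurable borel"
  unfolding trunc_def[abs_def] by (rule borel_measurable_times) (auto intro: measurable_compose[OF _ clip_measurable])

lemma indicator_L2: "(\<lambda>x. complex_of_real (b * indicator {-k..k} x)) \<in> L2"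
  using bounded_support_L2[of "\<lambda>x. complex_of_real (b * indicator {-k..k} x)" "\<bar>b\<bar>" k]
  by (fastforce simp: indicator_def)

lemma trunc_L2: "k \<ge> 0 \<Longrightarrow> g \<in> borel_measurable borel \<Longrightarrow> trunc k g \<in> L2"
  using bounded_support_L2[OF trunc_measurable cmod_cut_le trunc_eq_0] by auto

lemma trunc_tendsto:
  assumes f: "f \<in> L2"
  shows "L2_tendsto (\<lambda>k. trunc (real k) f) f"
proof (rule L2_tendsto_dominated[OF f f])
  note [measurable] = L2_measurable[OF f]
  show "trunc (real k) f \<in> borel_measurable borel" for k by simp
  show "AE x in lborel. cmod (trunc (real k) f x - f x) \<le> cmod (f x)" for k
    using cmod_clip_diff_le[of "real k + 1"] by (intro AE_I2) (auto simp: trunc_def indicator_def)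
  have "(\<lambda>k. trunc (real k) f x) \<longlonglongrightarrow> f x" for x
  proof (rule tendsto_eventually)
    show "\<forall>\<^sub>F k in sequentially. trunc (real k) f x = f x"
      using eventually_ge_at_top[of "nat \<lceil>max \<bar>x\<bar> (cmod (f x))\<rceil>"]
    proof eventually_elim
      case (elim k)
      then have "\<bar>x\<bar> \<le> real k" "cmod (f x) \<le> real k" by linarith+
      then show ?case by (auto simp: trunc_def indicator_def intro!: clip_eq)
    qed
  qed
  then show "AE x in lborel. (\<lambda>k. trunc (real k) f x) \<longlonglongrightarrow> f x" by simp
qed

text \<open>A measurable function is an almost everywhere limit of continuous functions. The truncation
  supplies the dominating function that turns this into \<open>L\<^sup>2\<close> convergence.\<close>
lemma trunc_continuous_approx:
  assumes f: "f \<in> borel_measurable borel" and k: "k \<ge> 0"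
  obtains g where "\<And>n. continuous_on UNIV (g n)" "L2_tendsto (\<lambda>n. trunc k (g n)) (trunc k f)"
proof -
  note [measurable] = f
  have "f \<in> borel_measurable lebesgue" by (rule measurable_completion) simp
  then have "f measurable_on UNIV" by (rule lebesgue_measurable_imp_measurable_on) simp
  then obtain N g where N: "negligible N" and g: "\<And>n. continuous_on UNIV (g n)"
    and lim: "\<And>x. x \<notin> N \<Longrightarrow> (\<lambda>n. g n x) \<longlonglongrightarrow> f x"
    unfolding measurable_on_def by auto
  have gm[measurable]: "g n \<in> borel_measurable borel" for n
    by (rule borel_measurable_continuous_onI[OF g])
  have "AE x in lebesgue. x \<notin> N"
    using N by (intro AE_not_in) (simp add: negligible_iff_null_sets)
  then have N': "AE x in lborel. x \<notin> N" by (simp add: AE_completion_iff)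
  have "L2_tendsto (\<lambda>n. trunc k (g n)) (trunc k f)"
  proof (rule L2_tendsto_dominated[OF _ indicator_L2])
    show "trunc k f \<in> L2" by (rule trunc_L2[OF k f])
    show "trunc k (g n) \<in> borel_measurable borel" for n using k by simp
    show "AE x in lborel. cmod (trunc k (g n) x - trunc k f x)
        \<le> cmod (complex_of_real (2 * (k + 1) * indicator {-k..k} x))" for n
    proof (intro AE_I2)
      fix x
      have "cmod (trunc k (g n) x - trunc k f x) \<le> cmod (trunc k (g n) x) + cmod (trunc k f x)"
        by (rule norm_triangle_ineq4)
      also have "\<dots> \<le> (k + 1) + (k + 1)" using k by (intro add_mono cmod_cut_le)
      finally show "cmod (trunc k (g n) x - trunc k f x)
        \<le> cmod (complex_of_real (2 * (k + 1) * indicator {-k..k} x))"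
        using k by (auto simp: trunc_def indicator_def simp del: of_real_mult of_real_add)
    qed
    show "AE x in lborel. (\<lambda>n. trunc k (g n) x) \<longlonglongrightarrow> trunc k f x"
      using N'
    proof eventually_elim
      case (elim x)
      show ?case unfolding trunc_def
        using k by (intro tendsto_mult tendsto_const isCont_tendsto_compose[OF isCont_clip lim[OF elim]]) simp
    qed
  qed
  with g that show ?thesis by blast
qed

text \<open>The truncation of a continuous function can jump only at \<open>\<plusminus>k\<close>, so its translates converge
  pointwise everywhere else.\<close>
lemma translate_trunc_tendsto:
  assumes g: "continuous_on UNIV g" and k: "k \<ge> 0" and z: "z \<longlonglongrightarrow> 0"
  shows "L2_tendsto (\<lambda>j x. trunc k g (x - z j)) (trunc k g)"
proof -
  have gm[measurable]: "g \<in> borel_measurable borel" by (rule borel_measurable_continuous_onI[OF g])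
  have [measurable]: "trunc k g \<in> borel_measurable borel" using k by simp
  obtain Z where Z: "\<And>j. \<bar>z j\<bar> \<le> Z"
    using z convergentI convergent_imp_Bseq Bseq_def by (metis real_norm_def)
  show ?thesis
  proof (rule L2_tendsto_dominated[OF _ indicator_L2])
    show "trunc k g \<in> L2" by (rule trunc_L2[OF k gm])
    show "AE x in lborel. cmod (trunc k g (x - z j) - trunc k g x)
        \<le> cmod (complex_of_real (2 * (k + 1) * indicator {-(k+Z)..k+Z} x))" for j
    proof (intro AE_I2)
      fix x
      have le: "cmod (trunc k g (x - z j) - trunc k g x) \<le> 2 * (k + 1)"
      proof -
        have "cmod (trunc k g (x - z j) - trunc k g x) \<le> cmod (trunc k g (x - z j)) + cmod (trunc k g x)"
          by (rule norm_triangle_ineq4)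
        also have "\<dots> \<le> (k + 1) + (k + 1)" using k by (intro add_mono cmod_cut_le)
        finally show ?thesis by simp
      qed
      have "0 \<le> Z" using Z[of 0] by linarith
      show "cmod (trunc k g (x - z j) - trunc k g x)
        \<le> cmod (complex_of_real (2 * (k + 1) * indicator {-(k+Z)..k+Z} x))"
      proof (cases "\<bar>x\<bar> \<le> k + Z")
        case True
        then have "x \<in> {-(k+Z)..k+Z}" by auto
        then show ?thesis using le k by (simp del: of_real_mult of_real_add)
      next
        case False
        then have "k < \<bar>x - z j\<bar>" "k < \<bar>x\<bar>" using Z[of j] \<open>0 \<le> Z\<close> by linarith+
        then show ?thesis by (simp add: trunc_eq_0)
      qed
    qed
    have "AE x in lborel. x \<noteq> k \<and> x \<noteq> - k"
      using AE_lborel_singleton[of k] AE_lborel_singleton[of "-k"] by eventually_elim auto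
    then show "AE x in lborel. (\<lambda>j. trunc k g (x - z j)) \<longlonglongrightarrow> trunc k g x"
    proof eventually_elim
      case (elim x)
      have lim: "(\<lambda>j. x - z j) \<longlonglongrightarrow> x" using tendsto_diff[OF tendsto_const z, of x] by simp
      have 1: "(\<lambda>j. clip (k + 1) (g (x - z j))) \<longlonglongrightarrow> clip (k + 1) (g x)"
        using k g lim
        by (intro isCont_tendsto_compose[OF isCont_clip] isCont_tendsto_compose[of x g])
           (auto simp: continuous_on_eq_continuous_at)
      have 2: "(\<lambda>j. indicator {-k..k} (x - z j) :: complex) \<longlonglongrightarrow> indicator {-k..k} x"
      proof (cases "\<bar>x\<bar> < k")
        case True
        then have "\<forall>\<^sub>F j in sequentially. x - z j \<in> {-k<..<k}"
          by (intro topological_tendstoD[OF lim]) auto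
        then show ?thesis
          by (intro tendsto_eventually) (use True in \<open>auto elim!: eventually_mono simp: indicator_def\<close>)
      next
        case False
        then have "\<forall>\<^sub>F j in sequentially. x - z j \<in> - {-k..k}"
          using elim by (intro topological_tendstoD[OF lim]) auto
        then show ?thesis
          by (intro tendsto_eventually) (use False elim in \<open>auto elim!: eventually_mono simp: indicator_def\<close>)
      qed
      show ?case unfolding trunc_def by (intro tendsto_mult 1 2)
    qed
  qed measurable
qed

text \<open>Translations are isometries, so it suffices to know the claim on a dense set, and truncated
  continuous functions form one. The constant \<open>e / 3\<close> below is the share of each of the three
  distances \<open>f(\<sqdot> - z)\<close> to \<open>d(\<sqdot> - z)\<close>, \<open>d(\<sqdot> - z)\<close> to \<open>d\<close>, and \<open>d\<close> to \<open>f\<close>.\<close>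
lemma L2_translation_continuous:
  assumes f: "f \<in> L2" and z: "z \<longlonglongrightarrow> 0"
  shows "L2_tendsto (\<lambda>j x. f (x - z j)) f"
proof -
  note fm[measurable] = L2_measurable[OF f]
  have "(\<lambda>j. L2_norm (\<lambda>x. f (x - z j) - f x)) \<longlonglongrightarrow> 0"
  proof (rule LIMSEQ_I)
    fix e :: real assume e: "e > 0"
    obtain k where k: "L2_norm (\<lambda>x. trunc (real k) f x - f x) < e / 6"
    proof -
      have "(\<lambda>k. L2_norm (\<lambda>x. trunc (real k) f x - f x)) \<longlonglongrightarrow> 0"
        using trunc_tendsto[OF f] f by (subst (asm) L2_tendsto_iff_norm) (auto intro: trunc_L2)
      then have "\<forall>\<^sub>F k in sequentially. L2_norm (\<lambda>x. trunc (real k) f x - f x) < e / 6"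
        using e by (intro order_tendstoD) auto
      then show ?thesis using that by (auto simp: eventually_sequentially)
    qed
    obtain g where g: "\<And>n. continuous_on UNIV (g n)"
      and lim: "L2_tendsto (\<lambda>n. trunc (real k) (g n)) (trunc (real k) f)"
      using trunc_continuous_approx[OF fm, of "real k"] by auto
    have gm: "g n \<in> borel_measurable borel" for n by (rule borel_measurable_continuous_onI[OF g])
    obtain n where n: "L2_norm (\<lambda>x. trunc (real k) (g n) x - trunc (real k) f x) < e / 6"
    proof -
      have "(\<lambda>n. L2_norm (\<lambda>x. trunc (real k) (g n) x - trunc (real k) f x)) \<longlonglongrightarrow> 0"
        using lim gm by (subst (asm) L2_tendsto_iff_norm) (auto intro: trunc_L2)
      then have "\<forall>\<^sub>F n in sequentially. L2_norm (\<lambda>x. trunc (real k) (g n) x - trunc (real k) f x) < e / 6"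
        using e by (intro order_tendstoD) auto
      then show ?thesis using that by (auto simp: eventually_sequentially)
    qed
    let ?d = "trunc (real k) (g n)"
    have d: "?d \<in> L2" by (intro trunc_L2 gm) simp
    have df: "L2_norm (\<lambda>x. ?d x - f x) < e / 3"
      using L2_norm_triangle3[OF d trunc_L2[OF _ fm, of "real k"] f] k n by simp
    have "L2_tendsto (\<lambda>j x. ?d (x - z j)) ?d" by (intro translate_trunc_tendsto g z) simp
    then have "(\<lambda>j. L2_norm (\<lambda>x. ?d (x - z j) - ?d x)) \<longlonglongrightarrow> 0"
      using d by (subst (asm) L2_tendsto_iff_norm) (auto intro: L2_translate)
    then have "\<forall>\<^sub>F j in sequentially. L2_norm (\<lambda>x. ?d (x - z j) - ?d x) < e / 3"
      using e by (intro order_tendstoD) auto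
    then obtain J where J: "\<And>j. j \<ge> J \<Longrightarrow> L2_norm (\<lambda>x. ?d (x - z j) - ?d x) < e / 3"
      by (auto simp: eventually_sequentially)
    have "L2_norm (\<lambda>x. f (x - z j) - f x) < e" if "j \<ge> J" for j
    proof -
      have "L2_norm (\<lambda>x. f (x - z j) - ?d (x - z j)) = L2_norm (\<lambda>x. ?d x - f x)"
        using L2_norm_translate[of "\<lambda>x. f x - ?d x" "z j"] by (simp add: L2_norm_minus_commute)
      then show ?thesis
        using L2_norm_triangle3[OF L2_translate[OF f] L2_translate[OF d] f, of "z j" "z j"]
          L2_norm_triangle3[OF L2_translate[OF d] d f, of "z j"] df J[OF that] by simp
    qed
    then show "\<exists>J. \<forall>j\<ge>J. norm (L2_norm (\<lambda>x. f (x - z j) - f x) - 0) < e"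
      by (intro exI[of _ J]) simp
  qed
  then show ?thesis using f by (subst L2_tendsto_iff_norm) (auto intro: L2_translate)
qed

section \<open>The Fourier integral\<close>

lemma cmod_exp_i [simp]: "cmod (exp (- (\<i> * complex_of_real r))) = 1"
  by (simp add: norm_exp_eq_Re)

lemma integrable_fourier_kernel:
  "integrable lborel f \<Longrightarrow> integrable lborel (\<lambda>x. exp (- \<i> * complex_of_real (t * x)) * f x)"
  by (rule Bochner_Integration.integrable_bound[of _ f]) (auto simp: norm_mult simp del: of_real_mult)

lemma fourier_integral_measurable [measurable]:
  assumes [measurable]: "f \<in> borel_measurable borel"
  shows "fourier_integral f \<in> borel_measurable borel"
  unfolding fourier_integral_def[abs_def] by measurable

lemma cmod_fourier_integral_le:
  "cmod (fourier_integral f t) \<le> 1 / sqrt (2 * pi) * (LINT x|lborel. cmod (f x))"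
proof -
  have "cmod (LINT x|lborel. exp (- \<i> * complex_of_real (t * x)) * f x)
      \<le> (LINT x|lborel. cmod (exp (- \<i> * complex_of_real (t * x)) * f x))"
    by (rule integral_norm_bound)
  also have "\<dots> = (LINT x|lborel. cmod (f x))" by (simp add: norm_mult del: of_real_mult)
  finally show ?thesis
    unfolding fourier_integral_def norm_mult by (intro mult_mono) (simp_all add: norm_divide)
qed

lemma fourier_integral_diff:
  assumes "integrable lborel f" "integrable lborel g"
  shows "fourier_integral (\<lambda>x. f x - g x) t = fourier_integral f t - fourier_integral g t"
  using integrable_fourier_kernel[OF assms(1), of t] integrable_fourier_kernel[OF assms(2), of t]
  by (simp add: fourier_integral_def right_diff_distrib)

lemma integrable_lborel_prod:
  fixes f g :: "real \<Rightarrow> complex"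
  assumes "integrable lborel f" "integrable lborel g"
  shows "integrable (lborel \<Otimes>\<^sub>M lborel) (\<lambda>(x, y). f x * g y)"
proof (rule lborel_pair.Fubini_integrable)
  have [measurable]: "f \<in> borel_measurable borel" "g \<in> borel_measurable borel" using assms by auto
  show "(\<lambda>(x, y). f x * g y) \<in> borel_measurable (lborel \<Otimes>\<^sub>M lborel)" by measurable
  show "integrable lborel (\<lambda>x. LINT y|lborel. cmod (case (x, y) of (x, y) \<Rightarrow> f x * g y))"
    using assms by (simp add: norm_mult)
  show "AE x in lborel. integrable lborel (\<lambda>y. case (x, y) of (x, y) \<Rightarrow> f x * g y)"
    using assms by simp
qed

text \<open>The transform is symmetric for the bilinear pairing. Up to complex conjugation this says that the
  adjoint of the transform is the inverse transform, which is how surjectivity is proved below.\<close>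
lemma fourier_integral_swap:
  assumes "integrable lborel f" "integrable lborel g"
  shows "(LINT t|lborel. fourier_integral f t * g t) = (LINT x|lborel. f x * fourier_integral g x)"
proof -
  have [measurable]: "f \<in> borel_measurable borel" "g \<in> borel_measurable borel" using assms by auto
  let ?h = "\<lambda>x t. exp (- \<i> * complex_of_real (t * x)) * (f x * g t)"
  have int: "integrable (lborel \<Otimes>\<^sub>M lborel) (\<lambda>(x, t). ?h x t)"
    by (rule Bochner_Integration.integrable_bound[OF integrable_lborel_prod[OF assms]])
       (auto simp: norm_mult simp del: of_real_mult)
  have "(LINT t|lborel. fourier_integral f t * g t)
      = (LINT t|lborel. 1 / complex_of_real (sqrt (2 * pi)) * (LINT x|lborel. ?h x t))"
  proof (intro Bochner_Integration.integral_cong refl)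
    fix t
    have "(LINT x|lborel. ?h x t) = (LINT x|lborel. exp (- \<i> * complex_of_real (t * x)) * f x * g t)"
      by (simp only: mult.assoc)
    also have "\<dots> = (LINT x|lborel. exp (- \<i> * complex_of_real (t * x)) * f x) * g t"
      by simp
    finally show "fourier_integral f t * g t
      = 1 / complex_of_real (sqrt (2 * pi)) * (LINT x|lborel. ?h x t)"
      by (simp only: fourier_integral_def mult.assoc)
  qed
  also have "\<dots> = 1 / complex_of_real (sqrt (2 * pi)) * (LINT t|lborel. LINT x|lborel. ?h x t)"
    by simp
  also have "(LINT t|lborel. LINT x|lborel. ?h x t) = (LINT x|lborel. LINT t|lborel. ?h x t)"
    by (rule lborel_pair.Fubini_integral[OF int])
  also have "1 / complex_of_real (sqrt (2 * pi)) * (LINT x|lborel. LINT t|lborel. ?h x t)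
      = (LINT x|lborel. 1 / complex_of_real (sqrt (2 * pi)) * (LINT t|lborel. ?h x t))"
    by simp
  also have "\<dots> = (LINT x|lborel. f x * fourier_integral g x)"
  proof (intro Bochner_Integration.integral_cong refl)
    fix x
    have "(LINT t|lborel. ?h x t) = (LINT t|lborel. f x * (exp (- \<i> * complex_of_real (x * t)) * g t))"
      by (simp add: mult_ac)
    also have "\<dots> = f x * (LINT t|lborel. exp (- \<i> * complex_of_real (x * t)) * g t)"
      by simp
    finally show "1 / complex_of_real (sqrt (2 * pi)) * (LINT t|lborel. ?h x t) = f x * fourier_integral g x"
      by (simp add: fourier_integral_def)
  qed
  finally show ?thesis .
qed

section \<open>Plancherel's identity\<close>

lemma std_normal_density_minus [simp]: "std_normal_density (- x) = std_normal_density x"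
  by (simp add: std_normal_density_def)

text \<open>The characteristic function of the standard normal law, rescaled and translated.\<close>
lemma fourier_integral_gaussian:
  assumes s: "s > 0"
  shows "fourier_integral (\<lambda>t. exp (\<i> * complex_of_real (t * y)) * complex_of_real (std_normal_density (s * t))) x
    = complex_of_real (std_normal_density ((x - y) / s) / s)"
proof -
  let ?n = "std_normal_density"
  have "complex_of_real (exp (- (((x - y) / s)\<^sup>2) / 2)) = (CLINT u|density lborel ?n. iexp (((y - x) / s) * u))"
    using fun_cong[OF char_std_normal_distribution, of "(y - x) / s"]
    by (simp add: char_def power_divide power2_commute[of x])
  also have "\<dots> = (CLINT u|lborel. ?n u *\<^sub>R iexp (((y - x) / s) * u))"
    by (subst integral_density) auto
  also have "\<dots> = \<bar>s\<bar> *\<^sub>R (CLINT t|lborel. ?n (0 + s * t) *\<^sub>R iexp (((y - x) / s) * (0 + s * t)))"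
    by (rule lborel_integral_real_affine) (use s in simp)
  also have "\<dots> = complex_of_real s * (CLINT t|lborel. exp (- \<i> * complex_of_real (x * t)) *
      (exp (\<i> * complex_of_real (t * y)) * complex_of_real (?n (s * t))))"
  proof -
    have "?n (0 + s * t) *\<^sub>R iexp (((y - x) / s) * (0 + s * t)) = exp (- \<i> * complex_of_real (x * t)) *
      (exp (\<i> * complex_of_real (t * y)) * complex_of_real (?n (s * t)))" for t
    proof -
      have "iexp (((y - x) / s) * (0 + s * t)) = exp (- \<i> * complex_of_real (x * t) + \<i> * complex_of_real (t * y))"
        using s by (intro arg_cong[of _ _ exp]) (simp add: field_simps)
      then show ?thesis by (simp only: exp_add scaleR_conv_of_real add_0) (simp only: mult_ac)
    qed
    then show ?thesis using s by (simp only: scaleR_conv_of_real abs_of_pos)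
  qed
  finally have *: "(CLINT t|lborel. exp (- \<i> * complex_of_real (x * t)) *
      (exp (\<i> * complex_of_real (t * y)) * complex_of_real (?n (s * t))))
      = complex_of_real (exp (- (((x - y) / s)\<^sup>2) / 2)) / complex_of_real s"
    using s by (simp add: field_simps)
  show ?thesis unfolding fourier_integral_def * by (simp add: std_normal_density_def)
qed

lemma integrable_scaled_gaussian:
  "s > 0 \<Longrightarrow> integrable lborel (\<lambda>t. std_normal_density (s * t))"
  using lborel_integrable_real_affine[of std_normal_density s 0] by simp

lemma integrable_mult_gaussian:
  fixes g :: "real \<Rightarrow> complex"
  assumes s: "s > 0" and [measurable]: "g \<in> borel_measurable borel" and b: "\<And>t. cmod (g t) \<le> b"
  shows "integrable lborel (\<lambda>t. g t * complex_of_real (std_normal_density (s * t)))"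
proof (rule Bochner_Integration.integrable_bound)
  show "integrable lborel (\<lambda>t. b * std_normal_density (s * t))"
    using integrable_scaled_gaussian[OF s] by simp
  have "0 \<le> b" using b[of 0] norm_ge_zero order.trans by blast
  then show "AE t in lborel. cmod (g t * complex_of_real (std_normal_density (s * t)))
      \<le> norm (b * std_normal_density (s * t))"
    using b by (intro AE_I2) (simp add: norm_mult mult_right_mono)
qed measurable

definition autocorr :: "(real \<Rightarrow> complex) \<Rightarrow> real \<Rightarrow> complex" where
  "autocorr f z = L2_inner f (\<lambda>x. f (x - z))"

lemma cmod_autocorr_le: "f \<in> L2 \<Longrightarrow> cmod (autocorr f z) \<le> (L2_norm f)\<^sup>2"
  using L2_Cauchy_Schwarz[of f "\<lambda>x. f (x - z)"]
  by (simp add: autocorr_def L2_translate power2_eq_square)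

lemma autocorr_measurable [measurable]:
  assumes [measurable]: "f \<in> borel_measurable borel"
  shows "autocorr f \<in> borel_measurable borel"
  unfolding autocorr_def[abs_def] L2_inner_def by measurable

text \<open>The Gaussian weight makes every integral absolutely convergent, so that the transform can be
  moved twice from \<open>f\<close> to the weight. What remains is the Gaussian average of the autocorrelation
  of \<open>f\<close> at scale \<open>s\<close>.\<close>
lemma gaussian_weighted_fourier:
  assumes f: "f \<in> L1 \<inter> L2" and s: "s > 0"
  shows "(LINT t|lborel. complex_of_real (std_normal_density (s * t) * (cmod (fourier_integral f t))\<^sup>2))
    = 1 / complex_of_real (sqrt (2 * pi)) *
      (LINT z|lborel. complex_of_real (std_normal_density z) * autocorr f (s * z))"
proof -
  let ?n = "\<lambda>t. complex_of_real (std_normal_density t)" and ?F = "fourier_integral f"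
  have int: "integrable lborel f" and f2: "f \<in> L2" using f by (auto simp: L1_def)
  have [measurable]: "f \<in> borel_measurable borel" using f2 by (rule L2_measurable)
  have F_le: "cmod (?F t) \<le> 1 / sqrt (2 * pi) * (LINT x|lborel. cmod (f x))" for t
    by (rule cmod_fourier_integral_le)
  have "(LINT t|lborel. complex_of_real (std_normal_density (s * t) * (cmod (?F t))\<^sup>2))
      = (LINT t|lborel. ?F t * (cnj (?F t) * ?n (s * t)))"
    by (intro Bochner_Integration.integral_cong refl)
       (simp only: of_real_mult complex_norm_square mult_ac)
  also have "\<dots> = (LINT x|lborel. f x * fourier_integral (\<lambda>t. cnj (?F t) * ?n (s * t)) x)"
    using F_le by (intro fourier_integral_swap int integrable_mult_gaussian[OF s]) (auto simp only: complex_mod_cnj, measurable)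
  also have "\<dots> = (LINT x|lborel. f x * (1 / complex_of_real (sqrt (2 * pi)) *
      (LINT z|lborel. cnj (f (x - s * z)) * ?n z)))"
  proof (intro Bochner_Integration.integral_cong refl)
    fix x
    have "(LINT t|lborel. ?F t * (exp (\<i> * complex_of_real (t * x)) * ?n (s * t)))
        = (LINT y|lborel. f y * complex_of_real (std_normal_density ((y - x) / s) / s))"
      by (subst fourier_integral_swap[OF int integrable_mult_gaussian[OF s, of _ 1]])
         (simp_all only: fourier_integral_gaussian[OF s] norm_exp_i_times order_refl, measurable)
    also have "\<dots> = \<bar>- s\<bar> *\<^sub>R (LINT z|lborel. f (x + (-s) * z) *
        complex_of_real (std_normal_density ((x + (-s) * z - x) / s) / s))"
      by (rule lborel_integral_real_affine) (use s in simp)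
    also have "\<dots> = complex_of_real s * (LINT z|lborel. f (x - s * z) * ?n z / complex_of_real s)"
      using s by (simp add: scaleR_conv_of_real)
    also have "\<dots> = (LINT z|lborel. f (x - s * z) * ?n z)"
      using s by simp
    finally have *: "(LINT t|lborel. ?F t * (exp (\<i> * complex_of_real (t * x)) * ?n (s * t)))
        = (LINT z|lborel. f (x - s * z) * ?n z)" .
    have "fourier_integral (\<lambda>t. cnj (?F t) * ?n (s * t)) x = 1 / complex_of_real (sqrt (2 * pi)) *
        (LINT t|lborel. cnj (?F t * (exp (\<i> * complex_of_real (t * x)) * ?n (s * t))))"
      unfolding fourier_integral_def[of _ x]
      by (intro arg_cong2[of _ _ _ _ "(*)"] Bochner_Integration.integral_cong refl)
         (simp add: exp_cnj mult_ac)
    also have "\<dots> = 1 / complex_of_real (sqrt (2 * pi)) * cnj (LINT z|lborel. f (x - s * z) * ?n z)"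
      by (simp only: Bochner_Integration.integral_cnj *)
    finally show "f x * fourier_integral (\<lambda>t. cnj (?F t) * ?n (s * t)) x
      = f x * (1 / complex_of_real (sqrt (2 * pi)) * (LINT z|lborel. cnj (f (x - s * z)) * ?n z))"
      by (simp flip: Bochner_Integration.integral_cnj)
  qed
  also have "\<dots> = 1 / complex_of_real (sqrt (2 * pi)) *
      (LINT x|lborel. LINT z|lborel. f x * cnj (f (x - s * z)) * ?n z)"
    by (simp add: mult.assoc flip: Bochner_Integration.integral_mult_right_zero)
  also have "(LINT x|lborel. LINT z|lborel. f x * cnj (f (x - s * z)) * ?n z)
      = (LINT z|lborel. LINT x|lborel. f x * cnj (f (x - s * z)) * ?n z)"
  proof (rule lborel_pair.Fubini_integral)
    have "integrable (lborel \<Otimes>\<^sub>M lborel) (\<lambda>(z, x). f x * cnj (f (x - s * z)) * ?n z)"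
    proof (rule lborel_pair.Fubini_integrable)
      have shift: "(\<lambda>x. f (x - s * z)) \<in> L2" for z by (rule L2_translate[OF f2])
      show "(\<lambda>(z, x). f x * cnj (f (x - s * z)) * ?n z) \<in> borel_measurable (lborel \<Otimes>\<^sub>M lborel)"
        by measurable
      show "AE z in lborel. integrable lborel (\<lambda>x. case (z, x) of (z, x) \<Rightarrow> f x * cnj (f (x - s * z)) * ?n z)"
        using integrable_L2_inner[OF f2 shift] by simp
      show "integrable lborel (\<lambda>z. LINT x|lborel. cmod (case (z, x) of (z, x) \<Rightarrow> f x * cnj (f (x - s * z)) * ?n z))"
      proof (rule Bochner_Integration.integrable_bound)
        show "integrable lborel (\<lambda>z. (L2_norm f)\<^sup>2 * std_normal_density z)" by simp
        show "AE z in lborel. norm (LINT x|lborel. cmod (case (z, x) of (z, x) \<Rightarrow> f x * cnj (f (x - s * z)) * ?n z))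
            \<le> norm ((L2_norm f)\<^sup>2 * std_normal_density z)"
        proof (intro AE_I2)
          fix z
          let ?g = "\<lambda>x. complex_of_real (cmod (f x))"
          have g: "?g \<in> L2" using f2 by (simp add: L2_def)
          have ng: "L2_norm ?g = L2_norm f" by (simp add: L2_norm_def)
          have "(LINT x|lborel. cmod (case (z, x) of (z, x) \<Rightarrow> f x * cnj (f (x - s * z)) * ?n z))
              = (LINT x|lborel. cmod (f x) * cmod (f (x - s * z))) * std_normal_density z"
            by (simp add: norm_mult)
          moreover have "(LINT x|lborel. cmod (f x) * cmod (f (x - s * z))) = cmod (autocorr ?g (s * z))"
          proof -
            have "autocorr ?g (s * z) = complex_of_real (LINT x|lborel. cmod (f x) * cmod (f (x - s * z)))"
              unfolding autocorr_def L2_inner_def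
              by (subst integral_complex_of_real[symmetric]) simp
            then show ?thesis by (simp add: integral_nonneg_AE)
          qed
          ultimately show "norm (LINT x|lborel. cmod (case (z, x) of (z, x) \<Rightarrow> f x * cnj (f (x - s * z)) * ?n z))
            \<le> norm ((L2_norm f)\<^sup>2 * std_normal_density z)"
            using cmod_autocorr_le[OF g, of "s * z"] ng by (simp add: abs_mult mult_right_mono)
        qed
      qed measurable
    qed
    then show "integrable (lborel \<Otimes>\<^sub>M lborel) (\<lambda>(z, x). f x * cnj (f (x - s * z)) * ?n z)" .
  qed
  also have "(LINT z|lborel. LINT x|lborel. f x * cnj (f (x - s * z)) * ?n z)
      = (LINT z|lborel. ?n z * autocorr f (s * z))"
    by (simp add: autocorr_def L2_inner_def mult.commute)
  finally show ?thesis .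
qed

text \<open>As \<open>s \<longlonglongrightarrow> 0\<close> in the preceding identity, the weight on the left increases to the constant
  \<open>1 / sqrt (2 * pi)\<close>, so that monotone convergence applies, while on the right the autocorrelation
  is bounded and tends to its value at \<open>0\<close>, which is the squared norm of \<open>f\<close>; the latter is
  continuity of translations.\<close>
theorem plancherel_L1_L2:
  assumes f: "f \<in> L1 \<inter> L2"
  shows "fourier_integral f \<in> L2" "L2_norm (fourier_integral f) = L2_norm f"
proof -
  have f2: "f \<in> L2" using f by simp
  have fm[measurable]: "f \<in> borel_measurable borel" using f2 by (rule L2_measurable)
  let ?n = std_normal_density and ?F = "fourier_integral f"
  define s where "s j = 1 / real (Suc j)" for j
  have s: "s j > 0" for j by (simp add: s_def)
  have s0: "s \<longlonglongrightarrow> 0" unfolding s_def[abs_def] by (rule LIMSEQ_Suc[OF lim_1_over_n])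
  define I where "I j = (LINT z|lborel. complex_of_real (?n z) * autocorr f (s j * z))" for j
  have "I \<longlonglongrightarrow> (LINT z|lborel. complex_of_real (?n z) * complex_of_real ((L2_norm f)\<^sup>2))"
    unfolding I_def
  proof (rule integral_dominated_convergence[where w = "\<lambda>z. (L2_norm f)\<^sup>2 * ?n z"])
    show "AE z in lborel. (\<lambda>j. complex_of_real (?n z) * autocorr f (s j * z))
        \<longlonglongrightarrow> complex_of_real (?n z) * complex_of_real ((L2_norm f)\<^sup>2)"
    proof (intro AE_I2 tendsto_mult tendsto_const)
      fix z
      have "(\<lambda>j. s j * z) \<longlonglongrightarrow> 0" using tendsto_mult_right[OF s0, of z] by simp
      from L2_inner_tendsto_right[OF L2_translate[OF f2] f2 f2 L2_translation_continuous[OF f2 this]]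
      show "(\<lambda>j. autocorr f (s j * z)) \<longlonglongrightarrow> complex_of_real ((L2_norm f)\<^sup>2)"
        by (simp only: autocorr_def L2_inner_self)
    qed
    show "AE z in lborel. cmod (complex_of_real (?n z) * autocorr f (s j * z)) \<le> (L2_norm f)\<^sup>2 * ?n z" for j
      using cmod_autocorr_le[OF f2] by (intro AE_I2) (simp add: norm_mult mult.commute mult_left_mono)
    show "integrable lborel (\<lambda>z. (L2_norm f)\<^sup>2 * ?n z)" by simp
  qed measurable
  also have "(LINT z|lborel. complex_of_real (?n z) * complex_of_real ((L2_norm f)\<^sup>2))
      = complex_of_real ((L2_norm f)\<^sup>2)"
    by (simp only: integral_complex_of_real flip: of_real_mult) simp
  finally have I: "I \<longlonglongrightarrow> complex_of_real ((L2_norm f)\<^sup>2)" .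
  have Fi: "integrable lborel (\<lambda>t. ?n (s j * t) * (cmod (?F t))\<^sup>2)" for j
  proof -
    define b where "b = 1 / sqrt (2 * pi) * (LINT x|lborel. cmod (f x))"
    have b: "cmod (?F t) \<le> b" for t unfolding b_def by (rule cmod_fourier_integral_le)
    show ?thesis
    proof (rule Bochner_Integration.integrable_bound)
      show "integrable lborel (\<lambda>t. b\<^sup>2 * ?n (s j * t))" using integrable_scaled_gaussian[OF s] by simp
      show "AE t in lborel. norm (?n (s j * t) * (cmod (?F t))\<^sup>2) \<le> norm (b\<^sup>2 * ?n (s j * t))"
        using b by (intro AE_I2) (simp add: abs_mult mult.commute[of "b\<^sup>2"] mult_left_mono power_mono)
    qed measurable
  qed
  have lhs: "(\<integral>\<^sup>+t. ennreal (?n (s j * t) * (cmod (?F t))\<^sup>2) \<partial>lborel) = ennreal (1 / sqrt (2 * pi) * Re (I j))" for j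
  proof -
    have "(\<integral>\<^sup>+t. ennreal (?n (s j * t) * (cmod (?F t))\<^sup>2) \<partial>lborel) = ennreal (LINT t|lborel. ?n (s j * t) * (cmod (?F t))\<^sup>2)"
      by (rule nn_integral_eq_integral[OF Fi]) simp
    also have "(LINT t|lborel. ?n (s j * t) * (cmod (?F t))\<^sup>2)
        = Re (LINT t|lborel. complex_of_real (?n (s j * t) * (cmod (?F t))\<^sup>2))"
      by (simp only: integral_complex_of_real Re_complex_of_real)
    also have "\<dots> = 1 / sqrt (2 * pi) * Re (I j)"
      unfolding gaussian_weighted_fourier[OF f s] I_def by (simp add: Re_divide_of_real)
    finally show ?thesis .
  qed
  have "(\<lambda>j. \<integral>\<^sup>+t. ennreal (?n (s j * t) * (cmod (?F t))\<^sup>2) \<partial>lborel)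
      \<longlonglongrightarrow> (\<integral>\<^sup>+t. ennreal (?n 0 * (cmod (?F t))\<^sup>2) \<partial>lborel)"
  proof (rule nn_integral_LIMSEQ)
    show "incseq (\<lambda>j t. ennreal (?n (s j * t) * (cmod (?F t))\<^sup>2))"
    proof (intro incseq_SucI le_funI ennreal_leI mult_right_mono)
      fix j t
      have "(s (Suc j) * t)\<^sup>2 \<le> (s j * t)\<^sup>2"
        unfolding power_mult_distrib by (intro mult_right_mono power_mono) (auto simp: s_def frac_le)
      then show "?n (s j * t) \<le> ?n (s (Suc j) * t)"
        by (simp add: std_normal_density_def divide_right_mono)
    qed simp
    show "(\<lambda>j. ennreal (?n (s j * t) * (cmod (?F t))\<^sup>2)) \<longlonglongrightarrow> ennreal (?n 0 * (cmod (?F t))\<^sup>2)" for t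
    proof -
      have "(\<lambda>j. s j * t) \<longlonglongrightarrow> 0" using tendsto_mult_right[OF s0, of t] by simp
      moreover have "isCont ?n 0" unfolding std_normal_density_def[abs_def] by (intro continuous_intros) simp_all
      ultimately have "(\<lambda>j. ?n (s j * t)) \<longlonglongrightarrow> ?n 0"
        by (rule isCont_tendsto_compose[rotated])
      then show ?thesis by (intro tendsto_ennrealI tendsto_intros)
    qed
  qed measurable
  moreover have "(\<lambda>j. \<integral>\<^sup>+t. ennreal (?n (s j * t) * (cmod (?F t))\<^sup>2) \<partial>lborel)
      \<longlonglongrightarrow> ennreal (1 / sqrt (2 * pi) * (L2_norm f)\<^sup>2)"
    unfolding lhs using tendsto_Re[OF I] by (intro tendsto_ennrealI tendsto_mult tendsto_const) simp
  ultimately have "(\<integral>\<^sup>+t. ennreal (?n 0 * (cmod (?F t))\<^sup>2) \<partial>lborel) = ennreal (1 / sqrt (2 * pi) * (L2_norm f)\<^sup>2)"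
    by (rule LIMSEQ_unique)
  moreover have "?n 0 = 1 / sqrt (2 * pi)" by (simp add: std_normal_density_def)
  ultimately have "ennreal (1 / sqrt (2 * pi)) * (\<integral>\<^sup>+t. ennreal ((cmod (?F t))\<^sup>2) \<partial>lborel)
      = ennreal (1 / sqrt (2 * pi)) * ennreal ((L2_norm f)\<^sup>2)"
    by (subst nn_integral_cmult[symmetric]) (simp_all flip: ennreal_mult)
  then have eq: "(\<integral>\<^sup>+t. ennreal ((cmod (?F t))\<^sup>2) \<partial>lborel) = ennreal ((L2_norm f)\<^sup>2)"
    by (subst (asm) ennreal_mult_cancel_left) auto
  show F2: "?F \<in> L2" using eq by (simp add: L2_iff_nn_integral)
  have "(L2_norm ?F)\<^sup>2 = (L2_norm f)\<^sup>2" using eq nn_integral_L2_norm[OF F2] by simp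
  then show "L2_norm ?F = L2_norm f" by simp
qed

section \<open>The Fourier transform as a unitary operator\<close>

text \<open>The property that the choice in \<^const>\<open>fourier\<close> selects by. It is isometric and
  compatible with differences, so it determines \<open>g\<close> up to null sets, and any statement about \<^const>\<open>fourier\<close> on all of
  \<open>L\<^sup>2\<close> reduces to a statement about this relation.\<close>
definition is_fourier :: "(real \<Rightarrow> complex) \<Rightarrow> (real \<Rightarrow> complex) \<Rightarrow> bool" where
  "is_fourier f g \<longleftrightarrow> g \<in> L2 \<and>
    (\<exists>u. (\<forall>k. u k \<in> L1 \<inter> L2) \<and> L2_tendsto u f \<and> L2_tendsto (\<lambda>k. fourier_integral (u k)) g)"

lemma L1_L2_diff: "f \<in> L1 \<inter> L2 \<Longrightarrow> g \<in> L1 \<inter> L2 \<Longrightarrow> (\<lambda>x. f x - g x) \<in> L1 \<inter> L2"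
  using L2_diff by (auto simp: L1_def)

lemma fourier_integral_isometry:
  assumes "f \<in> L1 \<inter> L2" "g \<in> L1 \<inter> L2"
  shows "L2_norm (\<lambda>t. fourier_integral f t - fourier_integral g t) = L2_norm (\<lambda>x. f x - g x)"
proof -
  have "L2_norm (fourier_integral (\<lambda>x. f x - g x)) = L2_norm (\<lambda>x. f x - g x)"
    by (intro plancherel_L1_L2 L1_L2_diff assms)
  moreover have "fourier_integral (\<lambda>x. f x - g x) = (\<lambda>t. fourier_integral f t - fourier_integral g t)"
    using assms by (intro ext fourier_integral_diff) (auto simp: L1_def)
  ultimately show ?thesis by simp
qed

lemma L2_tendsto_imp_Cauchy:
  assumes u: "\<And>k. u k \<in> L2" and f: "f \<in> L2" and lim: "L2_tendsto u f" and e: "e > 0"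
  shows "\<exists>N. \<forall>i\<ge>N. \<forall>j\<ge>N. L2_norm (\<lambda>x. u i x - u j x) < e"
proof -
  have "(\<lambda>k. L2_norm (\<lambda>x. u k x - f x)) \<longlonglongrightarrow> 0" using u f lim by (simp add: L2_tendsto_iff_norm)
  then have "\<forall>\<^sub>F k in sequentially. L2_norm (\<lambda>x. u k x - f x) < e / 2"
    using e by (intro order_tendstoD) auto
  then obtain N where N: "\<And>k. k \<ge> N \<Longrightarrow> L2_norm (\<lambda>x. u k x - f x) < e / 2"
    by (auto simp: eventually_sequentially)
  have "L2_norm (\<lambda>x. u i x - u j x) < e" if "i \<ge> N" "j \<ge> N" for i j
    using L2_norm_triangle3[OF u f u, of i j] N[OF that(1)] N[OF that(2)]
      L2_norm_minus_commute[of "u j" f] by simp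
  then show ?thesis by blast
qed

lemma is_fourier_exists:
  assumes f: "f \<in> L2"
  obtains g where "is_fourier f g"
proof -
  obtain u where u: "\<And>k. u k \<in> L1 \<inter> L2" and lim: "L2_tendsto u f" using L1_L2_dense[OF f] by blast
  have u2: "u k \<in> L2" for k using u by blast
  obtain g where "g \<in> L2" "L2_tendsto (\<lambda>k. fourier_integral (u k)) g"
  proof (rule L2_complete[of "\<lambda>k. fourier_integral (u k)"])
    show "fourier_integral (u k) \<in> L2" for k by (rule plancherel_L1_L2[OF u])
    show "\<exists>N. \<forall>i\<ge>N. \<forall>j\<ge>N. L2_norm (\<lambda>x. fourier_integral (u i) x - fourier_integral (u j) x) < e"
      if "e > 0" for e
      using L2_tendsto_imp_Cauchy[OF u2 f lim that] by (simp add: fourier_integral_isometry[OF u u])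
  qed
  then have "is_fourier f g" unfolding is_fourier_def using u lim by blast
  then show ?thesis by (rule that)
qed

lemma is_fourier_fourier:
  assumes f: "f \<in> L2"
  shows "is_fourier f (fourier f)"
proof (cases "f \<in> L1 \<inter> L2")
  case True
  have "L2_tendsto (\<lambda>k. g) g" for g by (simp add: L2_tendsto_def)
  then have "is_fourier f (fourier_integral f)"
    unfolding is_fourier_def using True plancherel_L1_L2(1)[OF True] by (intro conjI exI[of _ "\<lambda>_. f"]) auto
  then show ?thesis using True by (simp add: fourier_def)
next
  case False
  then have "fourier f = (SOME g. is_fourier f g)" unfolding fourier_def is_fourier_def by (simp only: if_False)
  then show ?thesis using is_fourier_exists[OF f] someI[of "is_fourier f"] by metis
qed

lemma is_fourier_norm:
  assumes f: "f \<in> L2" and g: "is_fourier f g"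
  shows "L2_norm g = L2_norm f"
proof -
  obtain u where u: "\<And>k. u k \<in> L1 \<inter> L2" and lim: "L2_tendsto u f"
    "L2_tendsto (\<lambda>k. fourier_integral (u k)) g" and g2: "g \<in> L2"
    using g by (auto simp: is_fourier_def)
  have "(\<lambda>k. L2_norm (fourier_integral (u k))) \<longlonglongrightarrow> L2_norm g"
    by (intro L2_norm_tendsto lim g2 plancherel_L1_L2[OF u])
  moreover have "(\<lambda>k. L2_norm (u k)) \<longlonglongrightarrow> L2_norm f"
    using u by (intro L2_norm_tendsto lim f) auto
  ultimately show ?thesis using LIMSEQ_unique by (simp add: plancherel_L1_L2(2)[OF u])
qed

lemma is_fourier_diff:
  assumes f: "f \<in> L2" "f' \<in> L2" and "is_fourier f g" "is_fourier f' g'"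
  shows "is_fourier (\<lambda>x. f x - f' x) (\<lambda>t. g t - g' t)"
proof -
  obtain u where u: "\<And>k. u k \<in> L1 \<inter> L2" and lim: "L2_tendsto u f"
    "L2_tendsto (\<lambda>k. fourier_integral (u k)) g" and g2: "g \<in> L2"
    using assms(3) by (auto simp: is_fourier_def)
  obtain u' where u': "\<And>k. u' k \<in> L1 \<inter> L2" and lim': "L2_tendsto u' f'"
    "L2_tendsto (\<lambda>k. fourier_integral (u' k)) g'" and g2': "g' \<in> L2"
    using assms(4) by (auto simp: is_fourier_def)
  have "L2_tendsto (\<lambda>k x. u k x - u' k x) (\<lambda>x. f x - f' x)"
    using u u' by (intro L2_tendsto_diff lim lim' f) auto
  moreover have "L2_tendsto (\<lambda>k x. fourier_integral (u k) x - fourier_integral (u' k) x) (\<lambda>x. g x - g' x)"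
    by (intro L2_tendsto_diff lim lim' g2 g2' plancherel_L1_L2[OF u] plancherel_L1_L2[OF u'])
  moreover have "fourier_integral (\<lambda>x. u k x - u' k x)
      = (\<lambda>x. fourier_integral (u k) x - fourier_integral (u' k) x)" for k
    using u[of k] u'[of k] by (intro ext fourier_integral_diff) (auto simp: L1_def)
  ultimately show ?thesis
    unfolding is_fourier_def using L2_diff[OF g2 g2'] L1_L2_diff[OF u u']
    by (intro conjI exI[of _ "\<lambda>k x. u k x - u' k x"]) auto
qed

lemma fourier_L2: "f \<in> L2 \<Longrightarrow> fourier f \<in> L2"
  using is_fourier_fourier by (auto simp: is_fourier_def)

lemma is_fourier_unique:
  assumes f: "f \<in> L2" and g: "is_fourier f g" and g': "is_fourier f g'"
  shows "AE t in lborel. g t = g' t"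
proof -
  have 0: "(\<lambda>x. f x - f x) \<in> L2" by (intro L2_diff f)
  have "L2_norm (\<lambda>t. g t - g' t) = L2_norm (\<lambda>x. f x - f x)"
    by (rule is_fourier_norm[OF 0 is_fourier_diff[OF f f g g']])
  also have "\<dots> = 0" by (simp add: L2_norm_def)
  finally have "AE t in lborel. g t - g' t = 0"
    using g g' by (intro L2_norm_zero_AE L2_diff) (auto simp: is_fourier_def)
  then show ?thesis by simp
qed

lemma fourier_diff_AE:
  assumes f: "f \<in> L2" and g: "g \<in> L2"
  shows "AE t in lborel. fourier (\<lambda>x. f x - g x) t = fourier f t - fourier g t"
  by (intro is_fourier_unique[of "\<lambda>x. f x - g x"] L2_diff is_fourier_fourier is_fourier_diff f g)

text \<open>The inverse transform \<open>T\<close> is both an isometry and the adjoint of the transform. Hence, if \<open>f\<close> is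
  the limit of \<open>T\<close> applied to approximations of \<open>G\<close>, and \<open>H\<close> is the transform of \<open>f\<close>, then
  \<open>\<langle>H, G\<rangle> = \<langle>f, f\<rangle>\<close> and all three functions have the same norm; expanding \<open>\<parallel>H - G\<parallel>\<^sup>2\<close> gives \<open>0\<close>.\<close>
lemma fourier_surjective:
  assumes G: "G \<in> L2"
  shows "\<exists>f. f \<in> L2 \<and> (AE t in lborel. fourier f t = G t)"
proof -
  obtain v where v: "\<And>k. v k \<in> L1 \<inter> L2" and v_lim: "L2_tendsto v G" using L1_L2_dense[OF G] by blast
  have v1: "integrable lborel (v k)" and v2: "v k \<in> L2" for k using v[of k] by (auto simp: L1_def)
  \<comment> \<open>The inverse transform, expressed by conjugation.\<close>
  define T where "T w x = cnj (fourier_integral (\<lambda>y. cnj (w y)) x)" for w x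
  have cv: "(\<lambda>y. cnj (v k y)) \<in> L1 \<inter> L2" for k
    using v1 L2_cnj[OF v2] by (simp add: L1_def)
  have Tv: "T (v k) \<in> L2" for k
    unfolding T_def[abs_def] by (intro L2_cnj plancherel_L1_L2[OF cv])
  have Tn: "L2_norm (T (v k)) = L2_norm (v k)" for k
    unfolding T_def[abs_def] by (simp add: plancherel_L1_L2[OF cv])
  have Td: "L2_norm (\<lambda>x. T (v i) x - T (v j) x) = L2_norm (\<lambda>x. v i x - v j x)" for i j
  proof -
    have "L2_norm (\<lambda>x. T (v i) x - T (v j) x)
        = L2_norm (\<lambda>x. cnj (fourier_integral (\<lambda>y. cnj (v i y)) x - fourier_integral (\<lambda>y. cnj (v j y)) x))"
      by (simp add: T_def)
    also have "\<dots> = L2_norm (\<lambda>x. cnj (v i x) - cnj (v j x))"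
      unfolding L2_norm_cnj by (rule fourier_integral_isometry[OF cv cv])
    also have "\<dots> = L2_norm (\<lambda>x. cnj (v i x - v j x))" by simp
    finally show ?thesis by (simp only: L2_norm_cnj)
  qed
  obtain f where f: "f \<in> L2" and f_lim: "L2_tendsto (\<lambda>k. T (v k)) f"
    by (rule L2_complete[of "\<lambda>k. T (v k)"])
       (use L2_tendsto_imp_Cauchy[OF v2 G v_lim] in \<open>auto simp: Td Tv\<close>)
  have fG: "L2_norm f = L2_norm G"
    using L2_norm_tendsto[OF Tv f f_lim] L2_norm_tendsto[OF v2 G v_lim] LIMSEQ_unique
    by (simp add: Tn)
  define H where "H = fourier f"
  have isH: "is_fourier f H" unfolding H_def by (rule is_fourier_fourier[OF f])
  obtain u where u: "\<And>k. u k \<in> L1 \<inter> L2" and u_lim: "L2_tendsto u f"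
    "L2_tendsto (\<lambda>k. fourier_integral (u k)) H" and H: "H \<in> L2"
    using isH by (auto simp: is_fourier_def)
  have u1: "integrable lborel (u k)" and u2: "u k \<in> L2" for k using u[of k] by (auto simp: L1_def)
  have adj: "L2_inner (fourier_integral (u j)) (v k) = L2_inner (u j) (T (v k))" for j k
    unfolding L2_inner_def T_def complex_cnj_cnj by (intro fourier_integral_swap u1) (simp add: v1)
  have 1: "L2_inner H (v k) = L2_inner f (T (v k))" for k
  proof (rule LIMSEQ_unique)
    show "(\<lambda>j. L2_inner (fourier_integral (u j)) (v k)) \<longlonglongrightarrow> L2_inner H (v k)"
      by (intro L2_inner_tendsto_left plancherel_L1_L2[OF u] H v2 u_lim)
    show "(\<lambda>j. L2_inner (fourier_integral (u j)) (v k)) \<longlonglongrightarrow> L2_inner f (T (v k))"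
      unfolding adj by (intro L2_inner_tendsto_left u2 f Tv u_lim)
  qed
  have "L2_inner H G = L2_inner f f"
  proof (rule LIMSEQ_unique)
    show "(\<lambda>k. L2_inner H (v k)) \<longlonglongrightarrow> L2_inner H G"
      by (intro L2_inner_tendsto_right v2 G H v_lim)
    show "(\<lambda>k. L2_inner H (v k)) \<longlonglongrightarrow> L2_inner f f"
      unfolding 1 by (intro L2_inner_tendsto_right Tv f f_lim)
  qed
  then have "Re (L2_inner H G) = (L2_norm G)\<^sup>2" by (simp add: L2_inner_self fG)
  then have "(L2_norm (\<lambda>t. H t - G t))\<^sup>2 = 0"
    using L2_norm_diff_sq[OF H G] is_fourier_norm[OF f isH] fG by simp
  then have "AE t in lborel. H t - G t = 0"
    by (intro L2_norm_zero_AE L2_diff H G) simp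
  then show ?thesis using f unfolding H_def by auto
qed

text \<open>The choice defining the estimator is meaningful because of surjectivity.\<close>
lemma deconv_estimator_props:
  assumes "deconv_fourier s \<alpha> g \<phi> \<in> L2"
  shows "deconv_estimator s \<alpha> g \<phi> \<in> L2"
    and "AE t in lborel. fourier (deconv_estimator s \<alpha> g \<phi>) t = deconv_fourier s \<alpha> g \<phi> t"
  using someI_ex[OF fourier_surjective[OF assms]] unfolding deconv_estimator_def by auto

section \<open>Empirical characteristic functions\<close>

lemma has_density_integral:
  fixes g :: "real \<Rightarrow> complex"
  assumes "has_density M Z f" "\<And>x. 0 \<le> f x" and [measurable]: "f \<in> borel_measurable borel" "g \<in> borel_measurable borel"
  shows "(LINT \<omega>|M. g (Z \<omega>)) = (LINT x|lborel. g x * complex_of_real (f x))"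
proof -
  have d: "distr M lborel Z = density lborel (\<lambda>x. ennreal (f x))" and [measurable]: "Z \<in> measurable M borel"
    using assms(1) by (auto simp: has_density_def distributed_def)
  have "(LINT \<omega>|M. g (Z \<omega>)) = (LINT x|distr M lborel Z. g x)" by (subst integral_distr) auto
  also have "\<dots> = (LINT x|lborel. f x *\<^sub>R g x)"
    unfolding d by (rule integral_density) (use assms in auto)
  finally show ?thesis by (simp add: scaleR_conv_of_real mult.commute)
qed

lemma nn_integral_cmod_sum_orthogonal:
  fixes W :: "nat \<Rightarrow> 'a \<Rightarrow> complex"
  assumes int: "\<And>j k. integrable M (\<lambda>\<omega>. W j \<omega> * cnj (W k \<omega>))"
    and orth: "\<And>j k. j \<noteq> k \<Longrightarrow> (LINT \<omega>|M. W j \<omega> * cnj (W k \<omega>)) = 0"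
    and le: "\<And>j. Re (LINT \<omega>|M. W j \<omega> * cnj (W j \<omega>)) \<le> 1"
  shows "(\<integral>\<^sup>+\<omega>. ennreal ((cmod (\<Sum>j<n. W j \<omega>))\<^sup>2) \<partial>M) \<le> ennreal (real n)"
proof -
  let ?S = "\<lambda>\<omega>. \<Sum>j<n. \<Sum>k<n. W j \<omega> * cnj (W k \<omega>)"
  have eq: "complex_of_real ((cmod (\<Sum>j<n. W j \<omega>))\<^sup>2) = ?S \<omega>" for \<omega>
    unfolding complex_norm_square cnj_sum sum_product ..
  have "integrable M ?S" using int by simp
  then have i: "integrable M (\<lambda>\<omega>. (cmod (\<Sum>j<n. W j \<omega>))\<^sup>2)"
    unfolding eq[symmetric] by (simp only: complex_of_real_integrable_eq)
  have "complex_of_real (LINT \<omega>|M. (cmod (\<Sum>j<n. W j \<omega>))\<^sup>2) = (LINT \<omega>|M. ?S \<omega>)"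
    by (simp only: eq[symmetric] integral_complex_of_real)
  also have "\<dots> = (\<Sum>j<n. \<Sum>k<n. LINT \<omega>|M. W j \<omega> * cnj (W k \<omega>))"
    using int by simp
  also have "\<dots> = (\<Sum>j<n. \<Sum>k<n. if j = k then LINT \<omega>|M. W j \<omega> * cnj (W j \<omega>) else 0)"
    by (intro sum.cong refl) (simp add: orth)
  also have "\<dots> = (\<Sum>j<n. LINT \<omega>|M. W j \<omega> * cnj (W j \<omega>))"
    by (intro sum.cong refl) simp
  finally have "(LINT \<omega>|M. (cmod (\<Sum>j<n. W j \<omega>))\<^sup>2) = Re (\<Sum>j<n. LINT \<omega>|M. W j \<omega> * cnj (W j \<omega>))"
    by (metis Re_complex_of_real)
  also have "\<dots> = (\<Sum>j<n. Re (LINT \<omega>|M. W j \<omega> * cnj (W j \<omega>)))" by (rule Re_sum)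
  also have "\<dots> \<le> (\<Sum>j<n. 1)" by (intro sum_mono le)
  finally have "(LINT \<omega>|M. (cmod (\<Sum>j<n. W j \<omega>))\<^sup>2) \<le> real n" by simp
  then show ?thesis by (subst nn_integral_eq_integral[OF i]) (auto intro: ennreal_leI)
qed

text \<open>The summands, centred at their common mean, are bounded and pairwise orthogonal, and each has
  variance \<open>1 - \<bar>\<mu>\<bar>\<^sup>2 \<le> 1\<close>.\<close>
lemma empirical_char_second_moment:
  assumes "prob_space M" and iid: "iid_sample M Z f"
    and f0: "\<And>x. 0 \<le> f x" and fm[measurable]: "f \<in> borel_measurable borel" and n: "n > 0"
  shows "(\<integral>\<^sup>+\<omega>. ennreal ((cmod (1 / of_nat n * (\<Sum>j<n. exp (- \<i> * complex_of_real (t * Z j \<omega>)))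
            - complex_of_real (sqrt (2 * pi)) * fourier_integral (cplx f) t))\<^sup>2) \<partial>M)
    \<le> ennreal (1 / real n)"
proof -
  interpret prob_space M by fact
  define e where "e x = exp (- \<i> * complex_of_real (t * x))" for x
  define \<mu> where "\<mu> = complex_of_real (sqrt (2 * pi)) * fourier_integral (cplx f) t"
  define W where "W j \<omega> = e (Z j \<omega>) - \<mu>" for j \<omega>
  have em[measurable]: "e \<in> borel_measurable borel" unfolding e_def[abs_def] by measurable
  have e1: "cmod (e x) = 1" for x by (simp add: e_def del: of_real_mult)
  have ind: "indep_vars (\<lambda>_. borel) Z UNIV" and dens: "has_density M (Z j) f" for j
    using iid by (auto simp: iid_sample_def)
  have Zm[measurable]: "Z j \<in> borel_measurable M" for j
    using dens[of j] by (auto simp: has_density_def distributed_def)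
  have mu: "(LINT \<omega>|M. e (Z j \<omega>)) = \<mu>" for j
    using has_density_integral[OF dens f0 fm em, of j] by (simp add: \<mu>_def fourier_integral_def e_def)
  have ie: "integrable M (\<lambda>\<omega>. e (Z j \<omega>))" for j
    by (rule integrable_const_bound[of _ 1]) (auto simp: e1)
  have W0: "(LINT \<omega>|M. W j \<omega>) = 0" and iW: "integrable M (W j)" for j
    using ie[of j] by (simp_all add: W_def[abs_def] mu prob_space)
  have Wb: "cmod (W j \<omega>) \<le> 1 + cmod \<mu>" for j \<omega>
    unfolding W_def using norm_triangle_ineq4[of "e (Z j \<omega>)" \<mu>] by (simp add: e1)
  have int: "integrable M (\<lambda>\<omega>. W j \<omega> * cnj (W k \<omega>))" for j k
  proof (rule integrable_const_bound)
    show "AE \<omega> in M. cmod (W j \<omega> * cnj (W k \<omega>)) \<le> (1 + cmod \<mu>) * (1 + cmod \<mu>)"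
      unfolding norm_mult complex_mod_cnj by (intro AE_I2 mult_mono Wb) (auto intro: add_nonneg_nonneg)
  qed (simp add: W_def)
  have orth: "(LINT \<omega>|M. W j \<omega> * cnj (W k \<omega>)) = 0" if "j \<noteq> k" for j k
  proof -
    \<comment> \<open>The product over \<open>{j, k}\<close> of these two functions of \<open>Z j\<close> and \<open>Z k\<close> is the cross term.\<close>
    let ?g = "\<lambda>i x. if i = j then e x - \<mu> else cnj (e x - \<mu>)"
    have iv: "indep_vars (\<lambda>_. borel) (\<lambda>i \<omega>. ?g i (Z i \<omega>)) {j, k}"
      by (rule indep_vars_compose2[OF indep_vars_subset[OF ind]]) auto
    have ig: "integrable M (\<lambda>\<omega>. ?g i (Z i \<omega>))" for i
      using ie[of i] by (cases "i = j") simp_all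
    have "(LINT \<omega>|M. (\<Prod>i\<in>{j, k}. ?g i (Z i \<omega>))) = (\<Prod>i\<in>{j, k}. (LINT \<omega>|M. ?g i (Z i \<omega>)))"
      by (rule indep_vars_lebesgue_integral[OF _ iv ig]) simp
    then show ?thesis using that W0[of j] by (simp add: W_def)
  qed
  have le: "Re (LINT \<omega>|M. W j \<omega> * cnj (W j \<omega>)) \<le> 1" for j
  proof -
    have "W j \<omega> * cnj (W j \<omega>) = 1 - e (Z j \<omega>) * cnj \<mu> - cnj (e (Z j \<omega>)) * \<mu> + \<mu> * cnj \<mu>" for \<omega>
      using complex_norm_square[of "e (Z j \<omega>)"] by (simp add: W_def algebra_simps e1)
    then have "(LINT \<omega>|M. W j \<omega> * cnj (W j \<omega>))
        = (LINT \<omega>|M. 1 - e (Z j \<omega>) * cnj \<mu> - cnj (e (Z j \<omega>)) * \<mu> + \<mu> * cnj \<mu>)"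
      by (simp only:)
    also have "\<dots> = 1 - \<mu> * cnj \<mu> - cnj \<mu> * \<mu> + \<mu> * cnj \<mu>"
      using ie[of j] by (simp add: mu prob_space)
    also have "\<dots> = 1 - complex_of_real ((cmod \<mu>)\<^sup>2)" unfolding complex_norm_square by simp
    finally show ?thesis by (simp del: of_real_power)
  qed
  have "(\<integral>\<^sup>+\<omega>. ennreal ((cmod (1 / of_nat n * (\<Sum>j<n. e (Z j \<omega>)) - \<mu>))\<^sup>2) \<partial>M)
      = (\<integral>\<^sup>+\<omega>. ennreal (1 / (real n)\<^sup>2) * ennreal ((cmod (\<Sum>j<n. W j \<omega>))\<^sup>2) \<partial>M)"
  proof (intro nn_integral_cong)
    fix \<omega>
    have "1 / of_nat n * (\<Sum>j<n. e (Z j \<omega>)) - \<mu> = (\<Sum>j<n. W j \<omega>) / of_nat n"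
      using n by (simp add: W_def sum_subtractf field_simps)
    then show "ennreal ((cmod (1 / of_nat n * (\<Sum>j<n. e (Z j \<omega>)) - \<mu>))\<^sup>2)
        = ennreal (1 / (real n)\<^sup>2) * ennreal ((cmod (\<Sum>j<n. W j \<omega>))\<^sup>2)"
      by (simp add: norm_divide power_divide flip: ennreal_mult)
  qed
  also have "\<dots> = ennreal (1 / (real n)\<^sup>2) * (\<integral>\<^sup>+\<omega>. ennreal ((cmod (\<Sum>j<n. W j \<omega>))\<^sup>2) \<partial>M)"
    by (rule nn_integral_cmult) (simp add: W_def)
  also have "\<dots> \<le> ennreal (1 / (real n)\<^sup>2) * ennreal (real n)"
    by (intro mult_left_mono nn_integral_cmod_sum_orthogonal int orth le) auto
  also have "\<dots> = ennreal (1 / real n)"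
    using n by (simp add: power2_eq_square flip: ennreal_mult)
  finally show ?thesis by (simp add: e_def \<mu>_def)
qed

section \<open>Kernel estimators and convolutions on the Fourier side\<close>

lemma scaled_kernel_L1_L2:
  assumes K: "K \<in> L1 \<inter> L2" and h: "h > 0"
  shows "(\<lambda>x. K ((y - x) / h)) \<in> L1 \<inter> L2"
proof -
  have eq: "y / h + (- 1 / h) * x = (y - x) / h" for x by (simp add: diff_divide_distrib)
  have [measurable]: "K \<in> borel_measurable borel" using K L2_measurable by blast
  have "integrable lborel (\<lambda>x. K (y / h + (- 1 / h) * x))"
    using K h by (intro lborel_integrable_real_affine) (auto simp: L1_def)
  moreover have "integrable lborel (\<lambda>x. (cmod (K (y / h + (- 1 / h) * x)))\<^sup>2)"
    using K h by (intro lborel_integrable_real_affine) (auto simp: L2_def)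
  ultimately show ?thesis unfolding eq by (simp add: L1_def L2_def)
qed

lemma fourier_integral_scaled_kernel:
  assumes h: "h > 0"
  shows "fourier_integral (\<lambda>x. K ((y - x) / h)) t
    = complex_of_real h * exp (- \<i> * complex_of_real (t * y)) * fourier_integral K (- (t * h))"
proof -
  have "(LINT x|lborel. exp (- \<i> * complex_of_real (t * x)) * K ((y - x) / h))
      = \<bar>- h\<bar> *\<^sub>R (LINT u|lborel. exp (- \<i> * complex_of_real (t * (y + (- h) * u))) * K ((y - (y + (- h) * u)) / h))"
    by (rule lborel_integral_real_affine) (use h in simp)
  also have "\<dots> = complex_of_real h * (LINT u|lborel. exp (- \<i> * complex_of_real (t * y)) *
      (exp (- \<i> * complex_of_real (- (t * h) * u)) * K u))"
  proof -
    have "exp (- \<i> * complex_of_real (t * (y + (- h) * u)))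
        = exp (- \<i> * complex_of_real (t * y)) * exp (- \<i> * complex_of_real (- (t * h) * u))" for u
      by (subst exp_add[symmetric]) (simp add: algebra_simps)
    moreover have "(y - (y + (- h) * u)) / h = u" for u using h by simp
    ultimately show ?thesis using h by (simp only: scaleR_conv_of_real mult.assoc) simp
  qed
  also have "\<dots> = complex_of_real h * (exp (- \<i> * complex_of_real (t * y)) *
      (LINT u|lborel. exp (- \<i> * complex_of_real (- (t * h) * u)) * K u))"
    by (simp only: integral_mult_right_zero)
  finally show ?thesis unfolding fourier_integral_def by (simp only: mult_ac)
qed

lemma L1_L2_sum:
  assumes "\<And>j. j < n \<Longrightarrow> f j \<in> L1 \<inter> L2"
  shows "(\<lambda>x. \<Sum>j<(n::nat). f j x) \<in> L1 \<inter> L2"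
  using assms
proof (induction n)
  case 0
  then show ?case by (simp add: L1_def L2_def)
next
  case (Suc n)
  have "(\<lambda>x. 0) \<in> L2" by (simp add: L2_def)
  then have "(\<lambda>x. (\<Sum>j<n. f j x) - (0 - f n x)) \<in> L2" using Suc by (intro L2_diff) auto
  then show ?case using Suc by (simp add: L1_def)
qed

lemma kernel_estimator_L1_L2:
  assumes "K \<in> L1 \<inter> L2" "h > 0"
  shows "kernel_estimator K h n y \<in> L1 \<inter> L2"
proof -
  have "(\<lambda>x. \<Sum>j<n. K ((y j - x) / h)) \<in> L1 \<inter> L2"
    by (intro L1_L2_sum scaled_kernel_L1_L2 assms)
  then have "(\<lambda>x. b * (\<Sum>j<n. K ((y j - x) / h))) \<in> L1 \<inter> L2" for b
    using L2_cmult by (auto simp: L1_def)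
  then show ?thesis unfolding kernel_estimator_def[abs_def] .
qed

lemma fourier_kernel_estimator:
  assumes K: "K \<in> L1 \<inter> L2" and h: "h > 0"
  shows "fourier (kernel_estimator K h n y) t = fourier_integral K (- (t * h)) *
    (1 / of_nat n * (\<Sum>j<n. exp (- \<i> * complex_of_real (t * y j))))"
proof -
  have int: "integrable lborel (\<lambda>x. K ((y j - x) / h))" for j
    using scaled_kernel_L1_L2[OF K h] by (simp add: L1_def)
  have "fourier (kernel_estimator K h n y) t = fourier_integral (kernel_estimator K h n y) t"
    using kernel_estimator_L1_L2[OF K h] by (simp add: fourier_def)
  also have "\<dots> = 1 / complex_of_real (real n * h) * (1 / complex_of_real (sqrt (2 * pi)) *
      (LINT x|lborel. (\<Sum>j<n. exp (- \<i> * complex_of_real (t * x)) * K ((y j - x) / h))))"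
  proof -
    have "exp (- \<i> * complex_of_real (t * x)) * kernel_estimator K h n y x
      = 1 / complex_of_real (real n * h) * (\<Sum>j<n. exp (- \<i> * complex_of_real (t * x)) * K ((y j - x) / h))" for x
      unfolding kernel_estimator_def sum_distrib_left by (intro sum.cong refl) (simp only: mult_ac)
    then show ?thesis unfolding fourier_integral_def by (simp only: integral_mult_right_zero mult_ac)
  qed
  also have "(LINT x|lborel. (\<Sum>j<n. exp (- \<i> * complex_of_real (t * x)) * K ((y j - x) / h)))
      = (\<Sum>j<n. LINT x|lborel. exp (- \<i> * complex_of_real (t * x)) * K ((y j - x) / h))"
    by (intro Bochner_Integration.integral_sum integrable_fourier_kernel int)
  also have "1 / complex_of_real (sqrt (2 * pi)) * \<dots> = (\<Sum>j<n. fourier_integral (\<lambda>x. K ((y j - x) / h)) t)"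
    unfolding fourier_integral_def sum_distrib_left ..
  also have "\<dots> = (\<Sum>j<n. complex_of_real h * fourier_integral K (- (t * h)) * exp (- \<i> * complex_of_real (t * y j)))"
    unfolding fourier_integral_scaled_kernel[OF h] by (simp only: mult_ac)
  also have "1 / complex_of_real (real n * h) * \<dots> = fourier_integral K (- (t * h)) *
    (1 / of_nat n * (\<Sum>j<n. exp (- \<i> * complex_of_real (t * y j))))"
    unfolding sum_distrib_left[symmetric] using h by simp
  finally show ?thesis .
qed

lemma L2_densityD:
  assumes "f \<in> L2_densities"
  shows "f \<in> borel_measurable borel" "0 \<le> f x" "cplx f \<in> L1 \<inter> L2" "integrable lborel f"
    "(LINT x|lborel. f x) = 1"
proof -
  have f: "f \<in> borel_measurable borel" "\<And>x. 0 \<le> f x" "(\<integral>\<^sup>+x. ennreal (f x) \<partial>lborel) = 1" "cplx f \<in> L2"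
    using assms by (auto simp: L2_densities_def)
  then show "f \<in> borel_measurable borel" "0 \<le> f x" by auto
  show i: "integrable lborel f" using f by (intro integrableI_nonneg) auto
  then show "cplx f \<in> L1 \<inter> L2" using f by (simp add: L1_def)
  show "(LINT x|lborel. f x) = 1" using f by (subst integral_eq_nn_integral) auto
qed

lemma fourier_density: "f \<in> L2_densities \<Longrightarrow> fourier (cplx f) = fourier_integral (cplx f)"
  using L2_densityD(3) by (simp add: fourier_def)

lemma fourier_integral_convolve:
  assumes "integrable lborel f" "integrable lborel g"
  shows "fourier_integral (cplx (convolve f g)) t
    = complex_of_real (sqrt (2 * pi)) * fourier_integral (cplx f) t * fourier_integral (cplx g) t"
proof -
  have [measurable]: "f \<in> borel_measurable borel" "g \<in> borel_measurable borel" using assms by auto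
  let ?e = "\<lambda>x. exp (- \<i> * complex_of_real (t * x))"
  have shift: "integrable lborel (\<lambda>y. f (y - x))" for x
    using lborel_integrable_real_affine[OF assms(1), of 1 "- x"] by simp
  have shift_int: "(LINT y|lborel. k (y - x)) = (LINT y|lborel. k y)" for k :: "real \<Rightarrow> 'b::{banach,second_countable_topology}" and x
    using lborel_integral_real_affine[of 1 k "- x"] by simp
  have int: "integrable (lborel \<Otimes>\<^sub>M lborel) (\<lambda>(x, y). ?e y * (cplx f (y - x) * cplx g x))"
  proof (rule lborel_pair.Fubini_integrable)
    have "(LINT y|lborel. cmod (case (x, y) of (x, y) \<Rightarrow> ?e y * (cplx f (y - x) * cplx g x)))
        = (LINT y|lborel. \<bar>f y\<bar>) * \<bar>g x\<bar>" for x
      using shift_int[of "\<lambda>y. \<bar>f y\<bar>" x] by (simp add: norm_mult del: of_real_mult)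
    then show "integrable lborel (\<lambda>x. LINT y|lborel. cmod (case (x, y) of (x, y) \<Rightarrow> ?e y * (cplx f (y - x) * cplx g x)))"
      using assms(2) by simp
    have "integrable lborel (\<lambda>y. ?e y * (cplx f (y - x) * cplx g x))" for x
      using shift by (intro integrable_fourier_kernel integrable_mult_left) simp
    then show "AE x in lborel. integrable lborel (\<lambda>y. case (x, y) of (x, y) \<Rightarrow> ?e y * (cplx f (y - x) * cplx g x))"
      by simp
  qed measurable
  have "(LINT y|lborel. ?e y * cplx (convolve f g) y) = (LINT y|lborel. LINT x|lborel. ?e y * (cplx f (y - x) * cplx g x))"
  proof (intro Bochner_Integration.integral_cong refl)
    fix y
    have "cplx (convolve f g) y = (LINT x|lborel. cplx f (y - x) * cplx g x)"
      unfolding convolve_def by (subst integral_complex_of_real[symmetric]) simp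
    then show "?e y * cplx (convolve f g) y = (LINT x|lborel. ?e y * (cplx f (y - x) * cplx g x))"
      by (simp only: integral_mult_right_zero)
  qed
  also have "\<dots> = (LINT x|lborel. LINT y|lborel. ?e y * (cplx f (y - x) * cplx g x))"
    by (rule lborel_pair.Fubini_integral[OF int])
  also have "\<dots> = (LINT x|lborel. (LINT y|lborel. ?e y * cplx f y) * (?e x * cplx g x))"
  proof (intro Bochner_Integration.integral_cong refl)
    fix x
    have "(LINT y|lborel. ?e y * (cplx f (y - x) * cplx g x))
        = (LINT y|lborel. (?e (y - x) * cplx f (y - x)) * (?e x * cplx g x))"
    proof (intro Bochner_Integration.integral_cong refl)
      fix y
      have "?e y = ?e (y - x) * ?e x" by (subst exp_add[symmetric]) (simp add: algebra_simps)
      then show "?e y * (cplx f (y - x) * cplx g x) = (?e (y - x) * cplx f (y - x)) * (?e x * cplx g x)"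
        by (simp only: mult_ac)
    qed
    also have "\<dots> = (LINT y|lborel. ?e (y - x) * cplx f (y - x)) * (?e x * cplx g x)"
      by (rule integral_mult_left_zero)
    also have "(LINT y|lborel. ?e (y - x) * cplx f (y - x)) = (LINT y|lborel. ?e y * cplx f y)"
      by (rule shift_int[of "\<lambda>y. ?e y * cplx f y"])
    finally show "(LINT y|lborel. ?e y * (cplx f (y - x) * cplx g x))
        = (LINT y|lborel. ?e y * cplx f y) * (?e x * cplx g x)" .
  qed
  also have "\<dots> = (LINT y|lborel. ?e y * cplx f y) * (LINT x|lborel. ?e x * cplx g x)"
    by (rule integral_mult_right_zero)
  finally show ?thesis unfolding fourier_integral_def by simp
qed

lemma convolve_nonneg: "(\<And>x. 0 \<le> f x) \<Longrightarrow> (\<And>x. 0 \<le> g x) \<Longrightarrow> 0 \<le> convolve f g y"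
  unfolding convolve_def by (intro integral_nonneg_AE AE_I2) simp

lemma convolve_measurable:
  assumes [measurable]: "f \<in> borel_measurable borel" "g \<in> borel_measurable borel"
  shows "convolve f g \<in> borel_measurable borel"
  unfolding convolve_def[abs_def] by measurable

text \<open>The limit at \<open>0\<close> bounds the quotient on a punctured neighbourhood of \<open>0\<close>; away from \<open>0\<close> the
  transform of an integrable function is bounded and \<open>\<bar>u\<bar> powr r\<close> is bounded below.\<close>
lemma kernel_class_bias:
  assumes r: "r > 0" and K: "K \<in> kernel_class r"
  obtains C where "C \<ge> 0"
    "\<And>u. u \<noteq> 0 \<Longrightarrow> cmod (1 - complex_of_real (sqrt (2 * pi)) * fourier_integral K u) \<le> C * \<bar>u\<bar> powr r"
proof -
  let ?b = "\<lambda>u. cmod (1 - complex_of_real (sqrt (2 * pi)) * fourier_integral K u)"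
  have KL: "K \<in> L1 \<inter> L2" using K by (simp add: kernel_class_def)
  obtain \<kappa> where "((\<lambda>t. ?b t / \<bar>t\<bar> powr r) \<longlongrightarrow> \<kappa>) (at 0)"
    using K KL by (auto simp: kernel_class_def fourier_def)
  then have "\<forall>\<^sub>F t in at 0. ?b t / \<bar>t\<bar> powr r < \<kappa> + 1" by (rule order_tendstoD) simp
  then obtain \<delta> where \<delta>: "\<delta> > 0" and near: "\<And>t. t \<noteq> 0 \<Longrightarrow> \<bar>t\<bar> < \<delta> \<Longrightarrow> ?b t / \<bar>t\<bar> powr r < \<kappa> + 1"
    by (auto simp: eventually_at)
  define A where "A = 1 + (LINT x|lborel. cmod (K x))"
  have A: "A \<ge> 0" unfolding A_def by (intro add_nonneg_nonneg) (auto intro: integral_nonneg_AE)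
  have bA: "?b u \<le> A" for u
  proof -
    have "?b u \<le> cmod 1 + cmod (complex_of_real (sqrt (2 * pi)) * fourier_integral K u)"
      by (rule norm_triangle_ineq4)
    also have "\<dots> = 1 + sqrt (2 * pi) * cmod (fourier_integral K u)" by (simp add: norm_mult)
    also have "\<dots> \<le> 1 + sqrt (2 * pi) * (1 / sqrt (2 * pi) * (LINT x|lborel. cmod (K x)))"
      by (intro add_left_mono mult_left_mono cmod_fourier_integral_le) simp
    also have "\<dots> = A" by (simp add: A_def)
    finally show ?thesis .
  qed
  define C where "C = max (\<kappa> + 1) (A / \<delta> powr r)"
  have "C \<ge> 0" unfolding C_def using A by (auto simp: le_max_iff_disj)
  moreover have "?b u \<le> C * \<bar>u\<bar> powr r" if "u \<noteq> 0" for u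
  proof (cases "\<bar>u\<bar> < \<delta>")
    case True
    have "?b u \<le> (\<kappa> + 1) * \<bar>u\<bar> powr r" using near[OF that True] that by (simp add: field_simps)
    also have "\<dots> \<le> C * \<bar>u\<bar> powr r" by (intro mult_right_mono) (auto simp: C_def)
    finally show ?thesis .
  next
    case False
    have "?b u \<le> A / \<delta> powr r * \<delta> powr r" using bA[of u] \<delta> by simp
    also have "\<dots> \<le> A / \<delta> powr r * \<bar>u\<bar> powr r"
      using False A \<delta> r by (intro mult_left_mono powr_mono2) auto
    also have "\<dots> \<le> C * \<bar>u\<bar> powr r" by (intro mult_right_mono) (auto simp: C_def)
    finally show ?thesis .
  qed
  ultimately show ?thesis using that by blast
qed

section \<open>Error of a thresholded quotient\<close>

lemma cmod_add_sq_le: "(cmod (z + w))\<^sup>2 \<le> 2 * (cmod z)\<^sup>2 + 2 * (cmod w)\<^sup>2"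
proof -
  have "(cmod (z + w))\<^sup>2 \<le> (cmod z + cmod w)\<^sup>2"
    by (intro power_mono norm_triangle_ineq) auto
  also have "\<dots> \<le> 2 * (cmod z)\<^sup>2 + 2 * (cmod w)\<^sup>2"
    using sum_squares_bound[of "cmod z" "cmod w"] by (simp add: power2_sum)
  finally show ?thesis .
qed

text \<open>The deterministic heart of the risk bound, at a single frequency with weight \<open>L\<close>, noise transform
  \<open>\<Phi>\<close>, its estimate \<open>\<phi>\<close>, target \<open>u\<close> and estimate \<open>G\<close> of the data transform. Above the threshold,
  \<open>L\<^sup>2 / \<bar>\<phi>\<bar>\<^sup>2 \<le> 1 / \<alpha>\<close> controls the quotient. Below it, the error is \<open>L\<^sup>2 * \<bar>u\<bar>\<^sup>2\<close>: either \<open>\<Phi>\<close> itself is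
  small, which is the first summand, or \<open>\<bar>\<Phi>\<bar> \<ge> 2 * sqrt \<alpha> * L > 2 * \<bar>\<phi>\<bar>\<close>, and then \<open>\<bar>\<phi> - \<Phi>\<bar>\<^sup>2 \<ge> \<alpha> * L\<^sup>2\<close>, so
  that the error is absorbed by the last summand.\<close>
lemma thresholded_quotient_error:
  fixes G \<phi> \<Phi> u :: complex
  assumes L: "L > 0" and \<alpha>: "\<alpha> > 0"
  defines "D \<equiv> (if (cmod (\<phi> / complex_of_real L))\<^sup>2 \<ge> \<alpha>
      then G * cnj \<phi> / complex_of_real (sqrt (2 * pi) * (cmod \<phi>)\<^sup>2) else 0)"
  shows "L\<^sup>2 * (cmod (D - u))\<^sup>2
    \<le> (if (cmod \<Phi>)\<^sup>2 < 4 * \<alpha> * L\<^sup>2 then L\<^sup>2 * (cmod u)\<^sup>2 else 0)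
      + 1 / (pi * \<alpha>) * (cmod (G - complex_of_real (sqrt (2 * pi)) * u * \<Phi>))\<^sup>2
      + 2 / \<alpha> * ((cmod u)\<^sup>2 * (cmod (\<phi> - \<Phi>))\<^sup>2)"
proof -
  have threshold: "(cmod (\<phi> / complex_of_real L))\<^sup>2 \<ge> \<alpha> \<longleftrightarrow> \<alpha> * L\<^sup>2 \<le> (cmod \<phi>)\<^sup>2"
    using L by (simp add: norm_divide power_divide field_simps)
  let ?g = "complex_of_real (sqrt (2 * pi)) * u * \<Phi>"
  have nn: "0 \<le> (if (cmod \<Phi>)\<^sup>2 < 4 * \<alpha> * L\<^sup>2 then L\<^sup>2 * (cmod u)\<^sup>2 else 0)"
    "0 \<le> 1 / (pi * \<alpha>) * (cmod (G - ?g))\<^sup>2" "0 \<le> 2 / \<alpha> * ((cmod u)\<^sup>2 * (cmod (\<phi> - \<Phi>))\<^sup>2)"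
    using \<alpha> by auto
  show ?thesis
  proof (cases "\<alpha> * L\<^sup>2 \<le> (cmod \<phi>)\<^sup>2")
    case True
    have "0 < \<alpha> * L\<^sup>2" using L \<alpha> by simp
    then have phi: "(cmod \<phi>)\<^sup>2 > 0" using True by linarith
    then have phi0: "\<phi> \<noteq> 0" by auto
    have LL: "L\<^sup>2 / (cmod \<phi>)\<^sup>2 \<le> 1 / \<alpha>" using True phi \<alpha> by (simp add: field_simps)
    have "D = G / (complex_of_real (sqrt (2 * pi)) * \<phi>)"
    proof -
      have "D = G * cnj \<phi> / (complex_of_real (sqrt (2 * pi)) * (\<phi> * cnj \<phi>))"
        using True threshold unfolding D_def by (simp only: if_True of_real_mult complex_norm_square)
      then show ?thesis using phi0 by simp
    qed
    then have "D - u = (G - ?g) / (complex_of_real (sqrt (2 * pi)) * \<phi>) + - (u * (\<phi> - \<Phi>) / \<phi>)"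
      using phi0 by (simp add: field_simps)
    then have "(cmod (D - u))\<^sup>2 \<le> 2 * (cmod ((G - ?g) / (complex_of_real (sqrt (2 * pi)) * \<phi>)))\<^sup>2
        + 2 * (cmod (- (u * (\<phi> - \<Phi>) / \<phi>)))\<^sup>2"
      by (simp only: cmod_add_sq_le)
    also have "\<dots> = ((cmod (G - ?g))\<^sup>2 / pi + 2 * ((cmod u)\<^sup>2 * (cmod (\<phi> - \<Phi>))\<^sup>2)) / (cmod \<phi>)\<^sup>2"
    proof -
      have "2 * (cmod ((G - ?g) / (complex_of_real (sqrt (2 * pi)) * \<phi>)))\<^sup>2
          = 2 * ((cmod (G - ?g))\<^sup>2 / (2 * pi * (cmod \<phi>)\<^sup>2))"
        by (simp only: norm_divide norm_mult power_divide power_mult_distrib norm_of_real power2_abs real_sqrt_pow2) (simp add: pi_ge_zero)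
      moreover have "2 * (cmod (- (u * (\<phi> - \<Phi>) / \<phi>)))\<^sup>2 = 2 * ((cmod u)\<^sup>2 * (cmod (\<phi> - \<Phi>))\<^sup>2 / (cmod \<phi>)\<^sup>2)"
        by (simp only: norm_minus_cancel norm_divide norm_mult power_divide power_mult_distrib)
      ultimately show ?thesis by (simp add: add_divide_distrib)
    qed
    finally have "L\<^sup>2 * (cmod (D - u))\<^sup>2
        \<le> L\<^sup>2 * (((cmod (G - ?g))\<^sup>2 / pi + 2 * ((cmod u)\<^sup>2 * (cmod (\<phi> - \<Phi>))\<^sup>2)) / (cmod \<phi>)\<^sup>2)"
      by (intro mult_left_mono) auto
    also have "\<dots> = ((cmod (G - ?g))\<^sup>2 / pi + 2 * ((cmod u)\<^sup>2 * (cmod (\<phi> - \<Phi>))\<^sup>2)) * (L\<^sup>2 / (cmod \<phi>)\<^sup>2)"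
      by simp
    also have "\<dots> \<le> ((cmod (G - ?g))\<^sup>2 / pi + 2 * ((cmod u)\<^sup>2 * (cmod (\<phi> - \<Phi>))\<^sup>2)) * (1 / \<alpha>)"
      by (intro mult_left_mono LL) auto
    also have "\<dots> = 1 / (pi * \<alpha>) * (cmod (G - ?g))\<^sup>2 + 2 / \<alpha> * ((cmod u)\<^sup>2 * (cmod (\<phi> - \<Phi>))\<^sup>2)"
      by (simp add: add_divide_distrib)
    finally show ?thesis using nn(1) by linarith
  next
    case False
    then have D: "D = 0" using threshold by (simp add: D_def)
    show ?thesis
    proof (cases "(cmod \<Phi>)\<^sup>2 < 4 * \<alpha> * L\<^sup>2")
      case True
      then show ?thesis using D nn(2,3) by simp
    next
      case far: False
      have "sqrt \<alpha> * L \<le> cmod (\<phi> - \<Phi>)"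
      proof -
        have "(cmod \<phi>)\<^sup>2 \<le> (sqrt \<alpha> * L)\<^sup>2" using False \<alpha> by (simp add: power_mult_distrib)
        then have "cmod \<phi> \<le> sqrt \<alpha> * L" by (rule power2_le_imp_le) (use \<alpha> L in simp)
        moreover have "(2 * (sqrt \<alpha> * L))\<^sup>2 \<le> (cmod \<Phi>)\<^sup>2" using far \<alpha> by (simp add: power_mult_distrib)
        then have "2 * (sqrt \<alpha> * L) \<le> cmod \<Phi>" by (rule power2_le_imp_le) simp
        ultimately show ?thesis using norm_triangle_ineq2[of \<Phi> \<phi>] norm_minus_commute[of \<phi> \<Phi>] by linarith
      qed
      then have "(sqrt \<alpha> * L)\<^sup>2 \<le> (cmod (\<phi> - \<Phi>))\<^sup>2" using \<alpha> L by (intro power_mono) auto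
      then have "L\<^sup>2 \<le> (cmod (\<phi> - \<Phi>))\<^sup>2 / \<alpha>" using \<alpha> by (simp add: power_mult_distrib field_simps)
      then have "L\<^sup>2 * (cmod u)\<^sup>2 \<le> (cmod (\<phi> - \<Phi>))\<^sup>2 / \<alpha> * (cmod u)\<^sup>2" by (rule mult_right_mono) simp
      also have "\<dots> \<le> 2 / \<alpha> * ((cmod u)\<^sup>2 * (cmod (\<phi> - \<Phi>))\<^sup>2)" using \<alpha> by (simp add: field_simps)
      finally show ?thesis using D far nn(2) by simp
    qed
  qed
qed

section \<open>Supersmooth noise\<close>

text \<open>From \<open>ln x \<le> x - 1\<close> at \<open>x = y * d / q\<close>, the point that makes the linear term equal to \<open>d * y\<close>.\<close>
lemma powr_le_exp:
  fixes q d :: real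
  assumes q: "q > 0" and d: "d > 0"
  obtains B where "B > 0" "\<And>y. y > 0 \<Longrightarrow> y powr q \<le> B * exp (d * y)"
proof -
  define B where "B = exp (- q - q * ln (d / q))"
  have "y powr q \<le> B * exp (d * y)" if y: "y > 0" for y
  proof -
    have "ln y + ln (d / q) = ln (y * (d / q))" using y q d by (subst ln_mult_pos) auto
    also have "\<dots> \<le> y * (d / q) - 1" using y q d by (intro ln_le_minus_one) simp
    finally have "q * ln y \<le> q * (y * (d / q) - 1 - ln (d / q))" using q by (intro mult_left_mono) auto
    also have "\<dots> = d * y - q - q * ln (d / q)" using q by (simp add: right_diff_distrib)
    finally show ?thesis using y by (simp add: powr_def B_def flip: exp_add)
  qed
  moreover have "B > 0" by (simp add: B_def)
  ultimately show ?thesis using that by blast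
qed

text \<open>A probability density has \<open>\<bar>\<F>f\<bar>\<^sup>2 \<le> 1 / (2 * pi) < 1\<close>, so the logarithm in the definition of
  supersmoothness is negative and its absolute value can be resolved.\<close>
lemma supersmooth_bounds:
  assumes f: "f \<in> L2_densities" and pos: "\<forall>t. (cmod (fourier (cplx f) t))\<^sup>2 > 0"
    and ss: "supersmooth a f"
  obtains d where "d > 0"
    "\<And>t. exp (- ((1 + t\<^sup>2) powr a / d)) \<le> (cmod (fourier_integral (cplx f) t))\<^sup>2"
    "\<And>t. (cmod (fourier_integral (cplx f) t))\<^sup>2 \<le> exp (- (d * (1 + t\<^sup>2) powr a))"
proof -
  let ?F = "\<lambda>t. (cmod (fourier_integral (cplx f) t))\<^sup>2"
  obtain d where d: "d > 0"
    and lo: "\<And>t. d \<le> (1 + t\<^sup>2) powr a * inverse \<bar>ln (?F t)\<bar>"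
    and hi: "\<And>t. (1 + t\<^sup>2) powr a * inverse \<bar>ln (?F t)\<bar> \<le> inverse d"
    using ss by (auto simp: supersmooth_def fourier_density[OF f])
  have F0: "?F t > 0" for t using pos by (simp add: fourier_density[OF f])
  have lnF: "ln (?F t) < 0" for t
  proof -
    have "cmod (fourier_integral (cplx f) t) \<le> 1 / sqrt (2 * pi) * (LINT x|lborel. cmod (cplx f x))"
      by (rule cmod_fourier_integral_le)
    also have "(LINT x|lborel. cmod (cplx f x)) = 1"
      using L2_densityD(5)[OF f] L2_densityD(2)[OF f] by simp
    finally have "cmod (fourier_integral (cplx f) t) \<le> 1 / sqrt (2 * pi)" by simp
    then have "?F t \<le> (1 / sqrt (2 * pi))\<^sup>2" by (intro power_mono) auto
    also have "\<dots> = 1 / (2 * pi)" by (simp add: power_divide)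
    also have "\<dots> < 1" using pi_ge_two by simp
    finally show ?thesis using F0 by simp
  qed
  have "exp (- ((1 + t\<^sup>2) powr a / d)) \<le> ?F t" for t
  proof -
    have "- ((1 + t\<^sup>2) powr a / d) \<le> ln (?F t)"
      using lo[of t] lnF[of t] d by (simp add: field_simps)
    then have "exp (- ((1 + t\<^sup>2) powr a / d)) \<le> exp (ln (?F t))" by (simp only: exp_le_cancel_iff)
    then show ?thesis using F0[of t] by (simp only: exp_ln)
  qed
  moreover have "?F t \<le> exp (- (d * (1 + t\<^sup>2) powr a))" for t
  proof -
    have "ln (?F t) \<le> - (d * (1 + t\<^sup>2) powr a)"
      using hi[of t] lnF[of t] d by (simp add: field_simps)
    then have "exp (ln (?F t)) \<le> exp (- (d * (1 + t\<^sup>2) powr a))" by (simp only: exp_le_cancel_iff)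
    then show ?thesis using F0[of t] by (simp only: exp_ln)
  qed
  ultimately show ?thesis using d that by blast
qed

text \<open>With \<open>u\<close> and \<open>\<Phi>\<close> the transforms of \<open>f_X\<close> and \<open>f_\<epsilon>\<close> the integrand involves the transform of the
  density of the observations: that density inherits the exponential decay of the noise and hence lies in every Sobolev
  class, whatever the kernel order \<open>r\<close>.\<close>
lemma weighted_moment_finite:
  fixes u \<Phi> :: "real \<Rightarrow> complex"
  assumes u: "u \<in> L2" and a: "a > 0" and r: "r > 0" and d: "d > 0"
    and decay: "\<And>t. (cmod (\<Phi> t))\<^sup>2 \<le> exp (- (d * (1 + t\<^sup>2) powr a))"
  obtains G where "G \<ge> 0"
    "(\<integral>\<^sup>+t. ennreal (\<bar>t\<bar> powr (2 * r) * (cmod (complex_of_real (sqrt (2 * pi)) * u t * \<Phi> t))\<^sup>2) \<partial>lborel) \<le> ennreal G"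
proof -
  obtain B where B: "B > 0" and Bexp: "\<And>y. y > 0 \<Longrightarrow> y powr (r / a) \<le> B * exp (d * y)"
    using powr_le_exp[of "r / a" d] a r d by auto
  have pt: "\<bar>t\<bar> powr (2 * r) * (cmod (complex_of_real (sqrt (2 * pi)) * u t * \<Phi> t))\<^sup>2
      \<le> 2 * pi * B * (cmod (u t))\<^sup>2" for t
  proof -
    have x: "1 + t\<^sup>2 > 0" by (simp add: add_pos_nonneg)
    have "\<bar>t\<bar> powr (2 * r) = (t\<^sup>2) powr r"
    proof (cases "t = 0")
      case False
      then have "\<bar>t\<bar> powr (2 * r) = (\<bar>t\<bar> powr 2) powr r" by (simp only: powr_powr)
      then show ?thesis using False by simp
    qed simp
    also have "\<dots> \<le> (1 + t\<^sup>2) powr r" using r by (intro powr_mono2) auto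
    also have "\<dots> = ((1 + t\<^sup>2) powr a) powr (r / a)" using a by (simp add: powr_powr)
    also have "\<dots> \<le> B * exp (d * (1 + t\<^sup>2) powr a)" using x by (intro Bexp) simp
    finally have "\<bar>t\<bar> powr (2 * r) * (cmod (\<Phi> t))\<^sup>2
        \<le> B * exp (d * (1 + t\<^sup>2) powr a) * exp (- (d * (1 + t\<^sup>2) powr a))"
      using decay[of t] B by (intro mult_mono) auto
    also have "\<dots> = B" by (simp add: exp_minus)
    finally have "2 * pi * (cmod (u t))\<^sup>2 * (\<bar>t\<bar> powr (2 * r) * (cmod (\<Phi> t))\<^sup>2) \<le> 2 * pi * (cmod (u t))\<^sup>2 * B"
      by (intro mult_left_mono) auto
    then show ?thesis by (simp add: norm_mult power_mult_distrib mult_ac)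
  qed
  have "(\<integral>\<^sup>+t. ennreal (\<bar>t\<bar> powr (2 * r) * (cmod (complex_of_real (sqrt (2 * pi)) * u t * \<Phi> t))\<^sup>2) \<partial>lborel)
      \<le> (\<integral>\<^sup>+t. ennreal (2 * pi * B * (cmod (u t))\<^sup>2) \<partial>lborel)"
    by (intro nn_integral_mono ennreal_leI pt)
  also have "\<dots> = ennreal (2 * pi * B * (L2_norm u)\<^sup>2)"
    using u B L2_measurable[OF u] by (simp add: ennreal_mult nn_integral_cmult nn_integral_L2_norm)
  finally show ?thesis using B that[of "2 * pi * B * (L2_norm u)\<^sup>2"] by simp
qed

text \<open>Only frequencies at which the noise transform is small contribute. By its exponential lower bound
  these are large, of order \<open>(1 + t\<^sup>2) powr a \<ge> \<Lambda> / (1 / d + s / a)\<close>, and there the weight of order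
  \<open>s\<close> is small compared to that of order \<open>p\<close>. The term \<open>s / a\<close> absorbs the polynomial weight in the
  threshold.\<close>
lemma cut_off_bias:
  fixes u \<Phi> :: "real \<Rightarrow> complex"
  assumes a: "a > 0" and d: "d > 0" and s: "0 \<le> s" and sp: "s < p" and \<alpha>: "\<alpha> > 0"
    and \<Lambda>: "0 < \<Lambda>" "\<Lambda> \<le> - ln (4 * \<alpha>)"
    and lower: "\<And>t. exp (- ((1 + t\<^sup>2) powr a / d)) \<le> (cmod (\<Phi> t))\<^sup>2"
    and [measurable]: "u \<in> borel_measurable borel"
  shows "(\<integral>\<^sup>+t. ennreal (if (cmod (\<Phi> t))\<^sup>2 < 4 * \<alpha> * (1 + t\<^sup>2) powr s
        then (1 + t\<^sup>2) powr s * (cmod (u t))\<^sup>2 else 0) \<partial>lborel)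
    \<le> ennreal ((\<Lambda> / (1 / d + s / a)) powr (- (p - s) / a)) *
      (\<integral>\<^sup>+t. ennreal ((1 + t\<^sup>2) powr p * (cmod (u t))\<^sup>2) \<partial>lborel)"
proof -
  define \<kappa> where "\<kappa> = 1 / d + s / a"
  have \<kappa>: "\<kappa> > 0" unfolding \<kappa>_def using d s a by (intro add_pos_nonneg) auto
  define E where "E = (\<Lambda> / \<kappa>) powr (- (p - s) / a)"
  have pt: "(if (cmod (\<Phi> t))\<^sup>2 < 4 * \<alpha> * (1 + t\<^sup>2) powr s then (1 + t\<^sup>2) powr s * (cmod (u t))\<^sup>2 else 0)
      \<le> E * ((1 + t\<^sup>2) powr p * (cmod (u t))\<^sup>2)" for t
  proof (cases "(cmod (\<Phi> t))\<^sup>2 < 4 * \<alpha> * (1 + t\<^sup>2) powr s")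
    case True
    define x where "x = 1 + t\<^sup>2"
    have x: "x \<ge> 1" by (simp add: x_def)
    have "exp (- (x powr a / d)) < 4 * \<alpha> * x powr s"
      using lower[of t] True unfolding x_def by linarith
    then have "- (x powr a / d) < ln (4 * \<alpha> * x powr s)"
      using \<alpha> x by (subst exp_less_cancel_iff[symmetric]) simp
    also have "\<dots> = ln (4 * \<alpha>) + s * ln x" using \<alpha> x by (simp add: ln_mult_pos ln_powr)
    also have "\<dots> \<le> - \<Lambda> + s * (x powr a / a)"
    proof -
      have "a * ln x = ln (x powr a)" using x by (simp add: ln_powr)
      also have "\<dots> \<le> x powr a" using x by (intro less_imp_le ln_less_self) simp
      finally have "ln x \<le> x powr a / a" using a by (simp add: field_simps)
      then have "s * ln x \<le> s * (x powr a / a)" using s by (intro mult_left_mono) auto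
      then show ?thesis using \<Lambda> by linarith
    qed
    finally have "\<Lambda> < \<kappa> * x powr a" by (simp add: \<kappa>_def distrib_right)
    then have "\<Lambda> / \<kappa> \<le> x powr a" using \<kappa> by (simp add: field_simps)
    then have "(x powr a) powr (- (p - s) / a) \<le> E"
      unfolding E_def using \<Lambda> \<kappa> sp a by (intro powr_mono2') (auto simp: divide_simps)
    moreover have "(x powr a) powr (- (p - s) / a) = x powr (s - p)" using a by (simp add: powr_powr)
    ultimately have "x powr (s - p) * x powr p \<le> E * x powr p" by (intro mult_right_mono) auto
    then have "x powr s \<le> E * x powr p" by (simp flip: powr_add)
    then have "x powr s * (cmod (u t))\<^sup>2 \<le> E * x powr p * (cmod (u t))\<^sup>2" by (rule mult_right_mono) simp
    then show ?thesis using True by (simp add: x_def mult.assoc)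
  qed (simp add: E_def)
  have "(\<integral>\<^sup>+t. ennreal (if (cmod (\<Phi> t))\<^sup>2 < 4 * \<alpha> * (1 + t\<^sup>2) powr s
        then (1 + t\<^sup>2) powr s * (cmod (u t))\<^sup>2 else 0) \<partial>lborel)
      \<le> (\<integral>\<^sup>+t. ennreal E * ennreal ((1 + t\<^sup>2) powr p * (cmod (u t))\<^sup>2) \<partial>lborel)"
  proof (intro nn_integral_mono)
    fix t
    have "0 \<le> E" by (simp add: E_def)
    then have "ennreal E * ennreal ((1 + t\<^sup>2) powr p * (cmod (u t))\<^sup>2)
        = ennreal (E * ((1 + t\<^sup>2) powr p * (cmod (u t))\<^sup>2))" by (simp add: ennreal_mult)
    then show "ennreal (if (cmod (\<Phi> t))\<^sup>2 < 4 * \<alpha> * (1 + t\<^sup>2) powr s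
        then (1 + t\<^sup>2) powr s * (cmod (u t))\<^sup>2 else 0)
      \<le> ennreal E * ennreal ((1 + t\<^sup>2) powr p * (cmod (u t))\<^sup>2)"
      by (simp only: ennreal_leI[OF pt])
  qed
  also have "\<dots> = ennreal E * (\<integral>\<^sup>+t. ennreal ((1 + t\<^sup>2) powr p * (cmod (u t))\<^sup>2) \<partial>lborel)"
    by (rule nn_integral_cmult) measurable
  finally show ?thesis by (simp add: E_def \<kappa>_def)
qed

section \<open>Risk for fixed sample sizes\<close>

lemma ell_measurable [measurable]: "ell s \<in> borel_measurable borel"
  unfolding ell_def[abs_def] by measurable

lemma ell_pos: "ell s t > 0"
proof -
  have "1 + t\<^sup>2 > 0" by (simp add: add_pos_nonneg)
  then show ?thesis by (simp add: ell_def)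
qed

lemma ell_sq: "(ell s t)\<^sup>2 = (1 + t\<^sup>2) powr s"
proof -
  have "1 + t\<^sup>2 > 0" by (simp add: add_pos_nonneg)
  then show ?thesis by (simp add: ell_def power2_eq_square flip: powr_add)
qed

lemma empirical_fourier_measurable [measurable]: "empirical_fourier m e \<in> borel_measurable borel"
  unfolding empirical_fourier_def[abs_def] by measurable

text \<open>Where the indicator does not vanish, \<open>\<bar>\<phi>\<bar> \<ge> sqrt \<alpha>\<close>, since \<open>ell s \<ge> 1\<close>.\<close>
lemma deconv_fourier_L2:
  assumes G: "fourier G \<in> L2" and s: "0 \<le> s" and \<alpha>: "\<alpha> > 0"
    and [measurable]: "\<phi> \<in> borel_measurable borel"
  shows "deconv_fourier s \<alpha> G \<phi> \<in> L2"
proof (rule L2_dominated)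
  note [measurable] = L2_measurable[OF G]
  show "(\<lambda>t. complex_of_real (1 / sqrt \<alpha>) * fourier G t) \<in> L2" by (rule L2_cmult[OF G])
  show "deconv_fourier s \<alpha> G \<phi> \<in> borel_measurable borel"
    unfolding deconv_fourier_def[abs_def] by measurable
  show "AE t in lborel. cmod (deconv_fourier s \<alpha> G \<phi> t) \<le> cmod (complex_of_real (1 / sqrt \<alpha>) * fourier G t)"
  proof (intro AE_I2)
    fix t
    show "cmod (deconv_fourier s \<alpha> G \<phi> t) \<le> cmod (complex_of_real (1 / sqrt \<alpha>) * fourier G t)"
    proof (cases "\<alpha> \<le> (cmod (\<phi> t / complex_of_real (ell s t)))\<^sup>2")
      case True
      have "1 \<le> (1 + t\<^sup>2) powr (s / 2)" using s by (intro ge_one_powr_ge_zero) auto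
      then have l: "1 \<le> ell s t" by (simp add: ell_def)
      have "sqrt \<alpha> \<le> cmod (\<phi> t / complex_of_real (ell s t))"
        using real_sqrt_le_mono[OF True] by simp
      also have "\<dots> = cmod (\<phi> t) / ell s t" using l by (simp add: norm_divide)
      also have "\<dots> \<le> cmod (\<phi> t)" using l by (simp add: divide_le_eq mult_le_cancel_left1)
      finally have \<phi>: "sqrt \<alpha> \<le> cmod (\<phi> t)" .
      have "0 < sqrt \<alpha>" using \<alpha> by simp
      then have p0: "0 < cmod (\<phi> t)" using \<phi> by linarith
      have "cmod (deconv_fourier s \<alpha> G \<phi> t) = cmod (fourier G t) / (sqrt (2 * pi) * cmod (\<phi> t))"
        using True p0 by (simp add: deconv_fourier_def norm_mult norm_divide power2_eq_square)
      also have "\<dots> \<le> cmod (fourier G t) / (1 * sqrt \<alpha>)"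
        using \<phi> \<alpha> pi_ge_two by (intro divide_left_mono mult_mono) (auto intro!: mult_pos_pos)
      finally show ?thesis using \<alpha> by (simp add: norm_mult norm_divide)
    qed (simp add: deconv_fourier_def)
  qed
qed

lemma nn_integral_affine_comb:
  fixes Q E :: "'a \<Rightarrow> real"
  assumes "prob_space M" and [measurable]: "Q \<in> borel_measurable M" "E \<in> borel_measurable M"
    and nn: "\<And>x. 0 \<le> Q x" "\<And>x. 0 \<le> E x" "0 \<le> a" "0 \<le> b" "0 \<le> c" "0 \<le> q" "0 \<le> e"
    and "(\<integral>\<^sup>+x. ennreal (Q x) \<partial>M) \<le> ennreal q" "(\<integral>\<^sup>+x. ennreal (E x) \<partial>M) \<le> ennreal e"
  shows "(\<integral>\<^sup>+x. ennreal (a + b * Q x + c * E x) \<partial>M) \<le> ennreal (a + b * q + c * e)"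
proof -
  interpret prob_space M by fact
  have "(\<integral>\<^sup>+x. ennreal (a + b * Q x + c * E x) \<partial>M)
      = (\<integral>\<^sup>+x. ennreal a + ennreal b * ennreal (Q x) + ennreal c * ennreal (E x) \<partial>M)"
    using nn by (intro nn_integral_cong) (simp add: ennreal_mult)
  also have "\<dots> = ennreal a + ennreal b * (\<integral>\<^sup>+x. ennreal (Q x) \<partial>M) + ennreal c * (\<integral>\<^sup>+x. ennreal (E x) \<partial>M)"
    by (simp add: nn_integral_add nn_integral_cmult emeasure_space_1)
  also have "\<dots> \<le> ennreal a + ennreal b * ennreal q + ennreal c * ennreal e"
    using assms by (intro add_mono mult_left_mono) auto
  also have "\<dots> = ennreal (a + b * q + c * e)" using nn by (simp add: ennreal_mult)
  finally show ?thesis .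
qed

text \<open>A bound for fixed sample sizes, bandwidth and threshold. The pointwise error bound is integrated
  over frequencies and over the probability space; after exchanging the two integrals, the two
  empirical characteristic functions enter only through their second moments. The data term splits
  into the variance of the empirical characteristic function, damped by the transform of the kernel,
  and the bias of the kernel.\<close>
theorem deconvolution_risk:
  fixes M :: "'a measure" and Ys \<epsilon>s :: "nat \<Rightarrow> 'a \<Rightarrow> real"
  assumes fX: "f_X \<in> L2_densities" and fe: "f_\<epsilon> \<in> L2_densities"
    and M: "prob_space M" and Ys: "iid_sample M Ys (convolve f_X f_\<epsilon>)" and \<epsilon>s: "iid_sample M \<epsilon>s f_\<epsilon>"
    and K: "K \<in> L1 \<inter> L2" and C: "C \<ge> 0"
    and bias: "\<And>v. v \<noteq> 0 \<Longrightarrow> cmod (1 - complex_of_real (sqrt (2 * pi)) * fourier_integral K v) \<le> C * \<bar>v\<bar> powr r"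
    and h: "h > 0" and \<alpha>: "\<alpha> > 0" and n: "n > 0" and m: "m > 0" and s: "0 \<le> s"
    and G: "G \<ge> 0" and moment: "(\<integral>\<^sup>+t. ennreal (\<bar>t\<bar> powr (2 * r) * (cmod (complex_of_real (sqrt (2 * pi)) *
        fourier_integral (cplx f_X) t * fourier_integral (cplx f_\<epsilon>) t))\<^sup>2) \<partial>lborel) \<le> ennreal G"
  shows "(\<integral>\<^sup>+\<omega>. sobolev_norm_sq s (\<lambda>x. deconv_estimator s \<alpha> (kernel_estimator K h n (\<lambda>j. Ys j \<omega>))
        (empirical_fourier m (\<lambda>j. \<epsilon>s j \<omega>)) x - complex_of_real (f_X x)) \<partial>M)
    \<le> (\<integral>\<^sup>+t. ennreal (if (cmod (fourier_integral (cplx f_\<epsilon>) t))\<^sup>2 < 4 * \<alpha> * (1 + t\<^sup>2) powr s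
          then (1 + t\<^sup>2) powr s * (cmod (fourier_integral (cplx f_X) t))\<^sup>2 else 0) \<partial>lborel)
      + ennreal (1 / (pi * \<alpha>) * (2 / (real n * h) * (L2_norm K)\<^sup>2 + 2 * C\<^sup>2 * h powr (2 * r) * G
          + 1 / real m * (L2_norm (cplx f_X))\<^sup>2))"
proof -
  interpret prob_space M by fact
  interpret pair_sigma_finite M lborel ..
  let ?S = "complex_of_real (sqrt (2 * pi))"
  define u where "u = fourier_integral (cplx f_X)"
  define \<Phi> where "\<Phi> = fourier_integral (cplx f_\<epsilon>)"
  define g where "g t = ?S * u t * \<Phi> t" for t
  define k where "k t = fourier_integral K (- (t * h))" for t
  define q where "q \<omega> t = 1 / of_nat n * (\<Sum>j<n. exp (- \<i> * complex_of_real (t * Ys j \<omega>)))" for \<omega> t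
  define e where "e \<omega> t = 1 / of_nat m * (\<Sum>j<m. exp (- \<i> * complex_of_real (t * \<epsilon>s j \<omega>)))" for \<omega> t
  define B where "B t = (if (cmod (\<Phi> t))\<^sup>2 < 4 * \<alpha> * (1 + t\<^sup>2) powr s
      then (1 + t\<^sup>2) powr s * (cmod (u t))\<^sup>2 else 0)" for t
  define b where "b t = C\<^sup>2 * h powr (2 * r) * (\<bar>t\<bar> powr (2 * r) * (cmod (g t))\<^sup>2)" for t
  define Q where "Q \<omega> t = (cmod (q \<omega> t - ?S * g t))\<^sup>2" for \<omega> t
  define E where "E \<omega> t = (cmod (e \<omega> t - ?S * \<Phi> t))\<^sup>2" for \<omega> t
  define R where "R \<omega> t = (B t + 2 / (pi * \<alpha>) * b t) + 2 / (pi * \<alpha>) * (cmod (k t))\<^sup>2 * Q \<omega> t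
      + 1 / (pi * \<alpha>) * (cmod (u t))\<^sup>2 * E \<omega> t" for \<omega> t
  have fm[measurable]: "f_X \<in> borel_measurable borel" "f_\<epsilon> \<in> borel_measurable borel"
    using L2_densityD[OF fX] L2_densityD[OF fe] by auto
  have Km[measurable]: "K \<in> borel_measurable borel" using K L2_measurable by blast
  have um[measurable]: "u \<in> borel_measurable borel" and pm[measurable]: "\<Phi> \<in> borel_measurable borel"
    unfolding u_def \<Phi>_def by measurable
  have gm[measurable]: "g \<in> borel_measurable borel" unfolding g_def[abs_def] by measurable
  have km[measurable]: "k \<in> borel_measurable borel" unfolding k_def[abs_def] by measurable
  have Bm[measurable]: "B \<in> borel_measurable borel" unfolding B_def[abs_def] by measurable
  have bm[measurable]: "b \<in> borel_measurable borel" unfolding b_def[abs_def] by measurable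
  have [measurable]: "Ys j \<in> borel_measurable M" "\<epsilon>s j \<in> borel_measurable M" for j
    using Ys \<epsilon>s by (auto simp: iid_sample_def has_density_def distributed_def)
  have Qm[measurable]: "(\<lambda>(\<omega>, t). Q \<omega> t) \<in> borel_measurable (M \<Otimes>\<^sub>M lborel)"
    unfolding Q_def q_def by measurable
  have Em[measurable]: "(\<lambda>(\<omega>, t). E \<omega> t) \<in> borel_measurable (M \<Otimes>\<^sub>M lborel)"
    unfolding E_def e_def by measurable
  have Rm: "(\<lambda>(\<omega>, t). ennreal (R \<omega> t)) \<in> borel_measurable (M \<Otimes>\<^sub>M lborel)"
    unfolding R_def by measurable
  have nn: "0 \<le> B t" "0 \<le> b t" "0 \<le> Q \<omega> t" "0 \<le> E \<omega> t" for \<omega> t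
    using C by (auto simp: B_def b_def Q_def E_def)

  have pointwise: "sobolev_norm_sq s (\<lambda>x. deconv_estimator s \<alpha> (kernel_estimator K h n (\<lambda>j. Ys j \<omega>))
        (empirical_fourier m (\<lambda>j. \<epsilon>s j \<omega>)) x - complex_of_real (f_X x)) \<le> (\<integral>\<^sup>+t. ennreal (R \<omega> t) \<partial>lborel)" for \<omega>
  proof -
    define fY where "fY = kernel_estimator K h n (\<lambda>j. Ys j \<omega>)"
    define \<phi> where "\<phi> = empirical_fourier m (\<lambda>j. \<epsilon>s j \<omega>)"
    define D where "D = deconv_fourier s \<alpha> fY \<phi>"
    have fY: "fY \<in> L2" unfolding fY_def using kernel_estimator_L1_L2[OF K h] by blast
    have DL: "D \<in> L2" unfolding D_def \<phi>_def by (intro deconv_fourier_L2 fourier_L2 fY s \<alpha>) measurable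
    note est = deconv_estimator_props[OF DL[unfolded D_def]]
    have X2: "cplx f_X \<in> L2" using L2_densityD(3)[OF fX] by blast
    have "AE t in lborel. fourier (\<lambda>x. deconv_estimator s \<alpha> fY \<phi> x - cplx f_X x) t = D t - u t"
      using fourier_diff_AE[OF est(1) X2] est(2)
      by eventually_elim (simp add: D_def u_def fourier_density[OF fX])
    then have "sobolev_norm_sq s (\<lambda>x. deconv_estimator s \<alpha> fY \<phi> x - cplx f_X x)
        = (\<integral>\<^sup>+t. ennreal ((1 + t\<^sup>2) powr s * (cmod (D t - u t))\<^sup>2) \<partial>lborel)"
      unfolding sobolev_norm_sq_def by (intro nn_integral_cong_AE) (auto elim: eventually_mono)
    also have "\<dots> \<le> (\<integral>\<^sup>+t. ennreal (R \<omega> t) \<partial>lborel)"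
    proof (rule nn_integral_mono_AE)
      show "AE t in lborel. ennreal ((1 + t\<^sup>2) powr s * (cmod (D t - u t))\<^sup>2) \<le> ennreal (R \<omega> t)"
        \<comment> \<open>The kernel bias is controlled off the origin only.\<close>
        using AE_lborel_singleton[of 0]
      proof eventually_elim
        case (elim t)
        have fYt: "fourier fY t = k t * q \<omega> t"
          unfolding fY_def k_def q_def by (rule fourier_kernel_estimator[OF K h])
        have split: "(1 + t\<^sup>2) powr s * (cmod (D t - u t))\<^sup>2
            \<le> B t + 1 / (pi * \<alpha>) * (cmod (fourier fY t - g t))\<^sup>2
              + 2 / \<alpha> * ((cmod (u t))\<^sup>2 * (cmod (\<phi> t - \<Phi> t))\<^sup>2)"
        proof -
          have Dt: "D t = (if (cmod (\<phi> t / complex_of_real (ell s t)))\<^sup>2 \<ge> \<alpha>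
            then fourier fY t * cnj (\<phi> t) / complex_of_real (sqrt (2 * pi) * (cmod (\<phi> t))\<^sup>2) else 0)"
            by (simp add: D_def deconv_fourier_def)
          show ?thesis
            using thresholded_quotient_error[OF ell_pos \<alpha>, where \<phi> = "\<phi> t" and G = "fourier fY t" and u = "u t" and \<Phi> = "\<Phi> t"]
            by (simp only: Dt ell_sq B_def g_def)
        qed
        have "(cmod (fourier fY t - g t))\<^sup>2 \<le> 2 * ((cmod (k t))\<^sup>2 * Q \<omega> t) + 2 * b t"
        proof -
          have "fourier fY t - g t = k t * (q \<omega> t - ?S * g t) + - (g t * (1 - ?S * k t))"
            unfolding fYt by (simp add: algebra_simps)
          then have "(cmod (fourier fY t - g t))\<^sup>2
              \<le> 2 * (cmod (k t * (q \<omega> t - ?S * g t)))\<^sup>2 + 2 * (cmod (- (g t * (1 - ?S * k t))))\<^sup>2"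
            by (simp only: cmod_add_sq_le)
          also have "\<dots> = 2 * ((cmod (k t))\<^sup>2 * Q \<omega> t) + 2 * ((cmod (g t))\<^sup>2 * (cmod (1 - ?S * k t))\<^sup>2)"
            by (simp only: norm_minus_cancel norm_mult power_mult_distrib Q_def)
          also have "\<dots> \<le> 2 * ((cmod (k t))\<^sup>2 * Q \<omega> t) + 2 * ((cmod (g t))\<^sup>2 * (C * \<bar>- (t * h)\<bar> powr r)\<^sup>2)"
            unfolding k_def using elim h by (intro add_left_mono mult_left_mono power_mono bias) auto
          also have "(C * \<bar>- (t * h)\<bar> powr r)\<^sup>2 = C\<^sup>2 * h powr (2 * r) * \<bar>t\<bar> powr (2 * r)"
          proof -
            have sq: "(z powr r)\<^sup>2 = z powr (2 * r)" for z :: real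
              by (simp add: power2_eq_square flip: powr_add)
            show ?thesis using h by (simp add: abs_mult powr_mult power_mult_distrib sq mult_ac)
          qed
          finally show ?thesis by (simp add: b_def mult_ac)
        qed
        then have data: "1 / (pi * \<alpha>) * (cmod (fourier fY t - g t))\<^sup>2
            \<le> 1 / (pi * \<alpha>) * (2 * ((cmod (k t))\<^sup>2 * Q \<omega> t) + 2 * b t)"
          using \<alpha> by (intro mult_left_mono) auto
        have noise: "(cmod (\<phi> t - \<Phi> t))\<^sup>2 = 1 / (2 * pi) * E \<omega> t"
        proof -
          have "\<phi> t - \<Phi> t = (e \<omega> t - ?S * \<Phi> t) / ?S"
            unfolding \<phi>_def empirical_fourier_def e_def by (simp add: diff_divide_distrib)
          then show ?thesis
            unfolding E_def by (simp add: norm_divide power_divide)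
        qed
        have R_eq: "R \<omega> t = B t + 1 / (pi * \<alpha>) * (2 * ((cmod (k t))\<^sup>2 * Q \<omega> t) + 2 * b t)
            + 2 / \<alpha> * ((cmod (u t))\<^sup>2 * (1 / (2 * pi) * E \<omega> t))"
          using \<alpha> by (simp add: R_def field_simps)
        have "(1 + t\<^sup>2) powr s * (cmod (D t - u t))\<^sup>2 \<le> R \<omega> t"
          using split data unfolding noise R_eq by linarith
        then show ?case by (rule ennreal_leI)
      qed
    qed
    finally show ?thesis by (simp add: fY_def \<phi>_def)
  qed

  have Q1: "(\<integral>\<^sup>+\<omega>. ennreal (Q \<omega> t) \<partial>M) \<le> ennreal (1 / real n)" for t
  proof -
    have "g t = fourier_integral (cplx (convolve f_X f_\<epsilon>)) t"
      using fourier_integral_convolve[of f_X f_\<epsilon>] L2_densityD(4)[OF fX] L2_densityD(4)[OF fe]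
      by (simp add: g_def u_def \<Phi>_def)
    then show ?thesis unfolding Q_def q_def
      using empirical_char_second_moment[OF M Ys _ _ n, of t] L2_densityD(1,2)[OF fX] L2_densityD(1,2)[OF fe]
      by (simp only: convolve_nonneg convolve_measurable)
  qed
  have E1: "(\<integral>\<^sup>+\<omega>. ennreal (E \<omega> t) \<partial>M) \<le> ennreal (1 / real m)" for t
    unfolding E_def e_def \<Phi>_def
    by (rule empirical_char_second_moment[OF M \<epsilon>s L2_densityD(2)[OF fe] L2_densityD(1)[OF fe] m])
  have inner: "(\<integral>\<^sup>+\<omega>. ennreal (R \<omega> t) \<partial>M) \<le> ennreal ((B t + 2 / (pi * \<alpha>) * b t)
      + 2 / (pi * \<alpha>) * (cmod (k t))\<^sup>2 * (1 / real n) + 1 / (pi * \<alpha>) * (cmod (u t))\<^sup>2 * (1 / real m))" for t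
    unfolding R_def
    by (rule nn_integral_affine_comb[OF M])
       (use nn \<alpha> Q1[of t] E1[of t] in \<open>auto intro!: add_nonneg_nonneg mult_nonneg_nonneg simp: Q_def E_def q_def e_def\<close>)
  have k2: "(\<integral>\<^sup>+t. ennreal ((cmod (k t))\<^sup>2) \<partial>lborel) = ennreal ((L2_norm K)\<^sup>2 / h)"
  proof -
    have FK: "fourier_integral K \<in> L2" "L2_norm (fourier_integral K) = L2_norm K"
      by (rule plancherel_L1_L2[OF K])+
    have "ennreal ((L2_norm K)\<^sup>2) = (\<integral>\<^sup>+t. ennreal ((cmod (fourier_integral K t))\<^sup>2) \<partial>lborel)"
      using nn_integral_L2_norm[OF FK(1)] FK(2) by simp
    also have "\<dots> = ennreal \<bar>- h\<bar> * (\<integral>\<^sup>+t. ennreal ((cmod (fourier_integral K (0 + (- h) * t)))\<^sup>2) \<partial>lborel)"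
      using h by (intro nn_integral_real_affine) auto
    also have "\<dots> = ennreal h * (\<integral>\<^sup>+t. ennreal ((cmod (k t))\<^sup>2) \<partial>lborel)"
      using h by (simp add: k_def mult.commute)
    finally have "ennreal (1 / h) * ennreal ((L2_norm K)\<^sup>2)
        = ennreal (1 / h) * (ennreal h * (\<integral>\<^sup>+t. ennreal ((cmod (k t))\<^sup>2) \<partial>lborel))" by simp
    then show ?thesis using h by (simp add: mult.assoc[symmetric] flip: ennreal_mult)
  qed
  have u2: "(\<integral>\<^sup>+t. ennreal ((cmod (u t))\<^sup>2) \<partial>lborel) = ennreal ((L2_norm (cplx f_X))\<^sup>2)"
    using nn_integral_L2_norm plancherel_L1_L2[OF L2_densityD(3)[OF fX]] by (simp add: u_def)
  have b2: "(\<integral>\<^sup>+t. ennreal (b t) \<partial>lborel) \<le> ennreal (C\<^sup>2 * h powr (2 * r) * G)"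
  proof -
    have "(\<integral>\<^sup>+t. ennreal (b t) \<partial>lborel)
        = ennreal (C\<^sup>2 * h powr (2 * r)) * (\<integral>\<^sup>+t. ennreal (\<bar>t\<bar> powr (2 * r) * (cmod (g t))\<^sup>2) \<partial>lborel)"
      unfolding b_def by (subst nn_integral_cmult[symmetric]) (auto simp: ennreal_mult)
    also have "\<dots> \<le> ennreal (C\<^sup>2 * h powr (2 * r)) * ennreal G"
      using moment by (intro mult_left_mono) (auto simp: g_def u_def \<Phi>_def)
    finally show ?thesis using G by (simp add: ennreal_mult)
  qed
  have "(\<integral>\<^sup>+\<omega>. sobolev_norm_sq s (\<lambda>x. deconv_estimator s \<alpha> (kernel_estimator K h n (\<lambda>j. Ys j \<omega>))
        (empirical_fourier m (\<lambda>j. \<epsilon>s j \<omega>)) x - complex_of_real (f_X x)) \<partial>M)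
      \<le> (\<integral>\<^sup>+\<omega>. \<integral>\<^sup>+t. ennreal (R \<omega> t) \<partial>lborel \<partial>M)"
    by (intro nn_integral_mono pointwise)
  also have "\<dots> = (\<integral>\<^sup>+t. \<integral>\<^sup>+\<omega>. ennreal (R \<omega> t) \<partial>M \<partial>lborel)"
    using Fubini[OF Rm] by simp
  also have "\<dots> \<le> (\<integral>\<^sup>+t. ennreal ((B t + 2 / (pi * \<alpha>) * b t)
      + 2 / (pi * \<alpha>) * (cmod (k t))\<^sup>2 * (1 / real n) + 1 / (pi * \<alpha>) * (cmod (u t))\<^sup>2 * (1 / real m)) \<partial>lborel)"
    by (intro nn_integral_mono inner)
  also have "\<dots> = (\<integral>\<^sup>+t. ennreal (B t) + ennreal (2 / (pi * \<alpha>)) * ennreal (b t)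
      + ennreal (2 / (pi * \<alpha> * real n)) * ennreal ((cmod (k t))\<^sup>2)
      + ennreal (1 / (pi * \<alpha> * real m)) * ennreal ((cmod (u t))\<^sup>2) \<partial>lborel)"
    using nn \<alpha> by (intro nn_integral_cong) (simp flip: ennreal_mult ennreal_plus)
  also have "\<dots> = (\<integral>\<^sup>+t. ennreal (B t) \<partial>lborel) + ennreal (2 / (pi * \<alpha>)) * (\<integral>\<^sup>+t. ennreal (b t) \<partial>lborel)
      + ennreal (2 / (pi * \<alpha> * real n)) * (\<integral>\<^sup>+t. ennreal ((cmod (k t))\<^sup>2) \<partial>lborel)
      + ennreal (1 / (pi * \<alpha> * real m)) * (\<integral>\<^sup>+t. ennreal ((cmod (u t))\<^sup>2) \<partial>lborel)"
    by (simp add: nn_integral_add nn_integral_cmult)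
  also have "\<dots> \<le> (\<integral>\<^sup>+t. ennreal (B t) \<partial>lborel) + ennreal (2 / (pi * \<alpha>)) * ennreal (C\<^sup>2 * h powr (2 * r) * G)
      + ennreal (2 / (pi * \<alpha> * real n)) * ennreal ((L2_norm K)\<^sup>2 / h)
      + ennreal (1 / (pi * \<alpha> * real m)) * ennreal ((L2_norm (cplx f_X))\<^sup>2)"
    unfolding k2 u2 by (intro add_mono mult_left_mono b2) auto
  also have "\<dots> = (\<integral>\<^sup>+t. ennreal (B t) \<partial>lborel) + (ennreal (2 / (pi * \<alpha>) * (C\<^sup>2 * h powr (2 * r) * G)
      + 2 / (pi * \<alpha> * real n) * ((L2_norm K)\<^sup>2 / h) + 1 / (pi * \<alpha> * real m) * (L2_norm (cplx f_X))\<^sup>2))"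
    using \<alpha> G h by (simp add: add.assoc flip: ennreal_mult ennreal_plus)
  also have "2 / (pi * \<alpha>) * (C\<^sup>2 * h powr (2 * r) * G)
      + 2 / (pi * \<alpha> * real n) * ((L2_norm K)\<^sup>2 / h) + 1 / (pi * \<alpha> * real m) * (L2_norm (cplx f_X))\<^sup>2
    = 1 / (pi * \<alpha>) * (2 / (real n * h) * (L2_norm K)\<^sup>2 + 2 * C\<^sup>2 * h powr (2 * r) * G
          + 1 / real m * (L2_norm (cplx f_X))\<^sup>2)"
    by (simp add: distrib_left mult_ac)
  finally show ?thesis unfolding B_def \<Phi>_def u_def .
qed

section \<open>Rates\<close>

lemma powr_le_ln_powr:
  assumes q: "q > 0" and \<rho>: "\<rho> > 0"
  obtains B where "B > 0" "\<And>n::nat. n \<ge> 2 \<Longrightarrow> real n powr (- \<rho>) \<le> B * ln (real n) powr (- q)"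
proof -
  obtain B where B: "B > 0" and le: "\<And>y. y > 0 \<Longrightarrow> y powr q \<le> B * exp (\<rho> * y)"
    using powr_le_exp[OF q \<rho>] by blast
  have "real n powr (- \<rho>) \<le> B * ln (real n) powr (- q)" if "n \<ge> 2" for n :: nat
  proof -
    have ln: "ln (real n) > 0" using that by simp
    have "ln (real n) powr q \<le> B * real n powr \<rho>"
      using le[OF ln] that by (simp add: powr_def)
    then show ?thesis using that ln by (simp add: powr_minus field_simps)
  qed
  with B that show ?thesis by blast
qed

text \<open>With \<open>N = n powr (- r / (2 * r + 1))\<close> and \<open>M = m powr (- 1 / 2)\<close>, the bandwidth balances variance
  \<open>1 / (n * h)\<close> and squared bias \<open>h powr (2 * r)\<close> at the common order \<open>N\<^sup>2\<close>, and the threshold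
  \<open>\<alpha> = c' * (N + M)\<close> costs one factor: \<open>N\<^sup>2 / (N + M) \<le> N\<close> and \<open>M\<^sup>2 / (N + M) \<le> M\<close>.\<close>
lemma risk_rate:
  fixes n m :: nat
  assumes r: "r > 0" and c: "c > 0" and c': "c' > 0" and n: "n > 0" and m: "m > 0"
    and A: "A1 \<ge> 0" "A2 \<ge> 0" "A3 \<ge> 0"
  defines "h \<equiv> c * real n powr (- 1 / (2 * r + 1))"
    and "\<alpha> \<equiv> c' * (real n powr (- r / (2 * r + 1)) + real m powr (- 1 / 2))"
  shows "1 / (pi * \<alpha>) * (2 / (real n * h) * A1 + 2 * A2 * h powr (2 * r) * A3 + 1 / real m * A4\<^sup>2)
    \<le> 1 / (pi * c') * (2 / c * A1 + 2 * A2 * c powr (2 * r) * A3) * real n powr (- r / (2 * r + 1))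
      + 1 / (pi * c') * A4\<^sup>2 * real m powr (- 1 / 2)"
proof -
  define \<rho> where "\<rho> = r / (2 * r + 1)"
  define N where "N = real n powr (- \<rho>)"
  define M where "M = real m powr (- 1 / 2)"
  have N: "N > 0" and M: "M > 0" using n m by (simp_all add: N_def M_def)
  have \<alpha>: "\<alpha> = c' * (N + M)" by (simp add: \<alpha>_def N_def M_def \<rho>_def)
  have e1: "1 / (real n * h) = N\<^sup>2 / c"
  proof -
    have "real n * h = c * real n powr (1 - 1 / (2 * r + 1))"
      using n by (simp add: h_def powr_diff powr_minus field_simps)
    also have "1 - 1 / (2 * r + 1) = 2 * \<rho>" using r by (simp add: \<rho>_def field_simps)
    finally have "real n * h = c * (1 / N\<^sup>2)"
      using n by (simp add: N_def powr_minus power2_eq_square flip: powr_add) (simp add: divide_simps flip: powr_add)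
    then show ?thesis by simp
  qed
  have e2: "h powr (2 * r) = c powr (2 * r) * N\<^sup>2"
  proof -
    have "- 1 / (2 * r + 1) * (2 * r) = - \<rho> + - \<rho>" by (simp add: \<rho>_def)
    then show ?thesis using c n by (simp add: h_def N_def powr_mult powr_powr power2_eq_square flip: powr_add)
  qed
  have e3: "1 / real m = M\<^sup>2"
    using m by (simp add: M_def power2_eq_square powr_minus_divide flip: powr_add)
  have NM: "N\<^sup>2 / (N + M) \<le> N" "M\<^sup>2 / (N + M) \<le> M"
    using N M by (simp_all add: field_simps power2_eq_square)
  have "2 / (real n * h) = 2 * (1 / (real n * h))" by simp
  then have "1 / (pi * \<alpha>) * (2 / (real n * h) * A1 + 2 * A2 * h powr (2 * r) * A3 + 1 / real m * A4\<^sup>2)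
      = 1 / (pi * \<alpha>) * (2 * (N\<^sup>2 / c) * A1 + 2 * A2 * (c powr (2 * r) * N\<^sup>2) * A3 + M\<^sup>2 * A4\<^sup>2)"
    by (simp only: e1 e2 e3)
  also have "\<dots> = 1 / (pi * c') * (2 / c * A1 + 2 * A2 * c powr (2 * r) * A3) * (N\<^sup>2 / (N + M))
      + 1 / (pi * c') * A4\<^sup>2 * (M\<^sup>2 / (N + M))"
  proof -
    obtain T where T: "T = N + M" by blast
    then have "T > 0" using N M by simp
    then show ?thesis using c' c unfolding \<alpha> T[symmetric] by (simp add: field_simps)
  qed
  also have "\<dots> \<le> 1 / (pi * c') * (2 / c * A1 + 2 * A2 * c powr (2 * r) * A3) * N
      + 1 / (pi * c') * A4\<^sup>2 * M"
    using A c c' by (intro add_mono mult_left_mono NM mult_nonneg_nonneg add_nonneg_nonneg) auto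
  finally show ?thesis by (simp add: N_def M_def \<rho>_def)
qed

text \<open>The threshold is a sum of negative powers of the sample sizes, hence at most a constant times
  \<open>exp (- 2 * \<eta> * \<mu>)\<close>, since \<open>\<eta>\<close> is half of the smaller exponent;
  one of the two factors \<open>exp (- \<eta> * \<mu>)\<close> absorbs the constant \<open>8 * c'\<close>.\<close>
lemma threshold_log_lower:
  fixes n m :: nat
  assumes \<rho>: "\<rho> > 0" and c': "c' > 0" and n: "n \<ge> 2" and m: "m \<ge> 2"
  defines "\<eta> \<equiv> min (\<rho> / 2) (1 / 4)" and "\<mu> \<equiv> min (ln (real n)) (ln (real m))"
  assumes large: "ln (8 * c') \<le> \<eta> * ln (real n)" "ln (8 * c') \<le> \<eta> * ln (real m)"
  shows "\<eta> * \<mu> \<le> - ln (4 * (c' * (real n powr (- \<rho>) + real m powr (- 1 / 2))))"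
proof -
  have \<eta>: "\<eta> > 0" using \<rho> by (simp add: \<eta>_def)
  have \<mu>: "\<mu> > 0" using n m by (simp add: \<mu>_def)
  have "2 * \<eta> * \<mu> \<le> \<rho> * ln (real n)"
    using \<eta> n \<mu> by (intro mult_mono) (auto simp: \<eta>_def \<mu>_def)
  then have 1: "real n powr (- \<rho>) \<le> exp (- (2 * \<eta> * \<mu>))" using n by (simp add: powr_def)
  have "2 * \<eta> * \<mu> \<le> 1 / 2 * ln (real m)"
    using \<eta> m \<mu> by (intro mult_mono) (auto simp: \<eta>_def \<mu>_def)
  then have 2: "real m powr (- 1 / 2) \<le> exp (- (2 * \<eta> * \<mu>))" using m by (simp add: powr_def)
  have "ln (8 * c') \<le> \<eta> * \<mu>" using large by (simp add: \<mu>_def min_def)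
  then have "8 * c' \<le> exp (\<eta> * \<mu>)" using c' by (subst ln_le_cancel_iff[symmetric]) auto
  have "4 * (c' * (real n powr (- \<rho>) + real m powr (- 1 / 2)))
      \<le> 4 * (c' * (exp (- (2 * \<eta> * \<mu>)) + exp (- (2 * \<eta> * \<mu>))))"
    using 1 2 c' by (intro mult_left_mono add_mono) auto
  also have "\<dots> = 8 * c' * exp (- (2 * \<eta> * \<mu>))" by simp
  also have "\<dots> \<le> exp (\<eta> * \<mu>) * exp (- (2 * \<eta> * \<mu>))"
    using \<open>8 * c' \<le> _\<close> by (rule mult_right_mono) simp
  also have "\<dots> = exp (- (\<eta> * \<mu>))" by (simp flip: exp_add)
  finally have le: "4 * (c' * (real n powr (- \<rho>) + real m powr (- 1 / 2))) \<le> exp (- (\<eta> * \<mu>))" .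
  have "0 < 4 * (c' * (real n powr (- \<rho>) + real m powr (- 1 / 2)))"
    using c' n m by (intro mult_pos_pos add_pos_pos) auto
  then have "ln (4 * (c' * (real n powr (- \<rho>) + real m powr (- 1 / 2)))) \<le> ln (exp (- (\<eta> * \<mu>)))"
    using le by (subst ln_le_cancel_iff) auto
  then show ?thesis by simp
qed

theorem corollary4p8:
  fixes P :: "'b measure" and X \<epsilon> :: "'b \<Rightarrow> real"
    and M :: "'a measure" and Ys \<epsilon>s :: "nat \<Rightarrow> 'a \<Rightarrow> real"
    and f_X f_\<epsilon> f_Y :: "real \<Rightarrow> real" and K :: "real \<Rightarrow> complex"
    and a p r s c c' :: real
    and h :: "nat \<Rightarrow> real" and \<alpha> :: "nat \<Rightarrow> nat \<Rightarrow> real"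
    and fY_hat :: "nat \<Rightarrow> 'a \<Rightarrow> real \<Rightarrow> complex"
    and phi_hat :: "nat \<Rightarrow> 'a \<Rightarrow> real \<Rightarrow> complex"
    and fX_hat :: "nat \<Rightarrow> nat \<Rightarrow> 'a \<Rightarrow> real \<Rightarrow> complex"
  defines "f_Y \<equiv> convolve f_X f_\<epsilon>"
    and "h \<equiv> (\<lambda>n. c * real n powr (- 1 / (2 * r + 1)))"
    and "\<alpha> \<equiv> (\<lambda>n m. c' * (real n powr (- r / (2 * r + 1)) + real m powr (- 1 / 2)))"
    and "fY_hat \<equiv> (\<lambda>n \<omega>. kernel_estimator K (h n) n (\<lambda>j. Ys j \<omega>))"
    and "phi_hat \<equiv> (\<lambda>m \<omega>. empirical_fourier m (\<lambda>j. \<epsilon>s j \<omega>))"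
    and "fX_hat \<equiv> (\<lambda>n m \<omega>. deconv_estimator s (\<alpha> n m) (fY_hat n \<omega>) (phi_hat m \<omega>))"
  assumes "f_X \<in> L2_densities" and "f_\<epsilon> \<in> L2_densities"
    and "\<forall>t. (cmod (fourier (cplx f_\<epsilon>) t))\<^sup>2 > 0"
    and "prob_space P" and "prob_space.indep_var P borel X borel \<epsilon>"
    and "has_density P X f_X" and "has_density P \<epsilon> f_\<epsilon>"
    and "prob_space M" and "iid_sample M Ys f_Y" and "iid_sample M \<epsilon>s f_\<epsilon>"
    and "a > 0" and "supersmooth a f_\<epsilon>"
    and "p > 0" and "cplx f_X \<in> sobolev p"
    and "r > 0" and "K \<in> kernel_class r" and "c > 0" and "c' > 0"
    and "0 \<le> s" and "s < p"
  shows "\<exists>C::real. \<forall>\<^sub>F (n, m) in sequentially \<times>\<^sub>F sequentially.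
    (\<integral>\<^sup>+\<omega>. sobolev_norm_sq s (\<lambda>x. fX_hat n m \<omega> x - complex_of_real (f_X x)) \<partial>M)
      \<le> ennreal (C * (ln (real n) powr (- (p - s) / a) + ln (real m) powr (- (p - s) / a)))"
proof -
  have fX: "f_X \<in> L2_densities" and fe: "f_\<epsilon> \<in> L2_densities" by fact+
  have KK: "K \<in> L1 \<inter> L2" using \<open>K \<in> kernel_class r\<close> by (simp add: kernel_class_def)
  let ?u = "fourier_integral (cplx f_X)" and ?\<Phi> = "fourier_integral (cplx f_\<epsilon>)"
  have u2: "?u \<in> L2" by (rule plancherel_L1_L2[OF L2_densityD(3)[OF fX]])
  obtain d where d: "d > 0" and lower: "\<And>t. exp (- ((1 + t\<^sup>2) powr a / d)) \<le> (cmod (?\<Phi> t))\<^sup>2"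
    and upper: "\<And>t. (cmod (?\<Phi> t))\<^sup>2 \<le> exp (- (d * (1 + t\<^sup>2) powr a))"
    using supersmooth_bounds[OF fe \<open>\<forall>t. _\<close> \<open>supersmooth a f_\<epsilon>\<close>] by blast
  obtain G where G: "G \<ge> 0" "(\<integral>\<^sup>+t. ennreal (\<bar>t\<bar> powr (2 * r) * (cmod (complex_of_real (sqrt (2 * pi)) *
      ?u t * ?\<Phi> t))\<^sup>2) \<partial>lborel) \<le> ennreal G"
    using weighted_moment_finite[OF u2 \<open>a > 0\<close> \<open>r > 0\<close> d upper] by blast
  obtain C where C: "C \<ge> 0" "\<And>v. v \<noteq> 0 \<Longrightarrow>
      cmod (1 - complex_of_real (sqrt (2 * pi)) * fourier_integral K v) \<le> C * \<bar>v\<bar> powr r"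
    using kernel_class_bias[OF \<open>r > 0\<close> \<open>K \<in> kernel_class r\<close>] by blast
  define q where "q = (p - s) / a"
  have q: "q > 0" using \<open>s < p\<close> \<open>a > 0\<close> by (simp add: q_def)
  have mq: "- (p - s) / a = - q" by (simp only: q_def minus_divide_left)
  define \<rho> where "\<rho> = r / (2 * r + 1)"
  have \<rho>: "\<rho> > 0" using \<open>r > 0\<close> by (simp add: \<rho>_def)
  have mr: "- r / (2 * r + 1) = - \<rho>" by (simp add: \<rho>_def)
  obtain B1 where B1: "B1 > 0" "\<And>n::nat. n \<ge> 2 \<Longrightarrow> real n powr (- \<rho>) \<le> B1 * ln (real n) powr (- q)"
    using powr_le_ln_powr[OF q \<rho>] by blast
  obtain B2 where B2: "B2 > 0" "\<And>n::nat. n \<ge> 2 \<Longrightarrow> real n powr (- (1 / 2)) \<le> B2 * ln (real n) powr (- q)"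
    using powr_le_ln_powr[OF q, of "1 / 2"] by auto
  define \<eta> where "\<eta> = min (\<rho> / 2) (1 / 4)"
  have \<eta>: "\<eta> > 0" using \<rho> by (simp add: \<eta>_def)
  define \<kappa> where "\<kappa> = 1 / d + s / a"
  have \<kappa>: "\<kappa> > 0" unfolding \<kappa>_def using d \<open>0 \<le> s\<close> \<open>a > 0\<close> by (intro add_pos_nonneg) auto
  define S where "S = enn2real (sobolev_norm_sq p (cplx f_X))"
  have S: "(\<integral>\<^sup>+t. ennreal ((1 + t\<^sup>2) powr p * (cmod (?u t))\<^sup>2) \<partial>lborel) = ennreal S"
    using \<open>cplx f_X \<in> sobolev p\<close> by (simp add: sobolev_def S_def sobolev_norm_sq_def fourier_density[OF fX])
  define E where "E = (\<eta> / \<kappa>) powr (- q)"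
  define A1 where "A1 = 1 / (pi * c') * (2 / c * (L2_norm K)\<^sup>2 + 2 * C\<^sup>2 * c powr (2 * r) * G)"
  define A2 where "A2 = 1 / (pi * c') * (L2_norm (cplx f_X))\<^sup>2"
  have nonneg: "0 \<le> E * S" "0 \<le> A1" "0 \<le> A2"
    using \<open>c > 0\<close> \<open>c' > 0\<close> G(1) by (auto simp: E_def S_def A1_def A2_def)
  define Ct where "Ct = E * S + A1 * B1 + A2 * B2"

  have bound: "(\<integral>\<^sup>+\<omega>. sobolev_norm_sq s (\<lambda>x. fX_hat n m \<omega> x - complex_of_real (f_X x)) \<partial>M)
      \<le> ennreal (Ct * (ln (real n) powr (- q) + ln (real m) powr (- q)))"
    if n: "n \<ge> 2" "ln (8 * c') \<le> \<eta> * ln (real n)" and m: "m \<ge> 2" "ln (8 * c') \<le> \<eta> * ln (real m)" for n m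
  proof -
    define \<mu> where "\<mu> = min (ln (real n)) (ln (real m))"
    have \<mu>: "\<mu> > 0" using n m by (simp add: \<mu>_def)
    have h: "h n > 0" using \<open>c > 0\<close> n by (simp add: h_def)
    have \<alpha>: "\<alpha> n m > 0" using \<open>c' > 0\<close> n m by (auto simp: \<alpha>_def intro!: mult_pos_pos add_pos_pos)
    have log: "\<eta> * \<mu> \<le> - ln (4 * \<alpha> n m)"
      using threshold_log_lower[OF \<rho> \<open>c' > 0\<close> n(1) m(1)] n(2) m(2)
      unfolding \<alpha>_def mr by (simp add: \<eta>_def \<mu>_def)
    have cut: "(\<integral>\<^sup>+t. ennreal (if (cmod (?\<Phi> t))\<^sup>2 < 4 * \<alpha> n m * (1 + t\<^sup>2) powr s
        then (1 + t\<^sup>2) powr s * (cmod (?u t))\<^sup>2 else 0) \<partial>lborel)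
        \<le> ennreal ((\<eta> * \<mu> / \<kappa>) powr (- q) * S)"
      using cut_off_bias[OF \<open>a > 0\<close> d \<open>0 \<le> s\<close> \<open>s < p\<close> \<alpha> _ log lower L2_measurable[OF u2]] \<eta> \<mu>
      unfolding S \<kappa>_def mq by (simp add: ennreal_mult S_def)
    have "(\<integral>\<^sup>+\<omega>. sobolev_norm_sq s (\<lambda>x. fX_hat n m \<omega> x - complex_of_real (f_X x)) \<partial>M)
        \<le> ennreal ((\<eta> * \<mu> / \<kappa>) powr (- q) * S) + ennreal (1 / (pi * \<alpha> n m) * (2 / (real n * h n) * (L2_norm K)\<^sup>2
          + 2 * C\<^sup>2 * h n powr (2 * r) * G + 1 / real m * (L2_norm (cplx f_X))\<^sup>2))"
      unfolding fX_hat_def fY_hat_def phi_hat_def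
    proof (rule order_trans)
      show "(\<integral>\<^sup>+\<omega>. sobolev_norm_sq s (\<lambda>x. deconv_estimator s (\<alpha> n m) (kernel_estimator K (h n) n (\<lambda>j. Ys j \<omega>))
          (empirical_fourier m (\<lambda>j. \<epsilon>s j \<omega>)) x - complex_of_real (f_X x)) \<partial>M)
        \<le> (\<integral>\<^sup>+t. ennreal (if (cmod (?\<Phi> t))\<^sup>2 < 4 * \<alpha> n m * (1 + t\<^sup>2) powr s
          then (1 + t\<^sup>2) powr s * (cmod (?u t))\<^sup>2 else 0) \<partial>lborel)
        + ennreal (1 / (pi * \<alpha> n m) * (2 / (real n * h n) * (L2_norm K)\<^sup>2
          + 2 * C\<^sup>2 * h n powr (2 * r) * G + 1 / real m * (L2_norm (cplx f_X))\<^sup>2))"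
        using n m by (intro deconvolution_risk[OF fX fe \<open>prob_space M\<close> \<open>iid_sample M Ys f_Y\<close>[unfolded f_Y_def]
          \<open>iid_sample M \<epsilon>s f_\<epsilon>\<close> KK C h \<alpha> _ _ \<open>0 \<le> s\<close> G]) auto
    qed (rule add_right_mono[OF cut])
    also have "\<dots> = ennreal ((\<eta> * \<mu> / \<kappa>) powr (- q) * S + 1 / (pi * \<alpha> n m) * (2 / (real n * h n) * (L2_norm K)\<^sup>2
          + 2 * C\<^sup>2 * h n powr (2 * r) * G + 1 / real m * (L2_norm (cplx f_X))\<^sup>2))"
      using \<alpha> h G(1) by (intro ennreal_plus[symmetric]) (auto simp: S_def)
    also have "\<dots> \<le> ennreal (Ct * (ln (real n) powr (- q) + ln (real m) powr (- q)))"
    proof (rule ennreal_leI)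
      define l1 l2 where "l1 = ln (real n) powr (- q)" and "l2 = ln (real m) powr (- q)"
      have l: "l1 \<ge> 0" "l2 \<ge> 0" by (simp_all add: l1_def l2_def)
      have "(\<eta> * \<mu> / \<kappa>) powr (- q) = E * \<mu> powr (- q)"
        using \<eta> \<kappa> \<mu> by (simp add: E_def flip: powr_mult)
      moreover have "E * S * \<mu> powr (- q) \<le> E * S * (l1 + l2)"
        using l unfolding \<mu>_def l1_def l2_def by (intro mult_left_mono nonneg) (simp add: min_def)
      ultimately have 1: "(\<eta> * \<mu> / \<kappa>) powr (- q) * S \<le> E * S * (l1 + l2)"
        by (simp add: mult_ac)
      have "1 / (pi * \<alpha> n m) * (2 / (real n * h n) * (L2_norm K)\<^sup>2
          + 2 * C\<^sup>2 * h n powr (2 * r) * G + 1 / real m * (L2_norm (cplx f_X))\<^sup>2)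
          \<le> A1 * real n powr (- \<rho>) + A2 * real m powr (- (1 / 2))"
        using risk_rate[OF \<open>r > 0\<close> \<open>c > 0\<close> \<open>c' > 0\<close>, of n m "(L2_norm K)\<^sup>2" "C\<^sup>2" G "L2_norm (cplx f_X)"] n m G(1)
        by (simp add: A1_def A2_def \<alpha>_def h_def \<rho>_def)
      also have "\<dots> \<le> A1 * (B1 * l1) + A2 * (B2 * l2)"
        unfolding l1_def l2_def using nonneg n m by (intro add_mono mult_left_mono B1(2) B2(2)) auto
      also have "\<dots> \<le> A1 * (B1 * (l1 + l2)) + A2 * (B2 * (l1 + l2))"
        using l nonneg B1(1) B2(1) by (intro add_mono mult_left_mono) auto
      finally have "(\<eta> * \<mu> / \<kappa>) powr (- q) * S + 1 / (pi * \<alpha> n m) * (2 / (real n * h n) * (L2_norm K)\<^sup>2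
          + 2 * C\<^sup>2 * h n powr (2 * r) * G + 1 / real m * (L2_norm (cplx f_X))\<^sup>2)
          \<le> E * S * (l1 + l2) + (A1 * (B1 * (l1 + l2)) + A2 * (B2 * (l1 + l2)))"
        using 1 by linarith
      also have "\<dots> = Ct * (l1 + l2)" by (simp add: Ct_def algebra_simps)
      finally show "(\<eta> * \<mu> / \<kappa>) powr (- q) * S + 1 / (pi * \<alpha> n m) * (2 / (real n * h n) * (L2_norm K)\<^sup>2
          + 2 * C\<^sup>2 * h n powr (2 * r) * G + 1 / real m * (L2_norm (cplx f_X))\<^sup>2)
          \<le> Ct * (ln (real n) powr (- q) + ln (real m) powr (- q))"
        by (simp add: l1_def l2_def)
    qed
    finally show ?thesis .
  qed
  have ev: "\<forall>\<^sub>F n in sequentially. n \<ge> 2 \<and> ln (8 * c') \<le> \<eta> * ln (real n)"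
  proof -
    have "filterlim (\<lambda>n. \<eta> * ln (real n)) at_top sequentially"
      by (intro filterlim_tendsto_pos_mult_at_top[OF tendsto_const \<eta>]
          filterlim_compose[OF ln_at_top filterlim_real_sequentially])
    then have "\<forall>\<^sub>F n in sequentially. ln (8 * c') \<le> \<eta> * ln (real n)"
      by (simp add: filterlim_at_top)
    then show ?thesis using eventually_ge_at_top[of 2] by eventually_elim simp
  qed
  have "\<forall>\<^sub>F (n, m) in sequentially \<times>\<^sub>F sequentially.
    (\<integral>\<^sup>+\<omega>. sobolev_norm_sq s (\<lambda>x. fX_hat n m \<omega> x - complex_of_real (f_X x)) \<partial>M)
      \<le> ennreal (Ct * (ln (real n) powr (- (p - s) / a) + ln (real m) powr (- (p - s) / a)))"
    using eventually_prodI[OF ev ev] unfolding mq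
    by eventually_elim (use bound in \<open>auto simp: case_prod_beta\<close>)
  then show ?thesis by blast
qed

end
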